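(* Let $n\ge2$, let $S\subset\mathbb{CP}^n$ be a strongly $\mathbb{C}$-convex, simply-connected smooth real hypersurface, and let $\theta$ be a $\mathbb{C}$-valued contact form on $S$, that is, a non-vanishing complex 1-form with $\theta|_{H}\equiv0$. Let $\tilde{d'}$ be a linear operator from smooth functions on $S$ to smooth complex 1-forms on $S$ satisfying $\tilde{d'}u|_H=d'u$ for all $u$, with $d'$ as in the context. Then for every smooth $u\colon S\to\mathbb{C}$ the following conditions are equivalent: (a) $u=f+g$, where $f$ is CR and $g$ is dual-CR; (b) there is a smooth scalar function $\lambda\colon S\to\mathbb{C}$ such that the 1-form $\tilde{d'}u+\lambda\theta$ is closed.
   Context: All objects are smooth ($C^\infty$); $J$ is the standard complex structure; $S$ is not assumed compact. $S$ is strongly $\mathbb{C}$-convex if it is locally projectively equivalent to a strongly convex hypersurface, i.e. near each of its points some projective automorphism of $\mathbb{CP}^n$ maps it to a hypersurface with definite second fundamental form in an affine chart. $H_pS=T_pS\cap JT_pS$, and $|_H$ denotes restriction to the spaces $H_pS$. Projective dual CR structure. Suppose first that $S\subset\mathbb{C}^n$ and no complex tangent hyperplane $p+H_pS$ passes through the origin, i.e. $\sum_m z_m\,\partial\rho/\partial z_m\ne0$ on $S$ for $\rho$ a (local) real-valued defining function. Put $w_j=\frac{\partial\rho/\partial z_j}{\sum_m z_m\,\partial\rho/\partial z_m}$ on $S$ (independent of $\rho$). The map $\mathscr D_S=(w_1,\dots,w_n)\colon S\to\mathbb{C}^n$ is a local diffeomorphism onto a real hypersurface and its derivative carries $H_pS$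 to a complex subspace; set $J^*=(\mathscr D_S'(p))^{-1}\circ J\circ\mathscr D_S'(p)\colon H_pS\to H_pS$. This construction is projectively invariant; for general $S\subset\mathbb{CP}^n$, $J^*$ is defined near each point of $S$ by first applying a projective automorphism after which, near the image of that point, the hypersurface lies in $\mathbb{C}^n$ and none of its complex tangent hyperplanes passes through the origin, and pulling back (the result does not depend on the automorphism). A smooth $f\colon S\to\mathbb{C}$ is CR if $df(Jv)=i\,df(v)$ for all $v\in H_pS$, $p\in S$; a smooth $g\colon S\to\mathbb{C}$ is dual-CR if $dg(J^*v)=i\,dg(v)$ for all $v\in H_pS$, $p\in S$. For smooth $u\colon S\to\mathbb{C}$, $d'u$ and $d''u$ are the uniquely determined smoothly varying $\mathbb{R}$-linear maps $H_pS\to\mathbb{C}$ ($p\in S$) such that $du|_H=d'u+d''u$, $d'u(Jv)=i\,d'u(v)$ and $d''u(J^*v)=i\,d''u(v)$ for $v\in H_pS$. *)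

theory Defs
  imports "HOL-Analysis.Analysis"
begin

section \<open>Smooth maps and real hypersurfaces in complex Euclidean space\<close>

primrec Ck_on :: "nat \<Rightarrow> ('a::euclidean_space \<Rightarrow> 'b::euclidean_space) \<Rightarrow> 'a set \<Rightarrow> bool" where
  "Ck_on 0 f V \<longleftrightarrow> continuous_on V f"
| "Ck_on (Suc k) f V \<longleftrightarrow>
     f differentiable_on V \<and> (\<forall>v. Ck_on k (\<lambda>x. frechet_derivative f (at x) v) V)"

text \<open>Real \<open>C\<^sup>\<infinity>\<close> smoothness; only meaningful (and only used) for open \<open>V\<close>.\<close>

definition smooth_on :: "('a::euclidean_space \<Rightarrow> 'b::euclidean_space) \<Rightarrow> 'a set \<Rightarrow> bool" where
  "smooth_on f V \<longleftrightarrow> (\<forall>k. Ck_on k f V)"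

text \<open>Smoothness on a possibly non-open set: local extendability to a smooth map.\<close>

definition smooth_on_subset :: "('a::euclidean_space \<Rightarrow> 'b::euclidean_space) \<Rightarrow> 'a set \<Rightarrow> bool" where
  "smooth_on_subset f M \<longleftrightarrow>
     (\<forall>z\<in>M. \<exists>V F. open V \<and> z \<in> V \<and> smooth_on F V \<and> (\<forall>x\<in>V \<inter> M. F x = f x))"

definition defining_function ::
    "('a::euclidean_space) set \<Rightarrow> 'a set \<Rightarrow> ('a \<Rightarrow> real) \<Rightarrow> bool" where
  "defining_function M V \<rho> \<longleftrightarrow>
     open V \<and> smooth_on \<rho> V \<and> V \<inter> M = {x \<in> V. \<rho> x = 0} \<and>
     (\<forall>x\<in>V \<inter> M. frechet_derivative \<rho> (at x) \<noteq> (\<lambda>_. 0))"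

definition smooth_hypersurface :: "('a::euclidean_space) set \<Rightarrow> bool" where
  "smooth_hypersurface M \<longleftrightarrow> (\<forall>z\<in>M. \<exists>V \<rho>. z \<in> V \<and> defining_function M V \<rho>)"

definition tangent_space :: "('a::euclidean_space) set \<Rightarrow> 'a \<Rightarrow> 'a set" where
  "tangent_space M z =
     {v. \<exists>V \<rho>. z \<in> V \<inter> M \<and> defining_function M V \<rho> \<and> frechet_derivative \<rho> (at z) v = 0}"

definition gradient :: "('a::euclidean_space \<Rightarrow> real) \<Rightarrow> 'a \<Rightarrow> 'a" where
  "gradient \<rho> z = (\<Sum>b\<in>Basis. frechet_derivative \<rho> (at z) b *\<^sub>R b)"

text \<open>The second fundamental form with respect to the unit normal field
  \<open>\<nabla>\<rho> / \<bar>\<nabla>\<rho>\<bar>\<close>; another choice of \<open>\<rho>\<close> changes it at most by a sign.\<close>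

definition second_fundamental_form :: "('a::euclidean_space \<Rightarrow> real) \<Rightarrow> 'a \<Rightarrow> 'a \<Rightarrow> 'a \<Rightarrow> real" where
  "second_fundamental_form \<rho> z v w =
     frechet_derivative (\<lambda>x. gradient \<rho> x /\<^sub>R norm (gradient \<rho> x)) (at z) v \<bullet> w"

definition definite_second_fundamental_form :: "('a::euclidean_space) set \<Rightarrow> 'a \<Rightarrow> bool" where
  "definite_second_fundamental_form M z \<longleftrightarrow>
     (\<exists>V \<rho>. z \<in> V \<inter> M \<and> defining_function M V \<rho> \<and>
        ((\<forall>v\<in>tangent_space M z. v \<noteq> 0 \<longrightarrow> second_fundamental_form \<rho> z v v > 0) \<or>
         (\<forall>v\<in>tangent_space M z. v \<noteq> 0 \<longrightarrow> second_fundamental_form \<rho> z v v < 0)))"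

definition complex_tangent_space :: "(complex^'n::finite) set \<Rightarrow> complex^'n \<Rightarrow> (complex^'n) set" where
  "complex_tangent_space M z = tangent_space M z \<inter> (\<lambda>v. \<i> *s v) ` tangent_space M z"


section \<open>The dual CR structure of a hypersurface in complex Euclidean space\<close>

text \<open>\<open>wirtinger \<rho> z j\<close> is \<open>\<partial>\<rho>/\<partial>z\<^sub>j = (\<partial>\<rho>/\<partial>x\<^sub>j - \<i> \<partial>\<rho>/\<partial>y\<^sub>j) / 2\<close> at \<open>z\<close>.\<close>

definition wirtinger :: "(complex^'n::finite \<Rightarrow> real) \<Rightarrow> complex^'n \<Rightarrow> 'n \<Rightarrow> complex" where
  "wirtinger \<rho> z j =
     (complex_of_real (frechet_derivative \<rho> (at z) (axis j 1)) -
      \<i> * complex_of_real (frechet_derivative \<rho> (at z) (axis j \<i>))) / 2"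

text \<open>No complex tangent hyperplane of \<open>M\<close> at a point of \<open>V\<close> passes through the origin.\<close>

definition tangents_avoid_origin :: "(complex^'n::finite) set \<Rightarrow> (complex^'n) set \<Rightarrow> bool" where
  "tangents_avoid_origin M V \<longleftrightarrow> (\<forall>z\<in>V \<inter> M. 0 \<notin> (\<lambda>v. z + v) ` complex_tangent_space M z)"

text \<open>The map \<open>(w\<^sub>1, \<dots>, w\<^sub>n)\<close>; its value at a point of \<open>M\<close> does not depend on \<open>\<rho>\<close>.\<close>

definition dual_map :: "(complex^'n::finite) set \<Rightarrow> complex^'n \<Rightarrow> complex^'n" where
  "dual_map M z =
     (THE w. \<exists>V \<rho>. z \<in> V \<inter> M \<and> defining_function M V \<rho> \<and>
        w = (\<chi> j. wirtinger \<rho> z j / (\<Sum>m\<in>UNIV. z $ m * wirtinger \<rho> z m)))"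

text \<open>Here and below, the derivative of a map on a hypersurface is the Frechet derivative within
  the hypersurface. As a linear map on the whole space it is not unique, but its restriction to
  the tangent space of the hypersurface is, and it is only ever applied to tangent vectors.\<close>

definition affine_dual_J :: "(complex^'n::finite) set \<Rightarrow> complex^'n \<Rightarrow> complex^'n \<Rightarrow> complex^'n" where
  "affine_dual_J M z v =
     (let D = frechet_derivative (dual_map M) (at z within M)
      in inv_into (complex_tangent_space M z) D (\<i> *s D v))"


section \<open>Complex projective space and its tangent bundle\<close>

text \<open>With \<open>n = CARD('n)\<close>, \<open>'n cp\<close> is \<open>\<complex>\<P>\<^sup>n\<close>; the homogeneous coordinates
  are indexed by \<open>'n option\<close>.\<close>

definition proj_rel :: "complex^(('n::finite) option) \<Rightarrow> complex^('n option) \<Rightarrow> bool" where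
  "proj_rel Z W \<longleftrightarrow> Z \<noteq> 0 \<and> (\<exists>c. c \<noteq> 0 \<and> W = c *s Z)"

lemma part_equivp_proj_rel: "part_equivp (proj_rel :: complex^(('n::finite) option) \<Rightarrow> _)"
proof (rule part_equivpI)
  show "\<exists>Z :: complex^('n option). proj_rel Z Z"
    by (rule exI[of _ "axis None 1"])
      (auto simp: proj_rel_def axis_eq_0_iff intro!: exI[of _ 1])
  show "symp (proj_rel :: complex^('n option) \<Rightarrow> _)"
  proof (rule sympI)
    fix Z W :: "complex^('n option)"
    assume "proj_rel Z W"
    then obtain c where "Z \<noteq> 0" "c \<noteq> 0" "W = c *s Z"
      by (auto simp: proj_rel_def)
    then show "proj_rel W Z"
      by (auto simp: proj_rel_def vector_smult_assoc intro!: exI[of _ "inverse c"])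
  qed
  show "transp (proj_rel :: complex^('n option) \<Rightarrow> _)"
  proof (rule transpI)
    fix Z W X :: "complex^('n option)"
    assume "proj_rel Z W" "proj_rel W X"
    then obtain c d where "Z \<noteq> 0" "c \<noteq> 0" "d \<noteq> 0" "X = d *s (c *s Z)"
      by (auto simp: proj_rel_def)
    then show "proj_rel Z X"
      by (auto simp: proj_rel_def vector_smult_assoc intro!: exI[of _ "d * c"])
  qed
qed

quotient_type (overloaded) 'n cp = "complex^(('n::finite) option)" / partial: proj_rel
  by (rule part_equivp_proj_rel)

text \<open>The quotient topology.\<close>

instantiation cp :: (finite) topological_space
begin

definition open_cp :: "'a cp set \<Rightarrow> bool" where
  "open_cp U \<longleftrightarrow> open {Z :: complex^('a option). Z \<noteq> 0 \<and> abs_cp Z \<in> U}"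

instance
proof
  have "open (- {0 :: complex^('a option)})"
    by (rule open_Compl) simp
  also have "- {0 :: complex^('a option)} = {Z. Z \<noteq> 0 \<and> abs_cp Z \<in> UNIV}"
    by auto
  finally show "open (UNIV :: 'a cp set)"
    unfolding open_cp_def .
next
  fix U U' :: "'a cp set"
  assume "open U" "open U'"
  then have "open ({Z :: complex^('a option). Z \<noteq> 0 \<and> abs_cp Z \<in> U} \<inter>
                   {Z. Z \<noteq> 0 \<and> abs_cp Z \<in> U'})"
    unfolding open_cp_def by (rule open_Int)
  also have "\<dots> = {Z. Z \<noteq> 0 \<and> abs_cp Z \<in> U \<inter> U'}"
    by auto
  finally show "open (U \<inter> U')"
    unfolding open_cp_def .
next
  fix \<U> :: "'a cp set set"
  assume "\<forall>U\<in>\<U>. open U"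
  then have "open (\<Union>U\<in>\<U>. {Z :: complex^('a option). Z \<noteq> 0 \<and> abs_cp Z \<in> U})"
    unfolding open_cp_def by (intro open_UN) auto
  also have "(\<Union>U\<in>\<U>. {Z :: complex^('a option). Z \<noteq> 0 \<and> abs_cp Z \<in> U}) =
             {Z. Z \<noteq> 0 \<and> abs_cp Z \<in> \<Union>\<U>}"
    by auto
  finally show "open (\<Union>\<U>)"
    unfolding open_cp_def .
qed

end

text \<open>The class of \<open>(Z, V)\<close> is the image of \<open>V\<close> under the derivative at \<open>Z\<close> of the projection
  \<open>Z \<mapsto> [Z]\<close>. That derivative has kernel \<open>\<complex> Z\<close>, and the projection is invariant under
  \<open>Z \<mapsto> c Z\<close>; hence the identification of \<open>(Z, V)\<close> with \<open>(c Z, c V + k Z)\<close>.\<close>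

definition tangent_rel ::
    "(complex^(('n::finite) option)) \<times> (complex^('n option)) \<Rightarrow>
     (complex^('n option)) \<times> (complex^('n option)) \<Rightarrow> bool" where
  "tangent_rel \<sigma> \<tau> \<longleftrightarrow> fst \<sigma> \<noteq> 0 \<and>
     (\<exists>c k. c \<noteq> 0 \<and> fst \<tau> = c *s fst \<sigma> \<and> snd \<tau> = c *s snd \<sigma> + k *s fst \<sigma>)"

lemma part_equivp_tangent_rel:
  "part_equivp (tangent_rel :: (complex^(('n::finite) option)) \<times> (complex^('n option)) \<Rightarrow> _)"
proof (rule part_equivpI)
  show "\<exists>\<sigma> :: (complex^('n option)) \<times> (complex^('n option)). tangent_rel \<sigma> \<sigma>"
    unfolding tangent_rel_def
    by (intro exI[of _ "(axis None 1, 0)"] conjI exI[of _ "1 :: complex"] exI[of _ "0 :: complex"])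
      (simp_all add: axis_eq_0_iff)
  show "symp (tangent_rel :: (complex^('n option)) \<times> (complex^('n option)) \<Rightarrow> _)"
  proof (rule sympI)
    fix \<sigma> \<tau> :: "(complex^('n option)) \<times> (complex^('n option))"
    assume "tangent_rel \<sigma> \<tau>"
    then obtain c k where *: "fst \<sigma> \<noteq> 0" "c \<noteq> 0" "fst \<tau> = c *s fst \<sigma>"
        "snd \<tau> = c *s snd \<sigma> + k *s fst \<sigma>"
      by (auto simp: tangent_rel_def)
    then have "fst \<sigma> = inverse c *s fst \<tau>"
      by (simp add: vector_smult_assoc)
    moreover from * have "snd \<sigma> = inverse c *s snd \<tau> + (- k / c / c) *s fst \<tau>"
      by (simp add: vec_eq_iff field_simps)
    ultimately show "tangent_rel \<tau> \<sigma>"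
      using * unfolding tangent_rel_def
      by (intro conjI exI[of _ "inverse c"] exI[of _ "- k / c / c"]) auto
  qed
  show "transp (tangent_rel :: (complex^('n option)) \<times> (complex^('n option)) \<Rightarrow> _)"
  proof (rule transpI)
    fix \<sigma> \<tau> \<upsilon> :: "(complex^('n option)) \<times> (complex^('n option))"
    assume "tangent_rel \<sigma> \<tau>" "tangent_rel \<tau> \<upsilon>"
    then obtain c k d l where "fst \<sigma> \<noteq> 0" "c \<noteq> 0" "d \<noteq> 0"
        "fst \<upsilon> = d *s (c *s fst \<sigma>)"
        "snd \<upsilon> = d *s (c *s snd \<sigma> + k *s fst \<sigma>) + l *s (c *s fst \<sigma>)"
      by (auto simp: tangent_rel_def)
    then show "tangent_rel \<sigma> \<upsilon>"
      unfolding tangent_rel_def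
      by (intro conjI exI[of _ "d * c"] exI[of _ "d * k + l * c"])
        (auto simp: vec_eq_iff algebra_simps)
  qed
qed

quotient_type (overloaded) 'n cp_tangent =
    "(complex^(('n::finite) option)) \<times> (complex^('n option))" / partial: tangent_rel
  by (rule part_equivp_tangent_rel)

lift_definition base :: "('n::finite) cp_tangent \<Rightarrow> 'n cp" is fst
  by (auto simp: tangent_rel_def proj_rel_def)

lift_definition tangent_J :: "('n::finite) cp_tangent \<Rightarrow> 'n cp_tangent" is
  "\<lambda>(Z, V). (Z, \<i> *s V)"
proof -
  fix \<sigma> \<tau> :: "(complex^('n option)) \<times> (complex^('n option))"
  assume "tangent_rel \<sigma> \<tau>"
  then obtain c k where "fst \<sigma> \<noteq> 0" "c \<noteq> 0" "fst \<tau> = c *s fst \<sigma>"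
      "snd \<tau> = c *s snd \<sigma> + k *s fst \<sigma>"
    by (auto simp: tangent_rel_def)
  then show "tangent_rel (case \<sigma> of (Z, V) \<Rightarrow> (Z, \<i> *s V)) (case \<tau> of (Z, V) \<Rightarrow> (Z, \<i> *s V))"
    unfolding tangent_rel_def
    by (intro conjI exI[of _ c] exI[of _ "\<i> * k"])
      (auto simp: case_prod_beta vec_eq_iff algebra_simps)
qed

definition homog :: "complex \<Rightarrow> complex^'n::finite \<Rightarrow> complex^('n option)" where
  "homog c z = (\<chi> i. case i of None \<Rightarrow> c | Some j \<Rightarrow> z $ j)"

text \<open>For invertible \<open>A\<close>, \<open>chart A\<close> is the standard affine embedding \<open>z \<mapsto> [1 : z]\<close> followed by the
  projective automorphism \<open>[Z] \<mapsto> [A Z]\<close>, and \<open>dchart A z v\<close> is the image of the vector \<open>v\<close> at \<open>z\<close>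
  under its derivative. Hence \<open>affine_part A S\<close> is the part in the standard affine chart of the
  image of \<open>S\<close> under the projective automorphism given by the inverse of \<open>A\<close>.\<close>

definition chart :: "complex^(('n::finite) option)^('n option) \<Rightarrow> complex^'n \<Rightarrow> 'n cp" where
  "chart A z = abs_cp (A *v homog 1 z)"

definition dchart ::
    "complex^(('n::finite) option)^('n option) \<Rightarrow> complex^'n \<Rightarrow> complex^'n \<Rightarrow> 'n cp_tangent" where
  "dchart A z v = abs_cp_tangent (A *v homog 1 z, A *v homog 0 v)"

definition affine_part ::
    "complex^(('n::finite) option)^('n option) \<Rightarrow> 'n cp set \<Rightarrow> (complex^'n) set" where
  "affine_part A S = {z. chart A z \<in> S}"


section \<open>Hypersurfaces in complex projective space\<close>

definition smooth_cp_hypersurface :: "('n::finite) cp set \<Rightarrow> bool" where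
  "smooth_cp_hypersurface S \<longleftrightarrow> (\<forall>A. invertible A \<longrightarrow> smooth_hypersurface (affine_part A S))"

definition strongly_C_convex :: "('n::finite) cp set \<Rightarrow> bool" where
  "strongly_C_convex S \<longleftrightarrow>
     (\<forall>p\<in>S. \<exists>A z V. invertible A \<and> chart A z = p \<and> open V \<and> z \<in> V \<and>
        (\<forall>x\<in>V \<inter> affine_part A S. definite_second_fundamental_form (affine_part A S) x))"

definition T :: "('n::finite) cp set \<Rightarrow> 'n cp \<Rightarrow> 'n cp_tangent set" where
  "T S p = {dchart A z v | A z v. invertible A \<and> chart A z = p \<and>
                                   z \<in> affine_part A S \<and> v \<in> tangent_space (affine_part A S) z}"

definition H :: "('n::finite) cp set \<Rightarrow> 'n cp \<Rightarrow> 'n cp_tangent set" where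
  "H S p = T S p \<inter> tangent_J ` T S p"

text \<open>The value does not depend on the automorphism \<open>A\<close> used to compute it.\<close>

definition dual_J :: "('n::finite) cp set \<Rightarrow> 'n cp_tangent \<Rightarrow> 'n cp_tangent" where
  "dual_J S \<tau> =
     (THE \<sigma>. \<exists>A z v V. invertible A \<and> z \<in> affine_part A S \<and>
        open V \<and> z \<in> V \<and> tangents_avoid_origin (affine_part A S) V \<and>
        v \<in> complex_tangent_space (affine_part A S) z \<and> \<tau> = dchart A z v \<and>
        \<sigma> = dchart A z (affine_dual_J (affine_part A S) z v))"


section \<open>Functions and 1-forms on a hypersurface\<close>

text \<open>Functions on \<open>S\<close> are represented by functions on \<open>'n cp\<close> of which only the values on \<open>S\<close>
  matter, and complex 1-forms on \<open>S\<close> by functions on \<open>'n cp_tangent\<close> of which only the values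
  on \<open>T S p\<close>, for \<open>p \<in> S\<close>, matter.\<close>

definition smooth_function :: "('n::finite) cp set \<Rightarrow> ('n cp \<Rightarrow> complex) \<Rightarrow> bool" where
  "smooth_function S u \<longleftrightarrow>
     (\<forall>A. invertible A \<longrightarrow> smooth_on_subset (\<lambda>z. u (chart A z)) (affine_part A S))"

text \<open>The differential; the value does not depend on the chart used to compute it.\<close>

definition differential :: "('n::finite) cp set \<Rightarrow> ('n cp \<Rightarrow> complex) \<Rightarrow> 'n cp_tangent \<Rightarrow> complex" where
  "differential S u \<tau> =
     (THE c. \<exists>A z v. invertible A \<and> z \<in> affine_part A S \<and>
        v \<in> tangent_space (affine_part A S) z \<and> \<tau> = dchart A z v \<and>
        c = frechet_derivative (\<lambda>x. u (chart A x)) (at z within affine_part A S) v)"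

text \<open>\<open>form_extension S E A \<omega> V \<alpha>\<close>: on the open set \<open>V\<close> of the chart \<open>A\<close>, the smooth complex 1-form
  \<open>\<alpha>\<close> extends the restriction of \<open>\<omega>\<close> to the spaces \<open>E p\<close> for \<open>p \<in> S\<close>. Below, \<open>E\<close> is \<open>T S\<close> or
  \<open>H S\<close>; for \<open>E = H S\<close>, \<open>smooth_form S E \<omega>\<close> says that \<open>\<omega>\<close> is a smoothly varying family of real-linear
  maps from the spaces \<open>H S p\<close> to \<open>\<complex>\<close>.\<close>

definition form_extension ::
    "('n::finite) cp set \<Rightarrow> ('n cp \<Rightarrow> 'n cp_tangent set) \<Rightarrow> complex^('n option)^('n option) \<Rightarrow>
     ('n cp_tangent \<Rightarrow> complex) \<Rightarrow> (complex^'n) set \<Rightarrow>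
     (complex^'n \<Rightarrow> complex^'n \<Rightarrow> complex) \<Rightarrow> bool" where
  "form_extension S E A \<omega> V \<alpha> \<longleftrightarrow>
     open V \<and> (\<forall>x\<in>V. linear (\<alpha> x)) \<and> (\<forall>v. smooth_on (\<lambda>x. \<alpha> x v) V) \<and>
     (\<forall>x\<in>V \<inter> affine_part A S. \<forall>v. dchart A x v \<in> E (chart A x) \<longrightarrow> \<omega> (dchart A x v) = \<alpha> x v)"

definition smooth_form ::
    "('n::finite) cp set \<Rightarrow> ('n cp \<Rightarrow> 'n cp_tangent set) \<Rightarrow> ('n cp_tangent \<Rightarrow> complex) \<Rightarrow> bool" where
  "smooth_form S E \<omega> \<longleftrightarrow>
     (\<forall>A z. invertible A \<and> z \<in> affine_part A S \<longrightarrow> (\<exists>V \<alpha>. z \<in> V \<and> form_extension S E A \<omega> V \<alpha>))"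

text \<open>\<open>d\<omega> = 0\<close> on \<open>S\<close>: the exterior derivative of a local extension \<open>\<alpha>\<close>, which is
  \<open>d\<alpha>(v, w) = D\<^sub>v(\<alpha> w) - D\<^sub>w(\<alpha> v)\<close> for constant \<open>v\<close> and \<open>w\<close>, vanishes on pairs of tangent
  vectors of \<open>S\<close>. By naturality of the exterior derivative the choice of \<open>\<alpha>\<close> does not matter.\<close>

definition closed_form :: "('n::finite) cp set \<Rightarrow> ('n cp_tangent \<Rightarrow> complex) \<Rightarrow> bool" where
  "closed_form S \<omega> \<longleftrightarrow>
     (\<forall>A z. invertible A \<and> z \<in> affine_part A S \<longrightarrow>
        (\<exists>V \<alpha>. z \<in> V \<and> form_extension S (T S) A \<omega> V \<alpha> \<and>
           (\<forall>x\<in>V \<inter> affine_part A S.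
            \<forall>v\<in>tangent_space (affine_part A S) x. \<forall>w\<in>tangent_space (affine_part A S) x.
              frechet_derivative (\<lambda>y. \<alpha> y w) (at x) v - frechet_derivative (\<lambda>y. \<alpha> y v) (at x) w = 0)))"

definition contact_form :: "('n::finite) cp set \<Rightarrow> ('n cp_tangent \<Rightarrow> complex) \<Rightarrow> bool" where
  "contact_form S \<theta> \<longleftrightarrow>
     smooth_form S (T S) \<theta> \<and> (\<forall>p\<in>S. \<exists>\<tau>\<in>T S p. \<theta> \<tau> \<noteq> 0) \<and> (\<forall>p\<in>S. \<forall>\<tau>\<in>H S p. \<theta> \<tau> = 0)"

text \<open>A linear operator from smooth functions on \<open>S\<close> to smooth complex 1-forms on \<open>S\<close>. The case
  \<open>a = 1\<close>, \<open>b = 0\<close> of the last clause says that the form on \<open>S\<close> depends only on the function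
  on \<open>S\<close>.\<close>

definition linear_form_operator ::
    "('n::finite) cp set \<Rightarrow> (('n cp \<Rightarrow> complex) \<Rightarrow> 'n cp_tangent \<Rightarrow> complex) \<Rightarrow> bool" where
  "linear_form_operator S D \<longleftrightarrow>
     (\<forall>u. smooth_function S u \<longrightarrow> smooth_form S (T S) (D u)) \<and>
     (\<forall>u v w a b. smooth_function S u \<and> smooth_function S v \<and> smooth_function S w \<and>
        (\<forall>p\<in>S. w p = a * u p + b * v p) \<longrightarrow>
        (\<forall>p\<in>S. \<forall>\<tau>\<in>T S p. D w \<tau> = a * D u \<tau> + b * D v \<tau>))"

definition CR :: "('n::finite) cp set \<Rightarrow> ('n cp \<Rightarrow> complex) \<Rightarrow> bool" where
  "CR S f \<longleftrightarrow> smooth_function S f \<and>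
     (\<forall>p\<in>S. \<forall>\<tau>\<in>H S p. differential S f (tangent_J \<tau>) = \<i> * differential S f \<tau>)"

definition dual_CR :: "('n::finite) cp set \<Rightarrow> ('n cp \<Rightarrow> complex) \<Rightarrow> bool" where
  "dual_CR S g \<longleftrightarrow> smooth_function S g \<and>
     (\<forall>p\<in>S. \<forall>\<tau>\<in>H S p. differential S g (dual_J S \<tau>) = \<i> * differential S g \<tau>)"

text \<open>\<open>is_d_split S u a b\<close>: on the spaces \<open>H S p\<close>, \<open>a\<close> is \<open>d'u\<close> and \<open>b\<close> is \<open>d''u\<close>.\<close>

definition is_d_split ::
    "('n::finite) cp set \<Rightarrow> ('n cp \<Rightarrow> complex) \<Rightarrow> ('n cp_tangent \<Rightarrow> complex) \<Rightarrow>
     ('n cp_tangent \<Rightarrow> complex) \<Rightarrow> bool" where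
  "is_d_split S u a b \<longleftrightarrow> smooth_form S (H S) a \<and> smooth_form S (H S) b \<and>
     (\<forall>p\<in>S. \<forall>\<tau>\<in>H S p. differential S u \<tau> = a \<tau> + b \<tau> \<and>
        a (tangent_J \<tau>) = \<i> * a \<tau> \<and> b (dual_J S \<tau>) = \<i> * b \<tau>)"

definition restricts_to_d' ::
    "('n::finite) cp set \<Rightarrow> ('n cp \<Rightarrow> complex) \<Rightarrow> ('n cp_tangent \<Rightarrow> complex) \<Rightarrow> bool" where
  "restricts_to_d' S u a \<longleftrightarrow> (\<exists>b. is_d_split S u a b)"

end

theory Submission
  imports Defs
begin

text \<open>Suppose first that the form \<open>Dt u + l \<theta>\<close> is closed. Since \<open>S\<close> is simply connected, it is the
  differential of a smooth function \<open>f\<close>. On the complex tangent spaces \<open>H\<close> the contact form vanishes,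
  so there \<open>df = d'u\<close> is complex linear for \<open>J\<close>, and \<open>d(u - f) = d''u\<close> is complex linear for \<open>J*\<close>:
  \<open>f\<close> is CR and \<open>u - f\<close> is dual-CR.

  Conversely, let \<open>u = f + g\<close> with \<open>f\<close> CR and \<open>g\<close> dual-CR. On \<open>H\<close>, the difference
  \<open>df - d'u = d''u - dg\<close> is complex linear both for \<open>J\<close> and for \<open>J*\<close>. Strong \<open>\<complex>\<close>-convexity makes
  \<open>J - J*\<close> surjective on \<open>H\<close>, so the difference vanishes there
  (\<open>real_linear_J_dual_J_linear_eq_0\<close>). Then \<open>df - Dt u\<close> is a smooth multiple \<open>l \<theta>\<close> of the contact
  form (\<open>form_vanishing_on_H_eq_multiple\<close>), and \<open>Dt u + l \<theta> = df\<close> is closed.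

  The convexity hypothesis enters through the Gauss map, which sends a point to its complex tangent
  hyperplane. A conormal lift represents it by covectors in homogeneous coordinates. Two lifts are
  proportional, so their derivatives agree up to a factor modulo the lift
  (\<open>conormal_lift_derivative\<close>); this makes every relation between these derivatives that is complex
  linear modulo the lift independent of the chart (\<open>conormal_lift_transfer\<close>). In a convex chart the
  complex gradient of a defining function gives a lift, and the real part of its derivative along
  \<open>v\<close>, paired with \<open>v\<close>, is a positive multiple of the second fundamental form at \<open>v\<close>. Definiteness
  therefore shows that the derivative of the Gauss map is injective on \<open>H\<close>, so that \<open>J*\<close> is well
  defined, and that it does not commute with multiplication by \<open>\<i>\<close> on any nonzero vector of \<open>H\<close>, so
  that \<open>J - J*\<close> is injective, and hence surjective, on \<open>H\<close> (\<open>strongly_C_convex_conormal_lift\<close>).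

  The primitive of a closed form on \<open>S\<close> is found locally by flattening the hypersurface
  (\<open>hypersurface_flattening\<close>) and applying the Poincare lemma on a ball. Two local primitives differ
  by a locally constant function, and such local solutions of a problem fit together to a global one
  on a simply connected set by continuation along paths (\<open>global_solution\<close>).\<close>


section \<open>Calculus of smooth maps\<close>

abbreviation FD :: "('a::euclidean_space \<Rightarrow> 'b::euclidean_space) \<Rightarrow> 'a \<Rightarrow> 'a \<Rightarrow> 'b" where
  "FD f x \<equiv> frechet_derivative f (at x)"

lemma FD_eqI: "(f has_derivative f') (at x) \<Longrightarrow> FD f x = f'"
  by (metis frechet_derivative_at)

lemma differentiable_on_openD:
  assumes "f differentiable_on V" "open V" "x \<in> V"
  shows "(f has_derivative FD f x) (at x)"
  using assms differentiable_on_eq_differentiable_at frechet_derivative_works by blast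

lemma Ck_on_SucD:
  assumes "Ck_on (Suc k) f V" "open V"
  shows "x \<in> V \<Longrightarrow> (f has_derivative FD f x) (at x)" "Ck_on k (\<lambda>x. FD f x v) V"
  using assms differentiable_on_openD by auto

lemma Ck_on_cong:
  assumes "open V"
  shows "Ck_on k f V \<Longrightarrow> (\<And>x. x \<in> V \<Longrightarrow> f x = g x) \<Longrightarrow> Ck_on k g V"
proof (induction k arbitrary: f g)
  case 0
  then show ?case using continuous_on_cong[of V V f g] by simp
next
  case (Suc k)
  have D: "(g has_derivative FD f x) (at x)" if "x \<in> V" for x
    by (rule has_derivative_transform_within_open[OF _ \<open>open V\<close> that Suc.prems(2)])
      (use Ck_on_SucD(1)[OF Suc.prems(1) \<open>open V\<close>] that in auto)
  then have "g differentiable_on V"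
    by (meson differentiable_at_imp_differentiable_on differentiableI)
  moreover have "Ck_on k (\<lambda>x. FD g x v) V" for v
    by (rule Suc.IH[OF Ck_on_SucD(2)[OF Suc.prems(1) \<open>open V\<close>, of v]]) (simp add: FD_eqI[OF D])
  ultimately show ?case by simp
qed

lemma Ck_on_SucI:
  assumes "open V" "\<And>x. x \<in> V \<Longrightarrow> (f has_derivative D x) (at x)"
    and "\<And>v. Ck_on k (\<lambda>x. D x v) V"
  shows "Ck_on (Suc k) f V"
proof -
  have "f differentiable_on V"
    using assms(1,2) by (meson differentiable_at_imp_differentiable_on differentiableI)
  moreover have "Ck_on k (\<lambda>x. FD f x v) V" for v
    by (rule Ck_on_cong[OF assms(1) assms(3)[of v]]) (simp add: FD_eqI[OF assms(2)])
  ultimately show ?thesis by simp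
qed

lemma Ck_on_subset: "Ck_on k f V \<Longrightarrow> W \<subseteq> V \<Longrightarrow> Ck_on k f W"
  by (induction k arbitrary: f) (auto intro: continuous_on_subset differentiable_on_subset)

lemma Ck_on_SucD': "Ck_on (Suc k) f V \<Longrightarrow> Ck_on k f V"
  by (induction k arbitrary: f) (auto intro: differentiable_imp_continuous_on)

lemma Ck_on_const: "open V \<Longrightarrow> Ck_on k (\<lambda>x. c) V"
proof (induction k arbitrary: c)
  case (Suc k)
  show ?case by (rule Ck_on_SucI[OF \<open>open V\<close>, of _ "\<lambda>_ _. 0"]) (use Suc \<open>open V\<close> in auto)
qed simp

lemma Ck_on_linear:
  assumes "linear f" "open V" shows "Ck_on k f V"
proof (cases k)
  case 0
  then show ?thesis using assms linear_continuous_on linear_conv_bounded_linear by auto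
next
  case (Suc j)
  show ?thesis unfolding Suc
    by (rule Ck_on_SucI[OF \<open>open V\<close>, of _ "\<lambda>_. f"])
      (use assms linear_imp_has_derivative Ck_on_const in auto)
qed

lemma Ck_on_add:
  assumes "open V" shows "Ck_on k f V \<Longrightarrow> Ck_on k g V \<Longrightarrow> Ck_on k (\<lambda>x. f x + g x) V"
proof (induction k arbitrary: f g)
  case (Suc k)
  note f = Ck_on_SucD[OF Suc.prems(1) assms] and g = Ck_on_SucD[OF Suc.prems(2) assms]
  show ?case
    by (rule Ck_on_SucI[OF assms has_derivative_add[OF f(1) g(1)] Suc.IH[OF f(2) g(2)]])
qed (auto intro: continuous_intros)

lemma Ck_on_sum:
  assumes "open V" shows "(\<And>i. i \<in> I \<Longrightarrow> Ck_on k (f i) V) \<Longrightarrow> Ck_on k (\<lambda>x. \<Sum>i\<in>I. f i x) V"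
  by (induction I rule: infinite_finite_induct) (auto intro: Ck_on_const Ck_on_add assms)

lemma Ck_on_bilinear:
  assumes "open V" and h: "bounded_bilinear h"
  shows "Ck_on k f V \<Longrightarrow> Ck_on k g V \<Longrightarrow> Ck_on k (\<lambda>x. h (f x) (g x)) V"
proof (induction k arbitrary: f g)
  case 0
  then show ?case using bounded_bilinear.continuous_on[OF h] by auto
next
  case (Suc k)
  note f = Ck_on_SucD[OF Suc.prems(1) assms(1)] and g = Ck_on_SucD[OF Suc.prems(2) assms(1)]
  show ?case
    by (rule Ck_on_SucI[OF assms(1) bounded_bilinear.FDERIV[OF h f(1) g(1)]])
      (auto intro!: Ck_on_add[OF assms(1)] Suc.IH f(2) g(2) Suc.prems[THEN Ck_on_SucD'])
qed

lemma linear_sum_Basis: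
  assumes "linear f" shows "f v = (\<Sum>b\<in>Basis. (v \<bullet> b) *\<^sub>R f b)"
proof -
  have "f v = f (\<Sum>b\<in>Basis. (v \<bullet> b) *\<^sub>R b)" by (simp add: euclidean_representation)
  also have "\<dots> = (\<Sum>b\<in>Basis. (v \<bullet> b) *\<^sub>R f b)"
    by (simp add: linear_sum[OF assms] linear_scale[OF assms])
  finally show ?thesis .
qed

text \<open>In a family of linear maps the vector may move with the point: expanding it in a basis leaves
  only smooth coefficients and values on fixed vectors.\<close>

lemma Ck_on_linear_family:
  assumes "open V" "\<And>x. x \<in> V \<Longrightarrow> linear (\<alpha> x)" "\<And>b. Ck_on k (\<lambda>x. \<alpha> x b) V" "Ck_on k w V"
  shows "Ck_on k (\<lambda>x. \<alpha> x (w x)) V"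
proof -
  have "Ck_on k (\<lambda>x. \<Sum>b\<in>Basis. (w x \<bullet> b) *\<^sub>R \<alpha> x b) V"
    by (intro Ck_on_sum[OF assms(1)] Ck_on_bilinear[OF assms(1) bounded_bilinear_scaleR]
        Ck_on_bilinear[OF assms(1) bounded_bilinear_inner] Ck_on_const[OF assms(1)] assms(3,4))
  then show ?thesis
    by (rule Ck_on_cong[OF assms(1)]) (simp add: linear_sum_Basis[OF assms(2), symmetric])
qed

text \<open>By the chain rule the derivative of the composition is a linear family evaluated on a moving
  vector, whose ingredients are one degree less smooth; hence the simultaneous induction.\<close>

lemma Ck_on_compose:
  assumes "open V" "open W"
  shows "Ck_on k f W \<Longrightarrow> Ck_on k g V \<Longrightarrow> g ` V \<subseteq> W \<Longrightarrow> Ck_on k (\<lambda>x. f (g x)) V"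
proof (induction k arbitrary: f g)
  case 0
  then show ?case using continuous_on_compose2 by auto
next
  case (Suc k)
  note f = Ck_on_SucD[OF Suc.prems(1) assms(2)] and g = Ck_on_SucD[OF Suc.prems(2) assms(1)]
  have D: "((\<lambda>x. f (g x)) has_derivative (\<lambda>v. FD f (g x) (FD g x v))) (at x)" if "x \<in> V" for x
    using has_derivative_compose[OF g(1)[OF that] f(1)] Suc.prems(3) that by blast
  show ?case
  proof (rule Ck_on_SucI[OF assms(1) D])
    show "Ck_on k (\<lambda>x. FD f (g x) (FD g x v)) V" for v
    proof (rule Ck_on_linear_family[OF assms(1), of "\<lambda>x. FD f (g x)" _ "\<lambda>x. FD g x v"])
      show "linear (FD f (g x))" if "x \<in> V" for x
        using f(1)[of "g x"] Suc.prems(3) that has_derivative_linear by blast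
      show "Ck_on k (\<lambda>x. FD f (g x) b) V" for b
        by (rule Suc.IH[OF f(2) Ck_on_SucD'[OF Suc.prems(2)] Suc.prems(3)])
    qed (rule g(2))
  qed
qed

lemma Ck_on_inverse:
  "open V \<Longrightarrow> 0 \<notin> V \<Longrightarrow> Ck_on k (inverse :: 'a \<Rightarrow> 'a::{euclidean_space,real_normed_field}) V"
proof (induction k)
  case 0
  then show ?case by (auto intro!: continuous_intros)
next
  case (Suc k)
  have "Ck_on k inverse V" using Suc by simp
  then have "Ck_on k (\<lambda>x::'a. (inverse x * inverse x) * (- v)) V" for v
    by (intro Ck_on_bilinear[OF \<open>open V\<close> bounded_bilinear_mult] Ck_on_const \<open>open V\<close>)
  then have *: "Ck_on k (\<lambda>x::'a. - (inverse x * v * inverse x)) V" for v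
    by (rule Ck_on_cong[OF \<open>open V\<close>, of _ "\<lambda>x. inverse x * inverse x * (- v)"]) simp
  then show ?case
    by (intro Ck_on_SucI[OF \<open>open V\<close>, of _ "\<lambda>x v. - (inverse x * v * inverse x)"])
      (use Suc * in \<open>auto intro!: has_derivative_inverse'\<close>)
qed

lemma smooth_on_mono: "smooth_on f V \<Longrightarrow> W \<subseteq> V \<Longrightarrow> smooth_on f W"
  unfolding smooth_on_def using Ck_on_subset by blast

lemma smooth_on_const: "open V \<Longrightarrow> smooth_on (\<lambda>x. c) V"
  by (simp add: smooth_on_def Ck_on_const)

lemma smooth_on_linear: "linear f \<Longrightarrow> open V \<Longrightarrow> smooth_on f V"
  by (simp add: smooth_on_def Ck_on_linear)

lemma smooth_on_id: "open V \<Longrightarrow> smooth_on (\<lambda>x. x) V"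
  by (rule smooth_on_linear) (auto simp: linear_iff)

lemma smooth_on_add: "open V \<Longrightarrow> smooth_on f V \<Longrightarrow> smooth_on g V \<Longrightarrow> smooth_on (\<lambda>x. f x + g x) V"
  by (simp add: smooth_on_def Ck_on_add)

lemma smooth_on_sum: "open V \<Longrightarrow> (\<And>i. i \<in> I \<Longrightarrow> smooth_on (f i) V) \<Longrightarrow> smooth_on (\<lambda>x. \<Sum>i\<in>I. f i x) V"
  by (simp add: smooth_on_def Ck_on_sum)

lemma smooth_on_bilinear:
  "open V \<Longrightarrow> bounded_bilinear h \<Longrightarrow> smooth_on f V \<Longrightarrow> smooth_on g V \<Longrightarrow> smooth_on (\<lambda>x. h (f x) (g x)) V"
  by (simp add: smooth_on_def Ck_on_bilinear)

lemmas smooth_on_mult = smooth_on_bilinear[OF _ bounded_bilinear_mult]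
  and smooth_on_scaleR = smooth_on_bilinear[OF _ bounded_bilinear_scaleR]
  and smooth_on_inner = smooth_on_bilinear[OF _ bounded_bilinear_inner]

lemma smooth_on_linear_family:
  "open V \<Longrightarrow> (\<And>x. x \<in> V \<Longrightarrow> linear (\<alpha> x)) \<Longrightarrow> (\<And>b. smooth_on (\<lambda>x. \<alpha> x b) V) \<Longrightarrow> smooth_on w V \<Longrightarrow>
    smooth_on (\<lambda>x. \<alpha> x (w x)) V"
  by (simp add: smooth_on_def Ck_on_linear_family)

lemma smooth_on_compose:
  "open V \<Longrightarrow> open W \<Longrightarrow> smooth_on f W \<Longrightarrow> smooth_on g V \<Longrightarrow> g ` V \<subseteq> W \<Longrightarrow> smooth_on (\<lambda>x. f (g x)) V"
  unfolding smooth_on_def using Ck_on_compose by blast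

lemma smooth_on_linear_compose:
  assumes "linear L" "open V" "smooth_on f V" shows "smooth_on (\<lambda>x. L (f x)) V"
  by (rule smooth_on_compose[OF assms(2) open_UNIV smooth_on_linear[OF assms(1) open_UNIV] assms(3)]) auto

lemma smooth_on_uminus: "open V \<Longrightarrow> smooth_on f V \<Longrightarrow> smooth_on (\<lambda>x. - f x) V"
  by (rule smooth_on_linear_compose) (auto simp: linear_iff)

lemma smooth_on_diff: "open V \<Longrightarrow> smooth_on f V \<Longrightarrow> smooth_on g V \<Longrightarrow> smooth_on (\<lambda>x. f x - g x) V"
  using smooth_on_add[of V f "\<lambda>x. - g x"] smooth_on_uminus by auto

lemma smooth_on_inverse:
  fixes f :: "'a::euclidean_space \<Rightarrow> 'b::{euclidean_space,real_normed_field}"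
  assumes "open V" "smooth_on f V" "\<And>x. x \<in> V \<Longrightarrow> f x \<noteq> 0"
  shows "smooth_on (\<lambda>x. inverse (f x)) V"
proof (rule smooth_on_compose[OF assms(1) _ _ assms(2)])
  show "open (- {0 :: 'b})" by auto
  then show "smooth_on inverse (- {0 :: 'b})" by (simp add: smooth_on_def Ck_on_inverse)
qed (use assms in auto)

lemma smooth_on_divide:
  fixes f :: "'a::euclidean_space \<Rightarrow> 'b::{euclidean_space,real_normed_field}"
  assumes "open V" "smooth_on f V" "smooth_on g V" "\<And>x. x \<in> V \<Longrightarrow> g x \<noteq> 0"
  shows "smooth_on (\<lambda>x. f x / g x) V"
  unfolding divide_inverse using assms by (intro smooth_on_mult smooth_on_inverse)

lemma smooth_on_of_real: "open V \<Longrightarrow> smooth_on f V \<Longrightarrow> smooth_on (\<lambda>x. complex_of_real (f x)) V"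
  by (rule smooth_on_linear_compose[of complex_of_real]) (auto simp: linear_iff scaleR_conv_of_real)

lemma linear_axis: "linear (axis i :: 'a::euclidean_space \<Rightarrow> 'a^'n)"
  by (auto simp: linear_iff axis_def vec_eq_iff)

lemma smooth_on_vec:
  fixes f :: "'n::finite \<Rightarrow> 'a::euclidean_space \<Rightarrow> 'b::euclidean_space"
  assumes "open V" "\<And>i. smooth_on (f i) V"
  shows "smooth_on (\<lambda>x. \<chi> i. f i x) V"
proof -
  have "smooth_on (\<lambda>x. \<Sum>i\<in>UNIV. axis i (f i x)) V"
    by (intro smooth_on_sum smooth_on_linear_compose[OF linear_axis] assms)
  also have "(\<lambda>x. \<Sum>i\<in>UNIV. axis i (f i x)) = (\<lambda>x. \<chi> i. f i x)"
    by (auto simp: vec_eq_iff axis_def if_distrib cong: if_cong)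
  finally show ?thesis .
qed

lemma smooth_on_vec_nth:
  fixes f :: "'a::euclidean_space \<Rightarrow> 'b::euclidean_space^'n"
  assumes "open V" "smooth_on f V" shows "smooth_on (\<lambda>x. f x $ i) V"
  by (rule smooth_on_linear_compose[of "\<lambda>x. x $ i"]) (use assms in \<open>auto simp: linear_iff\<close>)

lemma smooth_on_has_derivative:
  assumes "smooth_on f V" "open V" "x \<in> V" shows "(f has_derivative FD f x) (at x)"
  using Ck_on_SucD(1)[of 0 f V x] assms unfolding smooth_on_def by blast

lemma smooth_on_FD:
  assumes "smooth_on f V" "open V" shows "smooth_on (\<lambda>x. FD f x v) V"
  using assms Ck_on_SucD(2)[of _ f V v] unfolding smooth_on_def by blast

lemma smooth_on_continuous: "smooth_on f V \<Longrightarrow> continuous_on V f"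
  using Ck_on.simps(1) unfolding smooth_on_def by blast

lemma smooth_on_FD_linear: "smooth_on f V \<Longrightarrow> open V \<Longrightarrow> x \<in> V \<Longrightarrow> linear (FD f x)"
  using smooth_on_has_derivative has_derivative_linear by blast

lemma smooth_onI_FD:
  assumes "open V" "\<And>x. x \<in> V \<Longrightarrow> (f has_derivative D x) (at x)" "\<And>v. smooth_on (\<lambda>x. D x v) V"
  shows "smooth_on f V"
  unfolding smooth_on_def
proof
  fix k
  have "Ck_on (Suc k) f V"
    by (rule Ck_on_SucI[OF assms(1,2)]) (use assms(3) in \<open>auto simp: smooth_on_def\<close>)
  then show "Ck_on k f V" by (rule Ck_on_SucD')
qed

lemma smooth_on_line_derivative:
  fixes f :: "'a::euclidean_space \<Rightarrow> 'b::euclidean_space"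
  assumes "smooth_on f V" "open V" "a + t *\<^sub>R v \<in> V"
  shows "((\<lambda>t. f (a + t *\<^sub>R v)) has_vector_derivative FD f (a + t *\<^sub>R v) v) (at t)"
proof -
  have "((\<lambda>t. a + t *\<^sub>R v) has_derivative (\<lambda>s. s *\<^sub>R v)) (at t)"
    by (auto intro!: derivative_eq_intros)
  from has_derivative_compose[OF this smooth_on_has_derivative[OF assms]]
  show ?thesis
    unfolding has_vector_derivative_def
    using linear_scale[OF smooth_on_FD_linear[OF assms]] by (simp add: o_def)
qed

text \<open>The mean value theorem is applied once in each of the two directions.\<close>

lemma second_difference_mean_value:
  fixes f :: "'a::euclidean_space \<Rightarrow> real"
  assumes f: "smooth_on f V" and V: "open V" and "s > 0"
    and box: "\<And>\<sigma> \<tau>. 0 \<le> \<sigma> \<Longrightarrow> \<sigma> \<le> s \<Longrightarrow> 0 \<le> \<tau> \<Longrightarrow> \<tau> \<le> s \<Longrightarrow> x + \<sigma> *\<^sub>R v + \<tau> *\<^sub>R w \<in> V"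
  obtains \<sigma> \<tau> where "0 < \<sigma>" "\<sigma> < s" "0 < \<tau>" "\<tau> < s"
    "f (x + s *\<^sub>R v + s *\<^sub>R w) - f (x + s *\<^sub>R v) - f (x + s *\<^sub>R w) + f x =
      s * s * FD (\<lambda>y. FD f y v) (x + \<sigma> *\<^sub>R v + \<tau> *\<^sub>R w) w"
proof -
  let ?\<phi> = "\<lambda>\<sigma>. f ((x + s *\<^sub>R w) + \<sigma> *\<^sub>R v) - f (x + \<sigma> *\<^sub>R v)"
  have D: "DERIV ?\<phi> \<sigma> :> FD f ((x + s *\<^sub>R w) + \<sigma> *\<^sub>R v) v - FD f (x + \<sigma> *\<^sub>R v) v"
    if "0 \<le> \<sigma>" "\<sigma> \<le> s" for \<sigma>
    using smooth_on_line_derivative[OF f V, of "x + s *\<^sub>R w" \<sigma> v] smooth_on_line_derivative[OF f V, of x \<sigma> v]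
      box[of \<sigma> s] box[of \<sigma> 0] that \<open>s > 0\<close>
    unfolding has_real_derivative_iff_has_vector_derivative
    by (intro has_vector_derivative_diff) (simp_all add: algebra_simps)
  obtain \<sigma> where \<sigma>: "0 < \<sigma>" "\<sigma> < s"
    "?\<phi> s - ?\<phi> 0 = (s - 0) * (FD f ((x + s *\<^sub>R w) + \<sigma> *\<^sub>R v) v - FD f (x + \<sigma> *\<^sub>R v) v)"
    using MVT2[OF \<open>s > 0\<close> D] by blast
  let ?\<psi> = "\<lambda>\<tau>. FD f ((x + \<sigma> *\<^sub>R v) + \<tau> *\<^sub>R w) v"
  have D: "DERIV ?\<psi> \<tau> :> FD (\<lambda>y. FD f y v) ((x + \<sigma> *\<^sub>R v) + \<tau> *\<^sub>R w) w"
    if "0 \<le> \<tau>" "\<tau> \<le> s" for \<tau>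
    using smooth_on_line_derivative[OF smooth_on_FD[OF f V, of v] V, of "x + \<sigma> *\<^sub>R v" \<tau> w]
      box[of \<sigma> \<tau>] that \<sigma> by (simp add: has_real_derivative_iff_has_vector_derivative)
  obtain \<tau> where \<tau>: "0 < \<tau>" "\<tau> < s"
    "?\<psi> s - ?\<psi> 0 = (s - 0) * FD (\<lambda>y. FD f y v) ((x + \<sigma> *\<^sub>R v) + \<tau> *\<^sub>R w) w"
    using MVT2[OF \<open>s > 0\<close> D] by blast
  have "f (x + s *\<^sub>R v + s *\<^sub>R w) - f (x + s *\<^sub>R v) - f (x + s *\<^sub>R w) + f x = ?\<phi> s - ?\<phi> 0"
    by (simp add: algebra_simps)
  also have "\<dots> = s * (?\<psi> s - ?\<psi> 0)"
    unfolding \<sigma>(3) by (simp add: algebra_simps)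
  finally show thesis
    using that[OF \<sigma>(1,2) \<tau>(1,2)] \<tau>(3) by simp
qed

lemma FD_inner:
  assumes "smooth_on f V" "open V" "x \<in> V"
  shows "FD (\<lambda>x. f x \<bullet> b) x v = FD f x v \<bullet> b"
  using FD_eqI[OF has_derivative_inner_left[OF smooth_on_has_derivative[OF assms]]] by metis

text \<open>The second difference quotient is symmetric in the two directions, and by the mean value
  theorem it is a value near \<open>x\<close> of either mixed derivative; both are continuous.\<close>

lemma FD_commute:
  fixes f :: "'a::euclidean_space \<Rightarrow> 'b::euclidean_space"
  assumes f: "smooth_on f V" and V: "open V" and x: "x \<in> V"
  shows "FD (\<lambda>y. FD f y v) x w = FD (\<lambda>y. FD f y w) x v"
proof -
  have real: "FD (\<lambda>y. FD g y v) x w = FD (\<lambda>y. FD g y w) x v" (is "?a x = ?b x")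
    if g: "smooth_on g V" for g :: "'a \<Rightarrow> real"
  proof (rule ccontr)
    assume ne: "?a x \<noteq> ?b x"
    define e where "e = \<bar>?a x - ?b x\<bar> / 2"
    have e: "e > 0" using ne by (simp add: e_def)
    have cont: "continuous_on V ?a" "continuous_on V ?b"
      by (intro smooth_on_continuous smooth_on_FD g V)+
    obtain d1 where d1: "d1 > 0" "\<And>y. y \<in> V \<Longrightarrow> dist y x < d1 \<Longrightarrow> dist (?a y) (?a x) < e"
      using cont(1) x e unfolding continuous_on_iff by blast
    obtain d2 where d2: "d2 > 0" "\<And>y. y \<in> V \<Longrightarrow> dist y x < d2 \<Longrightarrow> dist (?b y) (?b x) < e"
      using cont(2) x e unfolding continuous_on_iff by blast
    obtain d3 where d3: "d3 > 0" "ball x d3 \<subseteq> V" using V x open_contains_ball by blast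
    define d where "d = min d1 (min d2 d3)"
    define s where "s = d / (2 * (norm v + norm w + 1))"
    have n: "norm v + norm w + 1 > 0" by (smt (verit) norm_ge_zero)
    have d: "d > 0" using d1 d2 d3 by (simp add: d_def)
    have s: "s > 0" using d n by (simp add: s_def)
    have near: "dist (x + \<sigma> *\<^sub>R v + \<tau> *\<^sub>R w) x < d" if "0 \<le> \<sigma>" "\<sigma> \<le> s" "0 \<le> \<tau>" "\<tau> \<le> s" for \<sigma> \<tau>
    proof -
      have "dist (x + \<sigma> *\<^sub>R v + \<tau> *\<^sub>R w) x \<le> \<sigma> * norm v + \<tau> * norm w"
        using norm_triangle_ineq[of "\<sigma> *\<^sub>R v" "\<tau> *\<^sub>R w"] that by (simp add: dist_norm algebra_simps)
      also have "\<dots> \<le> s * norm v + s * norm w"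
        using that by (intro add_mono mult_right_mono) auto
      also have "\<dots> < s * (2 * (norm v + norm w + 1))"
        using s n by (simp add: algebra_simps) (smt (verit) norm_ge_zero mult_nonneg_nonneg)
      also have "\<dots> = d" unfolding s_def using n by simp
      finally show ?thesis .
    qed
    have near': "x + \<sigma> *\<^sub>R v + \<tau> *\<^sub>R w \<in> V" if "0 \<le> \<sigma>" "\<sigma> \<le> s" "0 \<le> \<tau>" "\<tau> \<le> s" for \<sigma> \<tau>
      using near[OF that] d3(2) by (auto simp: d_def dist_commute)
    obtain \<sigma> \<tau> where 1: "0 < \<sigma>" "\<sigma> < s" "0 < \<tau>" "\<tau> < s"
      "g (x + s *\<^sub>R v + s *\<^sub>R w) - g (x + s *\<^sub>R v) - g (x + s *\<^sub>R w) + g x = s * s * ?a (x + \<sigma> *\<^sub>R v + \<tau> *\<^sub>R w)"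
      using second_difference_mean_value[OF g V s near'] by blast
    have near'': "x + \<sigma> *\<^sub>R w + \<tau> *\<^sub>R v \<in> V" if "0 \<le> \<sigma>" "\<sigma> \<le> s" "0 \<le> \<tau>" "\<tau> \<le> s" for \<sigma> \<tau>
      using near'[of \<tau> \<sigma>] that by (simp add: algebra_simps)
    obtain \<sigma>' \<tau>' where 2: "0 < \<sigma>'" "\<sigma>' < s" "0 < \<tau>'" "\<tau>' < s"
      "g (x + s *\<^sub>R w + s *\<^sub>R v) - g (x + s *\<^sub>R w) - g (x + s *\<^sub>R v) + g x = s * s * ?b (x + \<sigma>' *\<^sub>R w + \<tau>' *\<^sub>R v)"
      using second_difference_mean_value[OF g V s near''] by blast
    have eq: "s * s * ?a (x + \<sigma> *\<^sub>R v + \<tau> *\<^sub>R w) = s * s * ?b (x + \<sigma>' *\<^sub>R w + \<tau>' *\<^sub>R v)"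
      unfolding 1(5)[symmetric] 2(5)[symmetric] by (simp add: algebra_simps)
    have "x + \<sigma>' *\<^sub>R w + \<tau>' *\<^sub>R v = x + \<tau>' *\<^sub>R v + \<sigma>' *\<^sub>R w" by (simp add: algebra_simps)
    with eq s have eq: "?a (x + \<sigma> *\<^sub>R v + \<tau> *\<^sub>R w) = ?b (x + \<tau>' *\<^sub>R v + \<sigma>' *\<^sub>R w)" by simp
    have "dist (?a (x + \<sigma> *\<^sub>R v + \<tau> *\<^sub>R w)) (?a x) < e"
      using d1(2)[OF near'] near[of \<sigma> \<tau>] 1 by (simp add: d_def)
    moreover have "dist (?b (x + \<tau>' *\<^sub>R v + \<sigma>' *\<^sub>R w)) (?b x) < e"
      using d2(2)[OF near'] near[of \<tau>' \<sigma>'] 2 by (simp add: d_def)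
    ultimately show False unfolding eq e_def by (simp add: dist_real_def abs_if split: if_splits)
  qed
  show ?thesis
  proof (rule euclidean_eqI)
    fix b :: 'b
    have fb: "smooth_on (\<lambda>x. f x \<bullet> b) V"
      by (intro smooth_on_inner V f smooth_on_const)
    have *: "FD (\<lambda>y. FD (\<lambda>x. f x \<bullet> b) y v) x w = FD (\<lambda>y. FD f y v) x w \<bullet> b" for v w
    proof -
      have "((\<lambda>y. FD (\<lambda>x. f x \<bullet> b) y v) has_derivative (\<lambda>w. FD (\<lambda>y. FD f y v) x w \<bullet> b)) (at x)"
        by (rule has_derivative_transform_within_open[OF has_derivative_inner_left[OF
              smooth_on_has_derivative[OF smooth_on_FD[OF f V] V x]] V x])
          (simp add: FD_inner[OF f V])
      then show ?thesis by (simp add: FD_eqI)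
    qed
    show "FD (\<lambda>y. FD f y v) x w \<bullet> b = FD (\<lambda>y. FD f y w) x v \<bullet> b"
      using real[OF fb] unfolding * .
  qed
qed

text \<open>The primitive is the integral of the form along the segment from the centre.\<close>

lemma Poincare_lemma:
  fixes \<alpha> :: "'a::euclidean_space \<Rightarrow> 'a \<Rightarrow> 'b::euclidean_space"
  assumes lin: "\<And>x. x \<in> ball 0 r \<Longrightarrow> linear (\<alpha> x)"
    and smooth: "\<And>v. smooth_on (\<lambda>x. \<alpha> x v) (ball 0 r)"
    and closed: "\<And>x v w. x \<in> ball 0 r \<Longrightarrow> FD (\<lambda>y. \<alpha> y w) x v = FD (\<lambda>y. \<alpha> y v) x w"
  obtains P where "smooth_on P (ball 0 r)" "\<And>x v. x \<in> ball 0 r \<Longrightarrow> FD P x v = \<alpha> x v"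
proof -
  let ?B = "ball (0::'a) r"
  have tx: "t *\<^sub>R x \<in> ?B" if "x \<in> ?B" "t \<in> {0..1}" for x t
  proof -
    have "\<bar>t\<bar> * norm x \<le> 1 * norm x" using that by (intro mult_right_mono) auto
    then show ?thesis using that by simp
  qed
  have tx': "t * norm x < r" if "norm x < r" "0 \<le> t" "t \<le> 1" for x :: 'a and t
    using tx[of x t] that by simp
  have lin_sum: "\<alpha> x v = (\<Sum>b\<in>Basis. (v \<bullet> b) *\<^sub>R \<alpha> x b)" if "x \<in> ?B" for x v
    by (rule linear_sum_Basis[OF lin[OF that]])
  define D where "D x t v = \<alpha> (t *\<^sub>R x) v + t *\<^sub>R (\<Sum>b\<in>Basis. (x \<bullet> b) *\<^sub>R FD (\<lambda>y. \<alpha> y b) (t *\<^sub>R x) v)" for x t v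
  have FDlin: "linear (FD (\<lambda>y. \<alpha> y b) x)" if "x \<in> ?B" for x b
    using smooth_on_FD_linear[OF smooth _ that] by simp
  \<comment> \<open>Closedness turns the derivative of the integrand in direction \<open>v\<close> into \<open>d/dt (t \<alpha>(t x) v)\<close>,
    which integrates to \<open>\<alpha> x v\<close>.\<close>
  have D_eq: "D x t v = \<alpha> (t *\<^sub>R x) v + t *\<^sub>R FD (\<lambda>y. \<alpha> y v) (t *\<^sub>R x) x" if "x \<in> ?B" "t \<in> {0..1}" for x t v
  proof -
    have "(\<Sum>b\<in>Basis. (x \<bullet> b) *\<^sub>R FD (\<lambda>y. \<alpha> y b) (t *\<^sub>R x) v)
        = (\<Sum>b\<in>Basis. (x \<bullet> b) *\<^sub>R FD (\<lambda>y. \<alpha> y v) (t *\<^sub>R x) b)"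
      using closed[OF tx[OF that]] by simp
    also have "\<dots> = FD (\<lambda>y. \<alpha> y v) (t *\<^sub>R x) x"
      using linear_sum_Basis[OF FDlin[OF tx[OF that]]] by metis
    finally show ?thesis by (simp add: D_def)
  qed
  have Dlin: "linear (D x t)" if "x \<in> ?B" "t \<in> {0..1}" for x t
  proof -
    note l = lin[OF tx[OF that]] FDlin[OF tx[OF that]]
    show ?thesis unfolding D_def linear_iff
      by (simp add: linear_add[OF l(1)] linear_add[OF l(2)] linear_scale[OF l(1)] linear_scale[OF l(2)]
          scaleR_right_distrib sum.distrib scaleR_right.sum scaleR_left_commute mult_ac)
  qed
  have bl: "blinfun_apply (Blinfun (D x t)) = D x t" if "x \<in> ?B" "t \<in> {0..1}" for x t
    using Dlin[OF that] by (simp add: bounded_linear_Blinfun_apply linear_conv_bounded_linear)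
  have has_D: "((\<lambda>x. \<alpha> (t *\<^sub>R x) x) has_derivative D x t) (at x within ?B)" if "x \<in> ?B" "t \<in> {0..1}" for x t
  proof -
    have 1: "((\<lambda>x. \<alpha> (t *\<^sub>R x) b) has_derivative (\<lambda>v. t *\<^sub>R FD (\<lambda>y. \<alpha> y b) (t *\<^sub>R x) v)) (at x within ?B)" for b
    proof -
      have "((\<lambda>x. t *\<^sub>R x) has_derivative (\<lambda>v. t *\<^sub>R v)) (at x within ?B)"
        by (auto intro!: derivative_eq_intros)
      from has_derivative_compose[OF this smooth_on_has_derivative[OF smooth _ tx[OF that]]]
      show ?thesis by (simp add: linear_scale[OF FDlin[OF tx[OF that]]])
    qed
    have 2: "((\<lambda>x. \<Sum>b\<in>Basis. (x \<bullet> b) *\<^sub>R \<alpha> (t *\<^sub>R x) b) has_derivative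
       (\<lambda>v. \<Sum>b\<in>Basis. (x \<bullet> b) *\<^sub>R (t *\<^sub>R FD (\<lambda>y. \<alpha> y b) (t *\<^sub>R x) v) + (v \<bullet> b) *\<^sub>R \<alpha> (t *\<^sub>R x) b)) (at x within ?B)"
      by (intro has_derivative_sum has_derivative_scaleR 1) (auto intro!: derivative_eq_intros)
    have "(\<lambda>v. \<Sum>b\<in>Basis. (x \<bullet> b) *\<^sub>R (t *\<^sub>R FD (\<lambda>y. \<alpha> y b) (t *\<^sub>R x) v) + (v \<bullet> b) *\<^sub>R \<alpha> (t *\<^sub>R x) b) = D x t"
      unfolding D_def by (rule ext)
        (simp add: sum.distrib scaleR_right.sum mult_ac lin_sum[OF tx[OF that], symmetric])
    with 2 have 3: "((\<lambda>x. \<Sum>b\<in>Basis. (x \<bullet> b) *\<^sub>R \<alpha> (t *\<^sub>R x) b) has_derivative D x t) (at x within ?B)" by simp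
    show ?thesis
      by (rule has_derivative_transform[OF that(1) _ 3]) (rule lin_sum[OF tx[OF _ that(2)]])
  qed
  have cont\<alpha>: "continuous_on (?B \<times> {0..1}) (\<lambda>(x, t). \<alpha> (t *\<^sub>R x) v)" for v
    unfolding split_beta
    by (rule continuous_on_compose2[OF smooth_on_continuous[OF smooth]]) (auto intro!: continuous_intros tx')
  have contFD: "continuous_on (?B \<times> {0..1}) (\<lambda>(x, t). FD (\<lambda>y. \<alpha> y b) (t *\<^sub>R x) v)" for b v
    unfolding split_beta
    by (rule continuous_on_compose2[OF smooth_on_continuous[OF smooth_on_FD[OF smooth]]])
      (auto intro!: continuous_intros tx')
  have contD: "continuous_on (?B \<times> {0..1}) (\<lambda>(x, t). D x t v)" for v
    unfolding D_def using cont\<alpha> contFD unfolding split_beta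
    by (intro continuous_intros) auto
  define P where "P x = integral (cbox 0 1) (\<lambda>t. \<alpha> (t *\<^sub>R x) x)" for x
  have P: "(P has_derivative \<alpha> x) (at x)" if x: "x \<in> ?B" for x
  proof -
    have int: "(\<lambda>t. \<alpha> (t *\<^sub>R x) x) integrable_on cbox 0 1" if "x \<in> ?B" for x
    proof (rule integrable_continuous)
      show "continuous_on (cbox 0 1) (\<lambda>t. \<alpha> (t *\<^sub>R x) x)"
        by (rule continuous_on_compose2[OF smooth_on_continuous[OF smooth]])
          (use tx[OF that] in \<open>auto intro!: continuous_intros\<close>)
    qed
    have contB: "continuous_on (?B \<times> cbox 0 1) (\<lambda>(x, t). Blinfun (D x t))"
    proof (rule continuous_on_blinfun_componentwise)
      fix i :: 'a assume "i \<in> Basis"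
      show "continuous_on (?B \<times> cbox 0 1) (\<lambda>z. blinfun_apply (case z of (x, t) \<Rightarrow> Blinfun (D x t)) i)"
        unfolding box_real by (rule continuous_on_eq[OF contD[of i]]) (auto simp: bl)
    qed
    have "((\<lambda>x. integral (cbox 0 1) (\<lambda>t. \<alpha> (t *\<^sub>R x) x)) has_derivative
        integral (cbox 0 1) (\<lambda>t. Blinfun (D x t))) (at x within ?B)"
      by (rule leibniz_rule[OF _ int contB x]) (use has_D bl in \<open>auto simp: convex_ball\<close>)
    moreover have "blinfun_apply (integral (cbox 0 1) (\<lambda>t. Blinfun (D x t))) v = \<alpha> x v" for v
    proof -
      have ib: "(\<lambda>t. Blinfun (D x t)) integrable_on cbox 0 1"
      proof (rule integrable_continuous)
        show "continuous_on (cbox 0 1) (\<lambda>t. Blinfun (D x t))"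
          using continuous_on_compose2[OF contB, of "cbox 0 1" "\<lambda>t. (x, t)"] x
          by (simp add: image_subset_iff continuous_on_Pair)
      qed
      have "blinfun_apply (integral (cbox 0 1) (\<lambda>t. Blinfun (D x t))) v
          = integral (cbox 0 1) (\<lambda>t. blinfun_apply (Blinfun (D x t)) v)"
        by (rule blinfun_apply_integral[OF ib])
      also have "\<dots> = integral {0..1} (\<lambda>t. D x t v)"
        unfolding box_real by (rule integral_cong) (use bl[OF x] in auto)
      also have "((\<lambda>t. D x t v) has_integral (1 *\<^sub>R \<alpha> (1 *\<^sub>R x) v - 0 *\<^sub>R \<alpha> (0 *\<^sub>R x) v)) {0..1}"
      proof (rule fundamental_theorem_of_calculus)
        fix t :: real assume t: "t \<in> {0..1}"
        have "((\<lambda>t. \<alpha> (0 + t *\<^sub>R x) v) has_vector_derivative FD (\<lambda>y. \<alpha> y v) (0 + t *\<^sub>R x) x) (at t within {0..1})"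
          by (rule has_vector_derivative_at_within[OF smooth_on_line_derivative[OF smooth]]) (use tx[OF x t] in auto)
        then have "((\<lambda>t. t *\<^sub>R \<alpha> (t *\<^sub>R x) v) has_vector_derivative
            (t *\<^sub>R FD (\<lambda>y. \<alpha> y v) (t *\<^sub>R x) x + 1 *\<^sub>R \<alpha> (t *\<^sub>R x) v)) (at t within {0..1})"
          by (intro has_vector_derivative_scaleR) (auto intro!: derivative_eq_intros)
        then show "((\<lambda>t. t *\<^sub>R \<alpha> (t *\<^sub>R x) v) has_vector_derivative D x t v) (at t within {0..1})"
          by (simp add: D_eq[OF x t] add.commute)
      qed simp
      then have "integral {0..1} (\<lambda>t. D x t v) = \<alpha> x v" by (simp add: integral_unique)
      finally show ?thesis .
    qed
    then have "blinfun_apply (integral (cbox 0 1) (\<lambda>t. Blinfun (D x t))) = \<alpha> x" by (rule ext)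
    ultimately have "(P has_derivative \<alpha> x) (at x within ?B)"
      unfolding P_def by simp
    then show ?thesis using x by (simp add: at_within_open[of x ?B])
  qed
  show thesis
  proof (rule that)
    show "smooth_on P ?B" by (rule smooth_onI_FD[OF open_ball P smooth])
    show "FD P x v = \<alpha> x v" if "x \<in> ?B" for x v using FD_eqI[OF P[OF that]] by simp
  qed
qed


section \<open>Real hypersurfaces in Euclidean space\<close>

lemma defining_functionD:
  assumes "defining_function M V \<rho>"
  shows "open V" "smooth_on \<rho> V" "\<And>x. x \<in> V \<Longrightarrow> x \<in> M \<longleftrightarrow> \<rho> x = 0"
    "\<And>x. x \<in> V \<Longrightarrow> x \<in> M \<Longrightarrow> \<exists>\<nu>. FD \<rho> x \<nu> \<noteq> 0"
  using assms unfolding defining_function_def by (auto simp: fun_eq_iff)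

lemma defining_function_mono:
  "defining_function M V \<rho> \<Longrightarrow> open W \<Longrightarrow> W \<subseteq> V \<Longrightarrow> defining_function M W \<rho>"
  unfolding defining_function_def using smooth_on_mono by blast

text \<open>The map \<open>\<Phi>\<close> of the proof keeps the tangential coordinates at \<open>z\<close> and replaces the normal one by the
  value of the defining function, so it straightens \<open>M\<close> to a hyperplane. The parametrisation \<open>G\<close> is
  its inverse preceded by the orthogonal projection onto the tangent hyperplane; in this way the
  parameter domain is a ball of full dimension in the same space.\<close>

lemma defining_function_flattening:
  fixes M :: "'a::euclidean_space set"
  assumes V: "z \<in> V" "z \<in> M" "defining_function M V \<rho>" and U: "V \<subseteq> U"
  obtains r :: real and G :: "'a \<Rightarrow> 'a" and W and Q :: "'a \<Rightarrow> 'a"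
  where "r > 0" "smooth_on G (ball 0 r)" "open W" "z \<in> W" "W \<subseteq> U"
    "smooth_on Q W" "Q ` W \<subseteq> ball 0 r" "\<And>x. x \<in> M \<inter> W \<Longrightarrow> G (Q x) = x"
    "\<And>y. y \<in> ball 0 r \<Longrightarrow> G y \<in> M \<inter> W" "G 0 = z" "\<And>v. FD \<rho> z v = 0 \<Longrightarrow> FD G 0 v = v"
proof -
  note D = defining_functionD[OF V(3)]
  have lin: "linear (FD \<rho> x)" if "x \<in> V" for x by (rule smooth_on_FD_linear[OF D(2,1) that])
  define a where "a = gradient \<rho> z"
  have a: "FD \<rho> z v = v \<bullet> a" for v
    unfolding a_def gradient_def linear_sum_Basis[OF lin[OF V(1)], of v]
    by (simp add: inner_sum_right mult.commute)
  have a0: "a \<noteq> 0" using D(4)[OF V(1) V(2)] a by auto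
  define \<nu> where "\<nu> = a /\<^sub>R (a \<bullet> a)"
  have \<nu>: "\<nu> \<bullet> a = 1" using a0 by (simp add: \<nu>_def)
  define \<pi> where "\<pi> y = y - (y \<bullet> a) *\<^sub>R \<nu>" for y
  have \<pi>lin: "linear \<pi>" unfolding \<pi>_def by (auto simp: linear_iff algebra_simps inner_add_left)
  have \<pi>a: "\<pi> y \<bullet> a = 0" for y using \<nu> by (simp add: \<pi>_def inner_diff_left)
  then have \<pi>\<pi>: "\<pi> (\<pi> y) = \<pi> y" for y unfolding \<pi>_def[of "\<pi> y"] by simp
  have \<pi>norm: "norm (\<pi> y) \<le> norm y" for y
  proof -
    have "y = \<pi> y + (y \<bullet> a) *\<^sub>R \<nu>" by (simp add: \<pi>_def)
    then have "norm y ^ 2 = norm (\<pi> y + (y \<bullet> a) *\<^sub>R \<nu>) ^ 2" by simp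
    also have "\<dots> = norm (\<pi> y) ^ 2 + norm ((y \<bullet> a) *\<^sub>R \<nu>) ^ 2"
      by (rule norm_add_Pythagorean) (simp add: orthogonal_def \<nu>_def \<pi>a)
    finally have "norm (\<pi> y) ^ 2 \<le> norm y ^ 2" by simp
    then show ?thesis by (rule power2_le_imp_le) simp
  qed
  define \<Phi> where "\<Phi> x = \<pi> (x - z) + \<rho> x *\<^sub>R \<nu>" for x
  have \<Phi>a: "\<Phi> x \<bullet> a = \<rho> x" for x using \<nu> by (simp add: \<Phi>_def inner_add_left \<pi>a)
  have \<Phi>M: "\<pi> (\<Phi> x) = \<Phi> x \<longleftrightarrow> x \<in> M" if "x \<in> V" for x
    using D(3)[OF that] \<nu> unfolding \<pi>_def[of "\<Phi> x"] \<Phi>a by auto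
  define D\<Phi> where "D\<Phi> x v = \<pi> v + FD \<rho> x v *\<^sub>R \<nu>" for x v
  have smooth\<Phi>: "smooth_on \<Phi> V"
    unfolding \<Phi>_def
    by (intro smooth_on_add smooth_on_scaleR smooth_on_linear_compose[OF \<pi>lin] smooth_on_diff smooth_on_id
        smooth_on_const D)
  have D\<Phi>: "(\<Phi> has_derivative D\<Phi> x) (at x)" if "x \<in> V" for x
    unfolding \<Phi>_def D\<Phi>_def \<pi>_def
    by (auto intro!: derivative_eq_intros smooth_on_has_derivative[OF D(2,1) that])
  have D\<Phi>bl: "blinfun_apply (Blinfun (D\<Phi> x)) = D\<Phi> x" if "x \<in> V" for x
    using D\<Phi>[OF that] has_derivative_bounded_linear bounded_linear_Blinfun_apply by blast
  have D\<Phi>z: "D\<Phi> z v = v" for v by (simp add: D\<Phi>_def a \<pi>_def)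
  obtain U' V' g g' where inv: "open U'" "U' \<subseteq> V" "z \<in> U'" "open V'" "\<Phi> z \<in> V'" "homeomorphism U' V' \<Phi> g"
    "\<And>y. y \<in> V' \<Longrightarrow> (g has_derivative (g' y)) (at y)"
    "\<And>y. y \<in> V' \<Longrightarrow> g' y = inv (blinfun_apply (Blinfun (D\<Phi> (g y))))"
    "\<And>y. y \<in> V' \<Longrightarrow> bij (blinfun_apply (Blinfun (D\<Phi> (g y))))"
  proof (rule inverse_function_theorem[OF D(1)])
    show "(\<Phi> has_derivative blinfun_apply (Blinfun (D\<Phi> x))) (at x)" if "x \<in> V" for x
      using D\<Phi>[OF that] D\<Phi>bl[OF that] by simp
    show "continuous_on V (\<lambda>x. Blinfun (D\<Phi> x))"
    proof (rule continuous_on_blinfun_componentwise)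
      fix i :: 'a
      have "continuous_on V (\<lambda>x. D\<Phi> x i)"
        unfolding D\<Phi>_def by (intro continuous_intros smooth_on_continuous[OF smooth_on_FD[OF D(2,1)]])
      then show "continuous_on V (\<lambda>x. blinfun_apply (Blinfun (D\<Phi> x)) i)"
        by (rule continuous_on_eq) (simp add: D\<Phi>bl)
    qed
    show "id_blinfun o\<^sub>L Blinfun (D\<Phi> z) = id_blinfun"
      by (rule blinfun_eqI) (simp add: D\<Phi>bl[OF V(1)] D\<Phi>z)
  qed (use V(1) in \<open>auto\<close>)
  have gU: "g y \<in> U'" "\<Phi> (g y) = y" if "y \<in> V'" for y
    using inv(6) that unfolding homeomorphism_def by auto
  have g\<Phi>: "g (\<Phi> x) = x" "\<Phi> x \<in> V'" if "x \<in> U'" for x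
    using inv(6) that unfolding homeomorphism_def by auto
  have \<pi>\<nu>: "\<pi> \<nu> = 0" by (simp add: \<pi>_def \<nu>)
  define V0 where "V0 = {x \<in> V. FD \<rho> x \<nu> \<noteq> 0}"
  have V0: "open V0"
    unfolding V0_def using continuous_open_preimage[OF smooth_on_continuous[OF smooth_on_FD[OF D(2,1), of \<nu>]] D(1), of "- {0}"]
    by (auto simp: vimage_def Int_def)
  have gV0: "g y \<in> V0" if "y \<in> V'" for y
  proof -
    have "D\<Phi> (g y) \<nu> \<noteq> D\<Phi> (g y) 0"
      using inv(9)[OF that] D\<Phi>bl gU(1)[OF that] inv(2) \<nu> unfolding bij_def inj_def
      by (metis inner_zero_left subsetD zero_neq_one)
    then have "FD \<rho> (g y) \<nu> \<noteq> 0"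
      using linear_0[OF lin] linear_0[OF \<pi>lin] gU(1)[OF that] inv(2) by (auto simp: D\<Phi>_def \<pi>\<nu>)
    then show ?thesis using gU(1)[OF that] inv(2) by (auto simp: V0_def)
  qed
  \<comment> \<open>The derivative of the inverse in closed form, as a smooth function of the point \<open>x = g y\<close>.\<close>
  define h where "h x w = w - ((FD \<rho> x w - w \<bullet> a) / FD \<rho> x \<nu>) *\<^sub>R \<nu>" for x w
  have "smooth_on (\<lambda>x. h x w) V0" for w
    unfolding h_def
    by (intro smooth_on_diff smooth_on_const smooth_on_scaleR smooth_on_divide V0
        smooth_on_mono[OF smooth_on_FD[OF D(2,1)]]) (auto simp: V0_def)
  then have Ckh: "Ck_on k (\<lambda>x. h x w) V0" for k w unfolding smooth_on_def by blast
  have g'h: "g' y = h (g y)" if y: "y \<in> V'" for y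
  proof -
    have gV: "g y \<in> V" using gU(1)[OF y] inv(2) by blast
    note l = lin[OF gV]
    have "D\<Phi> (g y) (h (g y) w) = w" for w
    proof -
      have "D\<Phi> (g y) (h (g y) w) = \<pi> w + (FD \<rho> (g y) w - (FD \<rho> (g y) w - w \<bullet> a)) *\<^sub>R \<nu>"
        using gV0[OF y] unfolding D\<Phi>_def h_def
        by (simp add: linear_diff[OF \<pi>lin] linear_scale[OF \<pi>lin] linear_diff[OF l] linear_scale[OF l] \<pi>\<nu> V0_def)
      then show ?thesis by (simp add: \<pi>_def)
    qed
    then have "D\<Phi> (g y) \<circ> h (g y) = id" by auto
    then have "inv (D\<Phi> (g y)) = h (g y)"
      using inv(9)[OF y] unfolding D\<Phi>bl[OF gV] bij_def
      by (metis (no_types, lifting) ext inv_f_eq comp_apply id_apply)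
    then show ?thesis using inv(8)[OF y] D\<Phi>bl[OF gV] by simp
  qed
  have smoothg: "smooth_on g V'"
    unfolding smooth_on_def
  proof
    fix k show "Ck_on k g V'"
    proof (induction k)
      case 0
      show ?case using inv(6) by (simp add: homeomorphism_def)
    next
      case (Suc k)
      have "Ck_on k (\<lambda>y. h (g y) w) V'" for w
        by (rule Ck_on_compose[OF inv(4) V0 Ckh Suc]) (use gV0 in auto)
      then show ?case
        by (intro Ck_on_SucI[OF inv(4), of _ "\<lambda>y. h (g y)"]) (use inv(7) g'h in auto)
    qed
  qed
  have "\<Phi> z = 0" using D(3)[OF V(1)] V(2) linear_0[OF \<pi>lin] by (simp add: \<Phi>_def)
  then obtain r where r: "r > 0" "ball 0 r \<subseteq> V'" using inv(4,5) open_contains_ball by metis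
  have \<pi>ball: "\<pi> y \<in> ball 0 r" if "y \<in> ball 0 r" for y using \<pi>norm[of y] that by simp
  define W where "W = {x \<in> U'. \<Phi> x \<in> ball 0 r}"
  show thesis
  proof (rule that[of r "\<lambda>y. g (\<pi> y)" W "\<lambda>x. \<pi> (\<Phi> x)"])
    show "smooth_on (\<lambda>y. g (\<pi> y)) (ball 0 r)"
      by (rule smooth_on_compose[OF _ inv(4) smoothg smooth_on_linear[OF \<pi>lin]]) (use \<pi>ball r in auto)
    have "continuous_on U' \<Phi>" using inv(6) by (simp add: homeomorphism_def)
    from continuous_open_preimage[OF this inv(1) open_ball[of 0 r]] show W: "open W"
      by (auto simp: W_def vimage_def Int_def)
    show "z \<in> W" using \<open>\<Phi> z = 0\<close> r inv(3) by (simp add: W_def)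
    show "W \<subseteq> U" using inv(2) U by (auto simp: W_def)
    have "W \<subseteq> V" using inv(2) by (auto simp: W_def)
    then show "smooth_on (\<lambda>x. \<pi> (\<Phi> x)) W"
      by (intro smooth_on_linear_compose[OF \<pi>lin W] smooth_on_mono[OF smooth\<Phi>])
    show "(\<lambda>x. \<pi> (\<Phi> x)) ` W \<subseteq> ball 0 r" using \<pi>ball by (auto simp: W_def)
    show "g (\<pi> (\<pi> (\<Phi> x))) = x" if "x \<in> M \<inter> W" for x
      using that \<open>W \<subseteq> V\<close> \<Phi>M[of x] g\<Phi>(1)[of x] by (auto simp: W_def \<pi>\<pi>)
    fix y :: 'a assume y: "y \<in> ball 0 r"
    have \<pi>y: "\<pi> y \<in> V'" using \<pi>ball[OF y] r by blast
    note gy = gU[OF \<pi>y]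
    have "g (\<pi> y) \<in> M" using \<Phi>M[of "g (\<pi> y)"] gy inv(2) \<pi>\<pi> by auto
    then show "g (\<pi> y) \<in> M \<inter> W" using gy \<pi>ball[OF y] by (simp add: W_def)
  next
    have g0: "g 0 = z" using g\<Phi>(1)[OF inv(3)] \<open>\<Phi> z = 0\<close> by simp
    then show "g (\<pi> 0) = z" by (simp add: linear_0[OF \<pi>lin])
    fix v assume v: "FD \<rho> z v = 0"
    have "(g has_derivative g' 0) (at (\<pi> 0))"
      using inv(5,7) \<open>\<Phi> z = 0\<close> by (simp add: linear_0[OF \<pi>lin])
    from has_derivative_compose[OF linear_imp_has_derivative[OF \<pi>lin] this, of UNIV]
    have "FD (\<lambda>y. g (\<pi> y)) 0 v = g' 0 (\<pi> v)" by (simp add: FD_eqI)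
    also have "\<dots> = v" using g'h[of 0] inv(5) \<open>\<Phi> z = 0\<close> v by (simp add: g0 h_def \<pi>_def a)
    finally show "FD (\<lambda>y. g (\<pi> y)) 0 v = v" .
  qed (use r in auto)
qed

text \<open>The flattening maps a ball into \<open>M\<close>, and every tangent vector is a value of its derivative at the
  centre. Hence a derivative within \<open>M\<close>, though not unique, is determined on tangent vectors.\<close>

lemma derivative_within_zero:
  fixes f :: "'a::euclidean_space \<Rightarrow> 'b::euclidean_space"
  assumes df: "defining_function M V \<rho>" and z: "z \<in> V" "z \<in> M" and v: "FD \<rho> z v = 0"
    and f: "(f has_derivative D) (at z within M)" and W: "open W" "z \<in> W" "\<And>x. x \<in> M \<inter> W \<Longrightarrow> f x = 0"
  shows "D v = 0"
proof -
  have zV: "z \<in> V \<inter> W" using z W by simp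
  have df': "defining_function M (V \<inter> W) \<rho>"
    by (rule defining_function_mono[OF df open_Int[OF defining_functionD(1)[OF df] W(1)]]) simp
  obtain r :: real and G :: "'a \<Rightarrow> 'a" where G: "r > 0" "smooth_on G (ball 0 r)"
    "\<And>y. y \<in> ball 0 r \<Longrightarrow> G y \<in> M \<inter> W" "G 0 = z" "FD G 0 v = v"
    by (rule defining_function_flattening[OF zV z(2) df' Int_lower2]) (use v in blast)
  have 0: "0 \<in> ball (0::'a) r" using G(1) by simp
  have "((\<lambda>y. f (G y)) has_derivative (\<lambda>w. D (FD G 0 w))) (at 0 within ball 0 r)"
  proof (rule has_derivative_in_compose[of G _ 0 _ f])
    show "(G has_derivative FD G 0) (at 0 within ball 0 r)"
      by (rule has_derivative_at_withinI[OF smooth_on_has_derivative[OF G(2) open_ball 0]])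
    show "(f has_derivative D) (at (G 0) within G ` ball 0 r)"
      unfolding G(4) by (rule has_derivative_subset[OF f]) (use G(3) in auto)
  qed
  then have "((\<lambda>y. f (G y)) has_derivative (\<lambda>w. D (FD G 0 w))) (at 0)"
    by (simp only: at_within_open[OF 0 open_ball])
  moreover have "((\<lambda>y. f (G y)) has_derivative (\<lambda>w. 0)) (at 0)"
    by (rule has_derivative_transform_within_open[OF has_derivative_const open_ball 0]) (use W(3) G(3) in simp)
  ultimately have "(\<lambda>w. D (FD G 0 w)) = (\<lambda>w. 0)" by (rule has_derivative_unique)
  then show ?thesis using G(5) by metis
qed

text \<open>Any defining function vanishes on \<open>M\<close>, hence its derivative vanishes on the kernel of the
  derivative of any other one.\<close>

lemma tangent_space_eq:
  fixes M :: "'a::euclidean_space set"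
  assumes df: "defining_function M V \<rho>" and z: "z \<in> V" "z \<in> M"
  shows "tangent_space M z = {v. FD \<rho> z v = 0}"
proof (intro equalityI subsetI)
  fix v assume "v \<in> tangent_space M z"
  then obtain V' \<rho>' where *: "z \<in> V'" "defining_function M V' \<rho>'" "FD \<rho>' z v = 0"
    unfolding tangent_space_def by auto
  note D = defining_functionD[OF df]
  have "FD \<rho> z v = 0"
    by (rule derivative_within_zero[OF *(2,1) z(2) *(3) has_derivative_at_withinI[OF
          smooth_on_has_derivative[OF D(2,1) z(1)]] D(1) z(1)]) (use D(3) in auto)
  then show "v \<in> {v. FD \<rho> z v = 0}" by simp
qed (use assms in \<open>auto simp: tangent_space_def\<close>)

lemma smooth_hypersurfaceE:
  assumes "smooth_hypersurface M" "z \<in> M" "open U" "z \<in> U"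
  obtains V \<rho> where "z \<in> V" "V \<subseteq> U" "defining_function M V \<rho>"
proof -
  obtain V \<rho> where V: "z \<in> V" "defining_function M V \<rho>"
    using assms unfolding smooth_hypersurface_def by blast
  show ?thesis
    by (rule that[of "V \<inter> U" \<rho>])
      (use V assms defining_functionD(1)[OF V(2)] in \<open>auto intro!: defining_function_mono[OF V(2)]\<close>)
qed

lemma derivative_within_unique:
  fixes f g :: "'a::euclidean_space \<Rightarrow> 'b::euclidean_space"
  assumes M: "smooth_hypersurface M" "z \<in> M" and v: "v \<in> tangent_space M z"
    and f: "(f has_derivative D) (at z within M)" and g: "(g has_derivative D') (at z within M)"
    and W: "open W" "z \<in> W" "\<And>x. x \<in> M \<inter> W \<Longrightarrow> f x = g x"
  shows "D v = D' v"
proof -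
  obtain V \<rho> where V: "z \<in> V" "defining_function M V \<rho>"
    using smooth_hypersurfaceE[OF M open_UNIV UNIV_I] by metis
  have "FD \<rho> z v = 0" using v tangent_space_eq[OF V(2,1) M(2)] by simp
  from derivative_within_zero[OF V(2,1) M(2) this has_derivative_diff[OF f g] W(1,2)] W(3)
  show ?thesis by simp
qed

lemma subspace_tangent_space:
  assumes "smooth_hypersurface M" "z \<in> M"
  shows "subspace (tangent_space M z)"
proof -
  obtain V \<rho> where V: "z \<in> V" "defining_function M V \<rho>"
    using smooth_hypersurfaceE[OF assms open_UNIV UNIV_I] by metis
  note D = defining_functionD[OF V(2)]
  show ?thesis
    unfolding tangent_space_eq[OF V(2,1) assms(2)]
    by (rule linear_subspace_kernel[OF smooth_on_FD_linear[OF D(2,1) V(1)]])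
qed

lemma extension_has_derivative:
  assumes "smooth_on F V" "open V" "z \<in> V" "z \<in> M" "\<And>x. x \<in> V \<inter> M \<Longrightarrow> F x = f x"
  shows "(f has_derivative FD F z) (at z within M)"
proof -
  obtain d where d: "d > 0" "ball z d \<subseteq> V" using assms open_contains_ball by blast
  show ?thesis
    by (rule has_derivative_transform_within[OF has_derivative_at_withinI[OF
          smooth_on_has_derivative[OF assms(1-3)]] d(1) assms(4)])
      (use assms(5) d(2) in \<open>auto simp: dist_commute subset_iff\<close>)
qed

lemma smooth_on_subset_has_derivative:
  assumes "smooth_on_subset f M" "z \<in> M"
  shows "(f has_derivative frechet_derivative f (at z within M)) (at z within M)"
proof -
  obtain V F where "open V" "z \<in> V" "smooth_on F V" "\<forall>x\<in>V \<inter> M. F x = f x"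
    using assms unfolding smooth_on_subset_def by blast
  then have "(f has_derivative FD F z) (at z within M)"
    using extension_has_derivative[of F V z M f] assms(2) by blast
  then show ?thesis using frechet_derivative_works differentiable_def by blast
qed

lemma frechet_derivative_within_eq:
  fixes f :: "'a::euclidean_space \<Rightarrow> 'b::euclidean_space"
  assumes M: "smooth_hypersurface M" "z \<in> M" and v: "v \<in> tangent_space M z"
    and f: "(f has_derivative D) (at z within M)"
  shows "frechet_derivative f (at z within M) v = D v"
proof -
  have "(f has_derivative frechet_derivative f (at z within M)) (at z within M)"
    using f frechet_derivative_works differentiable_def by blast
  then show ?thesis using derivative_within_unique[OF M v _ f open_UNIV] by blast
qed

lemma hypersurface_flattening:
  fixes M :: "'a::euclidean_space set"
  assumes M: "smooth_hypersurface M" "z \<in> M" and U: "open U" "z \<in> U"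
  obtains r :: real and G :: "'a \<Rightarrow> 'a" and W and Q :: "'a \<Rightarrow> 'a"
  where "r > 0" "smooth_on G (ball 0 r)" "open W" "z \<in> W" "W \<subseteq> U"
    "smooth_on Q W" "Q ` W \<subseteq> ball 0 r" "\<And>x. x \<in> M \<inter> W \<Longrightarrow> G (Q x) = x"
    "\<And>y. y \<in> ball 0 r \<Longrightarrow> G y \<in> M \<inter> W"
proof -
  obtain V \<rho> where V: "z \<in> V" "V \<subseteq> U" "defining_function M V \<rho>"
    using smooth_hypersurfaceE[OF M U] by blast
  show thesis by (rule defining_function_flattening[OF V(1) M(2) V(3,2)]) (rule that)
qed

text \<open>A defining function vanishes on the image of \<open>G\<close>.\<close>

lemma flattening_derivative_tangent:
  assumes M: "smooth_hypersurface M" and G: "smooth_on G (ball 0 r)" "\<And>y. y \<in> ball 0 r \<Longrightarrow> G y \<in> M"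
    and y: "y \<in> ball 0 r"
  shows "FD G y w \<in> tangent_space M (G y)"
proof -
  obtain V \<rho> where V: "G y \<in> V" "defining_function M V \<rho>"
    using smooth_hypersurfaceE[OF M G(2)[OF y] open_UNIV UNIV_I] by metis
  note D = defining_functionD[OF V(2)]
  have op: "open {y \<in> ball 0 r. G y \<in> V}"
    using continuous_open_preimage[OF smooth_on_continuous[OF G(1)] open_ball D(1)]
    by (simp add: vimage_def Int_def)
  have "((\<lambda>y. \<rho> (G y)) has_derivative (\<lambda>w. FD \<rho> (G y) (FD G y w))) (at y)"
    by (rule has_derivative_compose[OF smooth_on_has_derivative[OF G(1) open_ball y]
          smooth_on_has_derivative[OF D(2,1) V(1)]])
  moreover have "((\<lambda>y. \<rho> (G y)) has_derivative (\<lambda>w. 0)) (at y)"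
  proof (rule has_derivative_transform_within_open[OF has_derivative_const op])
    show "y \<in> {y \<in> ball 0 r. G y \<in> V}" using y V by simp
    show "0 = \<rho> (G y)" if "y \<in> {y \<in> ball 0 r. G y \<in> V}" for y
      using D(3)[of "G y"] G(2)[of y] that by simp
  qed
  ultimately have "(\<lambda>w. FD \<rho> (G y) (FD G y w)) = (\<lambda>w. 0)"
    by (rule has_derivative_unique)
  then show ?thesis
    unfolding tangent_space_eq[OF V(2,1) G(2)[OF y]] by (auto simp: fun_eq_iff)
qed

text \<open>In flattening coordinates the function has zero derivative on a ball.\<close>

lemma zero_tangential_derivative_imp_locally_constant:
  fixes F :: "'a::euclidean_space \<Rightarrow> 'b::euclidean_space"
  assumes M: "smooth_hypersurface M" "z \<in> M" and V: "open V" "z \<in> V" and F: "smooth_on F V"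
    and zero: "\<And>x v. x \<in> V \<inter> M \<Longrightarrow> v \<in> tangent_space M x \<Longrightarrow> FD F x v = 0"
  obtains W where "open W" "z \<in> W" "\<And>x. x \<in> W \<inter> M \<Longrightarrow> F x = F z"
proof -
  obtain r :: real and G :: "'a \<Rightarrow> 'a" and W and Q :: "'a \<Rightarrow> 'a" where f: "r > 0" "smooth_on G (ball 0 r)" "open W" "z \<in> W" "W \<subseteq> V"
    "smooth_on Q W" "Q ` W \<subseteq> ball 0 r" "\<And>x. x \<in> M \<inter> W \<Longrightarrow> G (Q x) = x"
    "\<And>y. y \<in> ball 0 r \<Longrightarrow> G y \<in> M \<inter> W"
    by (rule hypersurface_flattening[OF M V]) (rule that)
  have "((\<lambda>y. F (G y)) has_derivative (\<lambda>w. 0)) (at y within ball 0 r)" if y: "y \<in> ball 0 r" for y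
  proof -
    have Gy: "G y \<in> V \<inter> M" using f(9)[OF y] f(5) by auto
    have "((\<lambda>y. F (G y)) has_derivative (\<lambda>w. FD F (G y) (FD G y w))) (at y)"
      by (rule has_derivative_compose[OF smooth_on_has_derivative[OF f(2) open_ball y]
            smooth_on_has_derivative[OF F V(1)]]) (use Gy in auto)
    moreover have "FD F (G y) (FD G y w) = 0" for w
      by (rule zero[OF Gy flattening_derivative_tangent[OF M(1) f(2) _ y]]) (use f(9) in auto)
    ultimately show ?thesis using has_derivative_at_withinI by simp
  qed
  then obtain c where c: "\<And>y. y \<in> ball 0 r \<Longrightarrow> F (G y) = c"
    using has_derivative_zero_constant[OF convex_ball] by metis
  have "F x = c" if "x \<in> W \<inter> M" for x
    using c[of "Q x"] f(7,8) that by (metis IntD1 IntD2 IntI image_subset_iff)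
  then show ?thesis using that[OF f(3,4)] f(4) M(2) by simp
qed

lemma hypersurface_locally_path_connected:
  assumes M: "smooth_hypersurface M" "z \<in> M" and U: "open U" "z \<in> U"
  obtains W where "open W" "z \<in> W" "W \<subseteq> U" "path_connected (W \<inter> M)"
proof -
  obtain r :: real and G :: "'a \<Rightarrow> 'a" and W and Q :: "'a \<Rightarrow> 'a" where f: "r > 0" "smooth_on G (ball 0 r)" "open W" "z \<in> W" "W \<subseteq> U"
    "smooth_on Q W" "Q ` W \<subseteq> ball 0 r" "\<And>x. x \<in> M \<inter> W \<Longrightarrow> G (Q x) = x"
    "\<And>y. y \<in> ball 0 r \<Longrightarrow> G y \<in> M \<inter> W"
    by (rule hypersurface_flattening[OF M U]) (rule that)
  have "W \<inter> M \<subseteq> G ` ball 0 r"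
  proof
    fix x assume x: "x \<in> W \<inter> M"
    then have "x = G (Q x)" "Q x \<in> ball 0 r" using f(7,8) by auto
    then show "x \<in> G ` ball 0 r" by blast
  qed
  then have "W \<inter> M = G ` ball 0 r" using f(9) by blast
  moreover have "path_connected (G ` ball 0 r)"
    by (intro path_connected_continuous_image smooth_on_continuous f convex_imp_path_connected convex_ball)
  ultimately show ?thesis using that f by metis
qed

text \<open>In flattening coordinates the form becomes a closed form on a ball, because its differential
  is only evaluated on tangent vectors there; the primitive is carried back by the flattening.\<close>

lemma closed_on_hypersurface_has_potential:
  fixes \<alpha> :: "'a::euclidean_space \<Rightarrow> 'a \<Rightarrow> 'b::euclidean_space"
  assumes M: "smooth_hypersurface M" "z \<in> M" and V: "open V" "z \<in> V"
    and lin: "\<And>x. x \<in> V \<Longrightarrow> linear (\<alpha> x)" and smooth: "\<And>v. smooth_on (\<lambda>x. \<alpha> x v) V"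
    and closed: "\<And>x v w. x \<in> V \<inter> M \<Longrightarrow> v \<in> tangent_space M x \<Longrightarrow> w \<in> tangent_space M x \<Longrightarrow>
      FD (\<lambda>y. \<alpha> y w) x v = FD (\<lambda>y. \<alpha> y v) x w"
  obtains W F where "open W" "z \<in> W" "W \<subseteq> V" "smooth_on F W"
    "\<And>x v. x \<in> W \<inter> M \<Longrightarrow> v \<in> tangent_space M x \<Longrightarrow> FD F x v = \<alpha> x v"
proof -
  obtain r :: real and G :: "'a \<Rightarrow> 'a" and W and Q :: "'a \<Rightarrow> 'a" where f: "r > 0" "smooth_on G (ball 0 r)" "open W" "z \<in> W" "W \<subseteq> V"
    "smooth_on Q W" "Q ` W \<subseteq> ball 0 r" "\<And>x. x \<in> M \<inter> W \<Longrightarrow> G (Q x) = x"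
    "\<And>y. y \<in> ball 0 r \<Longrightarrow> G y \<in> M \<inter> W"
    by (rule hypersurface_flattening[OF M V]) (rule that)
  let ?B = "ball (0::'a) r"
  have GV: "G y \<in> V" "G y \<in> M" if "y \<in> ?B" for y using f(9)[OF that] f(5) by auto
  have tan: "FD G y w \<in> tangent_space M (G y)" if "y \<in> ?B" for y w
    by (rule flattening_derivative_tangent[OF M(1) f(2) GV(2) that])
  note DG = smooth_on_has_derivative[OF f(2) open_ball]
  have linG: "linear (FD G y)" if "y \<in> ?B" for y by (rule smooth_on_FD_linear[OF f(2) open_ball that])
  define \<gamma> where "\<gamma> y w = \<alpha> (G y) (FD G y w)" for y w
  have \<gamma>sum: "\<gamma> y w = (\<Sum>b\<in>Basis. (FD G y w \<bullet> b) *\<^sub>R \<alpha> (G y) b)" if "y \<in> ?B" for y w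
    unfolding \<gamma>_def by (rule linear_sum_Basis[OF lin[OF GV(1)[OF that]]])
  have D\<gamma>: "FD (\<lambda>y. \<gamma> y w) y v = \<alpha> (G y) (FD (\<lambda>y. FD G y w) y v)
      + FD (\<lambda>x. \<alpha> x (FD G y w)) (G y) (FD G y v)" if y: "y \<in> ?B" for y v w
  proof -
    have DA: "((\<lambda>y. \<alpha> (G y) b) has_derivative (\<lambda>v. FD (\<lambda>x. \<alpha> x b) (G y) (FD G y v))) (at y)" for b
      by (rule has_derivative_compose[OF DG[OF y] smooth_on_has_derivative[OF smooth V(1) GV(1)[OF y]]])
    have "((\<lambda>y. \<Sum>b\<in>Basis. (FD G y w \<bullet> b) *\<^sub>R \<alpha> (G y) b) has_derivative
       (\<lambda>v. \<Sum>b\<in>Basis. (FD G y w \<bullet> b) *\<^sub>R FD (\<lambda>x. \<alpha> x b) (G y) (FD G y v)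
          + (FD (\<lambda>y. FD G y w) y v \<bullet> b) *\<^sub>R \<alpha> (G y) b)) (at y)"
      by (intro has_derivative_sum has_derivative_scaleR DA has_derivative_inner_left
          smooth_on_has_derivative[OF smooth_on_FD[OF f(2) open_ball] open_ball y])
    then have "((\<lambda>y. \<gamma> y w) has_derivative
       (\<lambda>v. \<Sum>b\<in>Basis. (FD G y w \<bullet> b) *\<^sub>R FD (\<lambda>x. \<alpha> x b) (G y) (FD G y v)
          + (FD (\<lambda>y. FD G y w) y v \<bullet> b) *\<^sub>R \<alpha> (G y) b)) (at y)"
      by (rule has_derivative_transform_within_open[OF _ open_ball y]) (simp add: \<gamma>sum)
    from FD_eqI[OF this] have "FD (\<lambda>y. \<gamma> y w) y v =
        (\<Sum>b\<in>Basis. (FD G y w \<bullet> b) *\<^sub>R FD (\<lambda>x. \<alpha> x b) (G y) (FD G y v))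
        + (\<Sum>b\<in>Basis. (FD (\<lambda>y. FD G y w) y v \<bullet> b) *\<^sub>R \<alpha> (G y) b)"
      by (simp add: sum.distrib)
    also have "(\<Sum>b\<in>Basis. (FD (\<lambda>y. FD G y w) y v \<bullet> b) *\<^sub>R \<alpha> (G y) b) = \<alpha> (G y) (FD (\<lambda>y. FD G y w) y v)"
      by (rule linear_sum_Basis[OF lin[OF GV(1)[OF y]], symmetric])
    also have "(\<Sum>b\<in>Basis. (FD G y w \<bullet> b) *\<^sub>R FD (\<lambda>x. \<alpha> x b) (G y) (FD G y v))
        = FD (\<lambda>x. \<alpha> x (FD G y w)) (G y) (FD G y v)"
    proof -
      have "((\<lambda>x. \<Sum>b\<in>Basis. (FD G y w \<bullet> b) *\<^sub>R \<alpha> x b) has_derivative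
          (\<lambda>u. \<Sum>b\<in>Basis. (FD G y w \<bullet> b) *\<^sub>R FD (\<lambda>x. \<alpha> x b) (G y) u)) (at (G y))"
        by (intro has_derivative_sum has_derivative_scaleR_right
            smooth_on_has_derivative[OF smooth V(1) GV(1)[OF y]])
      then have "((\<lambda>x. \<alpha> x (FD G y w)) has_derivative
          (\<lambda>u. \<Sum>b\<in>Basis. (FD G y w \<bullet> b) *\<^sub>R FD (\<lambda>x. \<alpha> x b) (G y) u)) (at (G y))"
        by (rule has_derivative_transform_within_open[OF _ V(1) GV(1)[OF y]])
          (simp add: linear_sum_Basis[OF lin, symmetric])
      from FD_eqI[OF this] show ?thesis by simp
    qed
    finally show ?thesis by simp
  qed
  obtain P where P: "smooth_on P ?B" "\<And>y w. y \<in> ?B \<Longrightarrow> FD P y w = \<gamma> y w"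
  proof (rule Poincare_lemma[of r \<gamma>])
    show "linear (\<gamma> y)" if "y \<in> ?B" for y
      unfolding \<gamma>_def using linear_compose[OF linG[OF that] lin[OF GV(1)[OF that]]] by (simp add: o_def)
    show "smooth_on (\<lambda>y. \<gamma> y v) ?B" for v
      unfolding \<gamma>_def
    proof (rule smooth_on_linear_family[of ?B "\<lambda>y. \<alpha> (G y)" "\<lambda>y. FD G y v"])
      show "smooth_on (\<lambda>y. \<alpha> (G y) b) ?B" for b
        by (rule smooth_on_compose[OF open_ball V(1) smooth f(2)]) (use GV in auto)
    qed (use lin GV smooth_on_FD[OF f(2)] in auto)
    show "FD (\<lambda>y. \<gamma> y w) y v = FD (\<lambda>y. \<gamma> y v) y w" if y: "y \<in> ?B" for y v w
      unfolding D\<gamma>[OF y] FD_commute[OF f(2) open_ball y, of w v]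
      using closed[OF _ tan[OF y] tan[OF y], of v w] GV[OF y] by simp
  qed (rule that)
  show ?thesis
  proof (rule that[OF f(3-5)])
    show "smooth_on (\<lambda>x. P (Q x)) W"
      by (rule smooth_on_compose[OF f(3) open_ball P(1) f(6,7)])
    fix x v assume x: "x \<in> W \<inter> M" and v: "v \<in> tangent_space M x"
    have xW: "x \<in> W" "x \<in> M" using x by auto
    have Qx: "Q x \<in> ?B" using f(7) xW by blast
    have GQ: "G (Q x) = x" using f(8) x by blast
    have DQ: "(Q has_derivative FD Q x) (at x)" by (rule smooth_on_has_derivative[OF f(6,3) xW(1)])
    have "((\<lambda>x. P (Q x)) has_derivative (\<lambda>v. FD P (Q x) (FD Q x v))) (at x)"
      by (rule has_derivative_compose[OF DQ smooth_on_has_derivative[OF P(1) open_ball Qx]])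
    then have 1: "FD (\<lambda>x. P (Q x)) x v = \<alpha> x (FD G (Q x) (FD Q x v))"
      using P(2)[OF Qx] GQ by (simp add: FD_eqI \<gamma>_def)
    have "((\<lambda>x. G (Q x)) has_derivative (\<lambda>v. FD G (Q x) (FD Q x v))) (at x)"
      by (rule has_derivative_compose[OF DQ DG[OF Qx]])
    from derivative_within_unique[OF M(1) xW(2) v has_derivative_at_withinI[OF this] has_derivative_ident f(3) xW(1)]
    have "FD G (Q x) (FD Q x v) = v" using f(8) by blast
    then show "FD (\<lambda>x. P (Q x)) x v = \<alpha> x v" using 1 by simp
  qed
qed


section \<open>Projective charts and their transition maps\<close>

lemma abs_cp_eq_iff:
  fixes Z W :: "complex^('n::finite option)"
  assumes "Z \<noteq> 0" "W \<noteq> 0"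
  shows "abs_cp Z = abs_cp W \<longleftrightarrow> (\<exists>c. c \<noteq> 0 \<and> W = c *s Z)"
proof -
  have r: "proj_rel Z Z" "proj_rel W W"
    using assms by (auto simp: proj_rel_def intro!: exI[of _ 1])
  have "proj_rel Z W \<longleftrightarrow> proj_rel Z Z \<and> proj_rel W W \<and> abs_cp Z = abs_cp W"
    by (rule Quotient3_rel[OF Quotient3_cp, symmetric])
  then show ?thesis using r assms by (auto simp: proj_rel_def)
qed

lemma tangent_rel_refl: "Z \<noteq> 0 \<Longrightarrow> tangent_rel (Z, V) (Z, V)"
  unfolding tangent_rel_def
  by (intro conjI exI[of _ "1::complex"] exI[of _ "0::complex"]) simp_all

lemma abs_cp_tangent_eq_iff:
  fixes Z W V U :: "complex^('n::finite option)"
  assumes "Z \<noteq> 0" "W \<noteq> 0"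
  shows "abs_cp_tangent (Z, V) = abs_cp_tangent (W, U) \<longleftrightarrow>
    (\<exists>c k. c \<noteq> 0 \<and> W = c *s Z \<and> U = c *s V + k *s Z)"
proof -
  have r: "tangent_rel (Z, V) (Z, V)" "tangent_rel (W, U) (W, U)"
    using assms by (simp_all add: tangent_rel_refl)
  have "tangent_rel (Z, V) (W, U) \<longleftrightarrow> tangent_rel (Z, V) (Z, V) \<and> tangent_rel (W, U) (W, U) \<and>
      abs_cp_tangent (Z, V) = abs_cp_tangent (W, U)"
    by (rule Quotient3_rel[OF Quotient3_cp_tangent, symmetric])
  then show ?thesis using r assms by (auto simp: tangent_rel_def)
qed

lemma homog_nth [simp]: "homog c z $ None = c" "homog c z $ Some j = z $ j"
  by (simp_all add: homog_def)

lemma vec_option_eq_iff: "Z = W \<longleftrightarrow> Z $ None = W $ None \<and> (\<forall>j. Z $ Some j = W $ Some j)"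
  for Z W :: "'a^('n::finite option)"
  unfolding vec_eq_iff by (metis option.exhaust)

lemma homog_1_nonzero [simp]: "homog 1 z \<noteq> 0"
  by (simp add: vec_option_eq_iff)

lemma homog_add: "homog (a + b) (v + w) = homog a v + homog b w"
  and homog_cmul: "homog (c * a) (c *s v) = c *s homog a v"
  by (simp_all add: vec_option_eq_iff)

lemma invertible_mult_eq_iff:
  fixes A :: "complex^'m^'m"
  assumes "invertible A" shows "A *v Z = A *v W \<longleftrightarrow> Z = W"
  using inj_matrix_vector_mult[OF assms] by (auto dest: injD)

lemma invertible_mult_nonzero:
  fixes A :: "complex^'m^'m"
  assumes "invertible A" "Z \<noteq> 0" shows "A *v Z \<noteq> 0"
  using invertible_mult_eq_iff[OF assms(1), of Z 0] assms(2) by simp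

lemma matrix_vector_mult_cmul: "A *v (c *s Z) = c *s (A *v Z)" for A :: "complex^'m^'n"
  by (simp add: vec_eq_iff matrix_vector_mult_def sum_distrib_left mult_ac)

lemma
  fixes A :: "complex^'m^'m"
  assumes "invertible A"
  shows matrix_inv_right: "A ** matrix_inv A = mat 1" and matrix_inv_left: "matrix_inv A ** A = mat 1"
  using someI_ex[OF assms[unfolded invertible_def]] unfolding matrix_inv_def by auto

text \<open>The change of homogeneous coordinates from the chart of \<open>A\<close> to that of \<open>A'\<close>.\<close>

definition transition :: "complex^('n::finite option)^('n option) \<Rightarrow> complex^('n option)^('n option) \<Rightarrow>
    complex^('n option)^('n option)" where
  "transition A A' = matrix_inv A' ** A"

lemma transition_mult: "invertible A' \<Longrightarrow> A' *v (transition A A' *v Z) = A *v Z"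
  by (simp add: transition_def matrix_vector_mul_assoc matrix_mul_assoc matrix_inv_right)

text \<open>In affine coordinates the linear map \<open>B\<close> is the linear fractional map \<open>pmap B\<close> with denominator
  \<open>pden B\<close>; \<open>dpmap B\<close> is its derivative, by the quotient rule.\<close>

definition pden :: "complex^('n::finite option)^('n option) \<Rightarrow> complex^'n \<Rightarrow> complex" where
  "pden B x = (B *v homog 1 x) $ None"

definition pmap :: "complex^('n::finite option)^('n option) \<Rightarrow> complex^'n \<Rightarrow> complex^'n" where
  "pmap B x = (\<chi> j. (B *v homog 1 x) $ Some j / pden B x)"

definition dpmap :: "complex^('n::finite option)^('n option) \<Rightarrow> complex^'n \<Rightarrow> complex^'n \<Rightarrow> complex^'n" where
  "dpmap B x v = (\<chi> j. (B *v homog 0 v) $ Some j / pden B x -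
     (B *v homog 1 x) $ Some j * (B *v homog 0 v) $ None / (pden B x * pden B x))"

lemma homog_pmap: "pden B x \<noteq> 0 \<Longrightarrow> B *v homog 1 x = pden B x *s homog 1 (pmap B x)"
  by (simp add: vec_option_eq_iff pmap_def pden_def)

text \<open>A tangent vector lifts to homogeneous coordinates only up to multiples of the point, which
  accounts for the second term.\<close>

lemma homog_dpmap:
  "pden B x \<noteq> 0 \<Longrightarrow> B *v homog 0 v = pden B x *s homog 0 (dpmap B x v) + (B *v homog 0 v) $ None *s homog 1 (pmap B x)"
  by (simp add: vec_option_eq_iff pmap_def dpmap_def field_simps)

lemma homog_0_add: "homog 0 (v + w) = homog 0 v + homog 0 w"
  and homog_0_cmul: "homog 0 (c *s v) = c *s homog 0 v"
  using homog_add[of 0 0 v w] homog_cmul[of c 0 v] by simp_all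

lemma dpmap_add: "dpmap B x (v + w) = dpmap B x v + dpmap B x w"
  by (simp add: dpmap_def vec_eq_iff homog_0_add matrix_vector_right_distrib add_divide_distrib algebra_simps)

lemma dpmap_cmul: "dpmap B x (c *s v) = c *s dpmap B x v"
  by (simp add: dpmap_def vec_eq_iff homog_0_cmul matrix_vector_mult_cmul algebra_simps)

lemma linear_cmul: "linear (\<lambda>v. c *s v :: complex^'n)"
  by (auto simp: linear_iff vec_eq_iff algebra_simps)

lemma scaleR_eq_cmul: "r *\<^sub>R v = complex_of_real r *s v" for v :: "complex^'n"
  by (simp only: vec_eq_iff vector_scaleR_component vector_smult_component) (simp add: scaleR_conv_of_real)

lemma linear_homog_0: "linear (homog 0 :: complex^'n::finite \<Rightarrow> _)"
  by (auto simp: linear_iff homog_0_add scaleR_eq_cmul homog_0_cmul)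

lemma linear_matrix_vector: "linear ((*v) A)" for A :: "complex^'m^'n"
  by (auto simp: linear_iff matrix_vector_right_distrib scaleR_eq_cmul matrix_vector_mult_cmul)

lemma linear_dpmap: "linear (dpmap B x)"
  by (auto simp: linear_iff dpmap_add scaleR_eq_cmul dpmap_cmul)

lemma homog_1_eq: "homog 1 x = homog 1 0 + homog 0 x"
  by (simp add: vec_option_eq_iff)

lemma has_derivative_homog_1: "(homog 1 has_derivative homog 0) (at x)"
proof -
  have "((\<lambda>x. homog 1 0 + homog 0 x) has_derivative homog 0) (at x)"
    using has_derivative_add[OF has_derivative_const linear_imp_has_derivative[OF linear_homog_0]] by simp
  then show ?thesis by (simp flip: homog_1_eq)
qed

lemma smooth_on_homog_1: "open V \<Longrightarrow> smooth_on (homog 1) V"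
  by (subst ext[OF homog_1_eq]) (intro smooth_on_add smooth_on_const smooth_on_linear linear_homog_0)

lemma smooth_on_pden: "open V \<Longrightarrow> smooth_on (pden B) V"
  unfolding pden_def[abs_def]
  by (intro smooth_on_vec_nth smooth_on_linear_compose[OF linear_matrix_vector] smooth_on_homog_1)

lemma open_pden: "open {x. pden B x \<noteq> 0}"
  using continuous_open_preimage[OF smooth_on_continuous[OF smooth_on_pden[OF open_UNIV]] open_UNIV, of "- {0}" B]
  by (auto simp: vimage_def)

lemma smooth_on_pmap: "open V \<Longrightarrow> (\<And>x. x \<in> V \<Longrightarrow> pden B x \<noteq> 0) \<Longrightarrow> smooth_on (pmap B) V"
  unfolding pmap_def[abs_def]
  by (intro smooth_on_vec smooth_on_divide smooth_on_vec_nth smooth_on_linear_compose[OF linear_matrix_vector]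
      smooth_on_homog_1 smooth_on_pden)

lemma has_derivative_vec_components:
  fixes f :: "'n::finite \<Rightarrow> 'a::real_normed_vector \<Rightarrow> complex"
  assumes "\<And>j. (f j has_derivative (\<lambda>v. f' v $ j)) (at x within M)"
  shows "((\<lambda>x. \<chi> j. f j x) has_derivative f') (at x within M)"
proof -
  have l: "bounded_linear (axis j :: complex \<Rightarrow> complex^'n)" for j
    using linear_axis by (simp add: linear_conv_bounded_linear)
  have "((\<lambda>x. \<Sum>j\<in>UNIV. axis j (f j x)) has_derivative (\<lambda>v. \<Sum>j\<in>UNIV. axis j (f' v $ j))) (at x within M)"
    by (intro has_derivative_sum bounded_linear.has_derivative[OF l] assms)
  moreover have "(\<Sum>j\<in>UNIV. axis j (c j)) = (\<chi> j. c j)" for c :: "'n \<Rightarrow> complex"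
    by (auto simp: vec_eq_iff axis_def if_distrib cong: if_cong)
  ultimately show ?thesis by simp
qed

lemma has_derivative_pmap:
  assumes "pden B x \<noteq> 0" shows "(pmap B has_derivative dpmap B x) (at x)"
proof -
  have n: "((\<lambda>x. (B *v homog 1 x) $ i) has_derivative (\<lambda>v. (B *v homog 0 v) $ i)) (at x)" for i
    by (rule bounded_linear.has_derivative[OF bounded_linear_vec_nth
        bounded_linear.has_derivative[OF linear_matrix_vector[unfolded linear_conv_bounded_linear] has_derivative_homog_1]])
  have "((\<lambda>x. (B *v homog 1 x) $ Some j / pden B x) has_derivative (\<lambda>v. dpmap B x v $ j)) (at x)" for j
    unfolding pden_def
    by (rule has_derivative_eq_rhs[OF has_derivative_divide[OF n n]])
      (use assms in \<open>auto simp: dpmap_def pden_def field_simps\<close>)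
  then show ?thesis
    unfolding pmap_def[abs_def] by (rule has_derivative_vec_components)
qed

lemma chart_eq_iff:
  assumes A: "invertible A" and A': "invertible A'"
  shows "chart A x = chart A' y \<longleftrightarrow> pden (transition A A') x \<noteq> 0 \<and> y = pmap (transition A A') x"
proof -
  let ?B = "transition A A'"
  have "chart A x = chart A' y \<longleftrightarrow> (\<exists>c. c \<noteq> 0 \<and> A' *v homog 1 y = c *s (A' *v (?B *v homog 1 x)))"
    unfolding chart_def using A A' by (subst abs_cp_eq_iff) (auto simp: invertible_mult_nonzero transition_mult)
  also have "\<dots> \<longleftrightarrow> (\<exists>c. c \<noteq> 0 \<and> homog 1 y = c *s (?B *v homog 1 x))"
    by (simp add: matrix_vector_mult_cmul[symmetric] invertible_mult_eq_iff[OF A'])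
  also have "\<dots> \<longleftrightarrow> pden ?B x \<noteq> 0 \<and> y = pmap ?B x"
  proof
    assume "\<exists>c. c \<noteq> 0 \<and> homog 1 y = c *s (?B *v homog 1 x)"
    then obtain c where c: "c \<noteq> 0" "homog 1 y = c *s (?B *v homog 1 x)" by blast
    have "1 = c * pden ?B x" using arg_cong[OF c(2), of "\<lambda>Z. Z $ None"] by (simp add: pden_def)
    moreover have "y $ j = c * (?B *v homog 1 x) $ Some j" for j
      using arg_cong[OF c(2), of "\<lambda>Z. Z $ Some j"] by simp
    moreover from \<open>1 = c * pden ?B x\<close> have "pden ?B x \<noteq> 0" by auto
    ultimately show "pden ?B x \<noteq> 0 \<and> y = pmap ?B x"
      by (auto simp: pmap_def vec_eq_iff eq_divide_eq mult_ac)
  next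
    assume "pden ?B x \<noteq> 0 \<and> y = pmap ?B x"
    then show "\<exists>c. c \<noteq> 0 \<and> homog 1 y = c *s (?B *v homog 1 x)"
      by (intro exI[of _ "inverse (pden ?B x)"]) (simp add: homog_pmap vector_smult_assoc)
  qed
  finally show ?thesis .
qed

lemma dchart_eq_iff:
  assumes A: "invertible A" and A': "invertible A'"
  shows "dchart A x v = dchart A' y w \<longleftrightarrow> chart A x = chart A' y \<and> w = dpmap (transition A A') x v"
proof -
  let ?B = "transition A A'"
  have "dchart A x v = dchart A' y w \<longleftrightarrow> (\<exists>c k. c \<noteq> 0 \<and> A' *v homog 1 y = c *s (A' *v (?B *v homog 1 x)) \<and>
      A' *v homog 0 w = c *s (A' *v (?B *v homog 0 v)) + k *s (A' *v (?B *v homog 1 x)))"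
    unfolding dchart_def using A A' by (subst abs_cp_tangent_eq_iff) (auto simp: invertible_mult_nonzero transition_mult)
  also have "\<dots> \<longleftrightarrow> (\<exists>c k. c \<noteq> 0 \<and> homog 1 y = c *s (?B *v homog 1 x) \<and>
      homog 0 w = c *s (?B *v homog 0 v) + k *s (?B *v homog 1 x))"
    by (simp add: matrix_vector_mult_cmul[symmetric] matrix_vector_right_distrib[symmetric] invertible_mult_eq_iff[OF A'])
  also have "\<dots> \<longleftrightarrow> (pden ?B x \<noteq> 0 \<and> y = pmap ?B x) \<and> w = dpmap ?B x v"
  proof
    assume "\<exists>c k. c \<noteq> 0 \<and> homog 1 y = c *s (?B *v homog 1 x) \<and>
      homog 0 w = c *s (?B *v homog 0 v) + k *s (?B *v homog 1 x)"
    then obtain c k where c: "c \<noteq> 0" "homog 1 y = c *s (?B *v homog 1 x)"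
      "homog 0 w = c *s (?B *v homog 0 v) + k *s (?B *v homog 1 x)" by blast
    have 1: "1 = c * pden ?B x" using arg_cong[OF c(2), of "\<lambda>Z. Z $ None"] by (simp add: pden_def)
    have 2: "y $ j = c * (?B *v homog 1 x) $ Some j" for j
      using arg_cong[OF c(2), of "\<lambda>Z. Z $ Some j"] by simp
    have 3: "0 = c * (?B *v homog 0 v) $ None + k * pden ?B x"
      using arg_cong[OF c(3), of "\<lambda>Z. Z $ None"] by (simp add: pden_def)
    have 4: "w $ j = c * (?B *v homog 0 v) $ Some j + k * (?B *v homog 1 x) $ Some j" for j
      using arg_cong[OF c(3), of "\<lambda>Z. Z $ Some j"] by simp
    have N: "pden ?B x \<noteq> 0" using 1 by auto
    have c': "c = 1 / pden ?B x" using 1 N by (simp add: field_simps)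
    have k: "k = - ((?B *v homog 0 v) $ None / (pden ?B x * pden ?B x))"
      using 3 N unfolding c' by (simp add: field_simps add_eq_0_iff)
    show "(pden ?B x \<noteq> 0 \<and> y = pmap ?B x) \<and> w = dpmap ?B x v"
      using 2 4 N unfolding c' k by (auto simp: pmap_def dpmap_def vec_eq_iff field_simps)
  next
    assume N: "(pden ?B x \<noteq> 0 \<and> y = pmap ?B x) \<and> w = dpmap ?B x v"
    show "\<exists>c k. c \<noteq> 0 \<and> homog 1 y = c *s (?B *v homog 1 x) \<and>
      homog 0 w = c *s (?B *v homog 0 v) + k *s (?B *v homog 1 x)"
      using N by (intro exI[of _ "inverse (pden ?B x)"]
          exI[of _ "- ((?B *v homog 0 v) $ None / (pden ?B x * pden ?B x))"])
        (auto simp: vec_option_eq_iff pmap_def dpmap_def field_simps, simp_all add: pden_def)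
  qed
  finally show ?thesis unfolding chart_eq_iff[OF A A'] .
qed

lemma base_dchart: "invertible A \<Longrightarrow> base (dchart A x v) = chart A x"
  unfolding dchart_def chart_def
  by (subst base.abs_eq)
    (simp_all add: eq_onp_def invertible_mult_nonzero tangent_rel_refl)

lemma tangent_J_dchart: "invertible A \<Longrightarrow> tangent_J (dchart A x v) = dchart A x (\<i> *s v)"
  unfolding dchart_def
  by (subst tangent_J.abs_eq)
    (simp_all add: homog_0_cmul matrix_vector_mult_cmul invertible_mult_nonzero tangent_rel_refl)

lemma transition_self: "invertible A \<Longrightarrow> transition A A = mat 1"
  by (simp add: transition_def matrix_inv_left)

lemma transition_identity [simp]: "pden (mat 1) x = 1" "pmap (mat 1) x = x" "dpmap (mat 1) x v = v"
  by (simp_all add: pden_def pmap_def dpmap_def vec_eq_iff)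

lemma chart_inj: "invertible A \<Longrightarrow> chart A x = chart A y \<longleftrightarrow> x = y"
  by (auto simp: chart_eq_iff transition_self)

lemma dchart_inj: "invertible A \<Longrightarrow> dchart A x v = dchart A y w \<longleftrightarrow> x = y \<and> v = w"
  by (auto simp: dchart_eq_iff chart_inj transition_self)

lemma continuous_on_chart: 
  assumes A: "invertible A" shows "continuous_on UNIV (chart A)"
  unfolding continuous_on_open_vimage[OF open_UNIV]
proof (intro allI impI)
  fix U :: "'a cp set" assume "open U"
  then have op: "open {Z :: complex^('a option). Z \<noteq> 0 \<and> abs_cp Z \<in> U}" by (simp add: open_cp_def)
  have "continuous_on UNIV (\<lambda>x. A *v homog 1 x)"
    by (intro smooth_on_continuous smooth_on_linear_compose[OF linear_matrix_vector] smooth_on_homog_1) auto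
  from open_vimage[OF op this] show "open (chart A -` U \<inter> UNIV)"
    using A by (simp add: chart_def vimage_def invertible_mult_nonzero)
qed

lemma open_chart_vimage: "invertible A \<Longrightarrow> open U \<Longrightarrow> open (chart A -` U)"
  using continuous_on_chart[of A] by (simp add: continuous_on_open_vimage)

lemma open_chart_image:
  assumes A: "invertible A" and U: "open U" shows "open (chart A ` U)"
proof -
  let ?C = "matrix_inv A"
  have AC: "A *v (?C *v Z) = Z" for Z
    using A by (simp add: matrix_vector_mul_assoc matrix_inv_right)
  let ?g = "\<lambda>Z. \<chi> j. (?C *v Z) $ Some j / (?C *v Z) $ None"
  define O' where "O' = {Z. (?C *v Z) $ None \<noteq> 0}"
  have cont: "continuous_on UNIV (\<lambda>Z. (?C *v Z) $ i)" for i
    by (intro smooth_on_continuous smooth_on_vec_nth smooth_on_linear linear_matrix_vector) auto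
  have O': "open O'"
    unfolding O'_def using open_vimage[OF _ cont[of None], of "- {0}"] by (auto simp: vimage_def)
  have "continuous_on O' ?g"
    by (intro smooth_on_continuous smooth_on_vec smooth_on_divide smooth_on_vec_nth smooth_on_linear linear_matrix_vector O')
      (auto simp: O'_def)
  from continuous_open_preimage[OF this O' U] have "open (O' \<inter> ?g -` U)" .
  also have "O' \<inter> ?g -` U = {Z. Z \<noteq> 0 \<and> abs_cp Z \<in> chart A ` U}"
  proof (intro equalityI subsetI)
    fix Z assume Z: "Z \<in> O' \<inter> ?g -` U"
    let ?c = "(?C *v Z) $ None"
    have c: "?c \<noteq> 0" using Z by (simp add: O'_def)
    have "?C *v Z = ?c *s homog 1 (?g Z)" using c by (simp add: vec_option_eq_iff)
    then have "A *v (?C *v Z) = A *v (?c *s homog 1 (?g Z))" by simp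
    then have eq: "Z = ?c *s (A *v homog 1 (?g Z))" by (simp add: AC matrix_vector_mult_cmul)
    have Z0: "Z \<noteq> 0" using c by auto
    have "chart A (?g Z) = abs_cp Z"
      unfolding chart_def using abs_cp_eq_iff[OF invertible_mult_nonzero[OF A homog_1_nonzero] Z0] eq c by blast
    then show "Z \<in> {Z. Z \<noteq> 0 \<and> abs_cp Z \<in> chart A ` U}" using Z Z0 by (auto intro: rev_image_eqI)
  next
    fix Z assume "Z \<in> {Z. Z \<noteq> 0 \<and> abs_cp Z \<in> chart A ` U}"
    then obtain x where x: "Z \<noteq> 0" "x \<in> U" "chart A x = abs_cp Z" by auto
    then obtain c where c: "c \<noteq> 0" "Z = c *s (A *v homog 1 x)"
      unfolding chart_def using abs_cp_eq_iff[OF invertible_mult_nonzero[OF A homog_1_nonzero] x(1)] by blast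
    have "?C *v Z = c *s homog 1 x"
      using A unfolding c(2) by (simp add: matrix_vector_mult_cmul matrix_vector_mul_assoc matrix_inv_left)
    then show "Z \<in> O' \<inter> ?g -` U" using c x by (simp add: O'_def)
  qed
  finally show ?thesis unfolding open_cp_def .
qed

section \<open>Tangent spaces, differentials and forms on a projective hypersurface\<close>

lemma mem_affine_part [simp]: "z \<in> affine_part A S \<longleftrightarrow> chart A z \<in> S"
  by (simp add: affine_part_def)

lemma chart_pmap:
  assumes "invertible A" "invertible A'" "pden (transition A A') x \<noteq> 0"
  shows "chart A' (pmap (transition A A') x) = chart A x"
  using chart_eq_iff[OF assms(1,2)] assms(3) by metis

lemma dchart_dpmap:
  assumes "invertible A" "invertible A'" "pden (transition A A') x \<noteq> 0"
  shows "dchart A' (pmap (transition A A') x) (dpmap (transition A A') x v) = dchart A x v"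
  using dchart_eq_iff[OF assms(1,2)] chart_pmap[OF assms] by metis

lemma affine_part_hypersurface:
  "smooth_cp_hypersurface S \<Longrightarrow> invertible A \<Longrightarrow> smooth_hypersurface (affine_part A S)"
  by (simp add: smooth_cp_hypersurface_def)

text \<open>A defining function in the second chart, composed with the transition map, vanishes on the
  hypersurface in the first chart, so its derivative vanishes on tangent vectors there.\<close>

lemma dpmap_tangent:
  assumes S: "smooth_cp_hypersurface S" and A: "invertible A" "invertible A'"
    and x: "chart A x \<in> S" "pden (transition A A') x \<noteq> 0" and v: "v \<in> tangent_space (affine_part A S) x"
  shows "dpmap (transition A A') x v \<in> tangent_space (affine_part A' S) (pmap (transition A A') x)"
proof -
  let ?B = "transition A A'" and ?M = "affine_part A S" and ?M' = "affine_part A' S"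
  have y: "pmap ?B x \<in> ?M'" using chart_pmap[OF A x(2)] x by simp
  obtain V' \<rho>' where V': "pmap ?B x \<in> V'" "defining_function ?M' V' \<rho>'"
    using smooth_hypersurfaceE[OF affine_part_hypersurface[OF S A(2)] y open_UNIV UNIV_I] by metis
  obtain V \<rho> where V: "x \<in> V" "defining_function ?M V \<rho>"
    using smooth_hypersurfaceE[OF affine_part_hypersurface[OF S A(1)] _ open_UNIV UNIV_I, of x] x by auto
  note D' = defining_functionD[OF V'(2)]
  let ?W = "{x. pden ?B x \<noteq> 0} \<inter> pmap ?B -` V'"
  have op: "open ?W"
    by (rule continuous_open_preimage[OF smooth_on_continuous[OF smooth_on_pmap[OF open_pden]] open_pden D'(1)]) auto
  have "((\<lambda>x. \<rho>' (pmap ?B x)) has_derivative (\<lambda>v. FD \<rho>' (pmap ?B x) (dpmap ?B x v))) (at x)"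
    by (rule has_derivative_compose[OF has_derivative_pmap[OF x(2)] smooth_on_has_derivative[OF D'(2,1) V'(1)]])
  note D = has_derivative_at_withinI[OF this]
  have xM: "x \<in> ?M" using x by simp
  have "FD \<rho> x v = 0" using v tangent_space_eq[OF V(2,1) xM] by simp
  then have "FD \<rho>' (pmap ?B x) (dpmap ?B x v) = 0"
  proof (rule derivative_within_zero[OF V(2,1) xM _ D op])
    show "x \<in> ?W" using x V' by simp
    show "\<rho>' (pmap ?B y) = 0" if "y \<in> ?M \<inter> ?W" for y
      using that D'(3)[of "pmap ?B y"] chart_pmap[OF A, of y] by simp
  qed
  then show ?thesis using tangent_space_eq[OF V'(2,1) y] by simp
qed

text \<open>Although the tangent space is defined by all charts together, every single chart yields all of
  it, because transition maps carry tangent vectors to tangent vectors.\<close>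

lemma T_chart:
  assumes S: "smooth_cp_hypersurface S" and A: "invertible A" and z: "chart A z \<in> S"
  shows "T S (chart A z) = dchart A z ` tangent_space (affine_part A S) z"
proof (intro equalityI subsetI)
  fix \<tau> assume "\<tau> \<in> T S (chart A z)"
  then obtain A' z' v where *: "\<tau> = dchart A' z' v" "invertible A'" "chart A' z' = chart A z"
    "v \<in> tangent_space (affine_part A' S) z'"
    unfolding T_def by auto
  have B: "pden (transition A' A) z' \<noteq> 0" "z = pmap (transition A' A) z'"
    using chart_eq_iff[OF *(2) A] *(3) by auto
  have "dpmap (transition A' A) z' v \<in> tangent_space (affine_part A S) z"
    unfolding B(2) by (rule dpmap_tangent[OF S *(2) A _ B(1) *(4)]) (use *(3) z in simp)
  moreover have "\<tau> = dchart A z (dpmap (transition A' A) z' v)"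
    using dchart_dpmap[OF *(2) A B(1), of v] *(1) B(2) by simp
  ultimately show "\<tau> \<in> dchart A z ` tangent_space (affine_part A S) z" by blast
next
  fix \<tau> assume "\<tau> \<in> dchart A z ` tangent_space (affine_part A S) z"
  then show "\<tau> \<in> T S (chart A z)" unfolding T_def using A z by auto
qed

lemma H_chart:
  assumes S: "smooth_cp_hypersurface S" and A: "invertible A" and z: "chart A z \<in> S"
  shows "H S (chart A z) = dchart A z ` complex_tangent_space (affine_part A S) z"
  unfolding H_def T_chart[OF assms] complex_tangent_space_def
  using dchart_inj[OF A] by (auto simp: image_iff tangent_J_dchart[OF A])

lemma dchart_in_T_iff:
  assumes "smooth_cp_hypersurface S" "invertible A" "chart A z \<in> S"
  shows "dchart A z v \<in> T S (chart A z) \<longleftrightarrow> v \<in> tangent_space (affine_part A S) z"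
  unfolding T_chart[OF assms] using dchart_inj[OF assms(2)] by auto

lemma dchart_in_H_iff:
  assumes "smooth_cp_hypersurface S" "invertible A" "chart A z \<in> S"
  shows "dchart A z v \<in> H S (chart A z) \<longleftrightarrow> v \<in> complex_tangent_space (affine_part A S) z"
  unfolding H_chart[OF assms] using dchart_inj[OF assms(2)] by auto

lemma complex_tangent_space_subset: "complex_tangent_space M z \<subseteq> tangent_space M z"
  by (simp add: complex_tangent_space_def)

lemma imaginary_unit_cmul_twice [simp]: "\<i> *s (\<i> *s v) = - v" for v :: "complex^'n"
  by (simp add: vec_eq_iff)

lemma mem_complex_tangent_space:
  assumes "smooth_hypersurface M" "z \<in> M"
  shows "v \<in> complex_tangent_space M z \<longleftrightarrow> v \<in> tangent_space M z \<and> \<i> *s v \<in> tangent_space M z"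
proof -
  note s = subspace_neg[OF subspace_tangent_space[OF assms]]
  have "v = \<i> *s (- (\<i> *s v))" "\<i> *s (\<i> *s w) = - w" for w by (simp_all add: vec_eq_iff)
  then show ?thesis unfolding complex_tangent_space_def using s by (force simp: image_iff)
qed

lemma at_within_Int_open:
  fixes x :: "'a::topological_space"
  assumes "open U" "x \<in> U" shows "at x within (M \<inter> U) = at x within M"
  by (rule at_within_nhd[OF assms(2,1)]) auto

text \<open>By the chain rule the derivatives in any two charts correspond under the transition map, so the
  description in the definition of the differential picks out exactly one value.\<close>

lemma differential_dchart:
  assumes S: "smooth_cp_hypersurface S" and A: "invertible A" and z: "chart A z \<in> S"
    and v: "v \<in> tangent_space (affine_part A S) z"
    and D: "((\<lambda>x. f (chart A x)) has_derivative D) (at z within affine_part A S)"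
  shows "differential S f (dchart A z v) = D v"
  unfolding differential_def
proof (rule the_equality)
  have zM: "z \<in> affine_part A S" using z by simp
  have "frechet_derivative (\<lambda>x. f (chart A x)) (at z within affine_part A S) v = D v"
    by (rule frechet_derivative_within_eq[OF affine_part_hypersurface[OF S A] zM v D])
  then show "\<exists>A' z' v'. invertible A' \<and> z' \<in> affine_part A' S \<and> v' \<in> tangent_space (affine_part A' S) z' \<and>
      dchart A z v = dchart A' z' v' \<and>
      D v = frechet_derivative (\<lambda>x. f (chart A' x)) (at z' within affine_part A' S) v'"
    using A zM v by metis
next
  fix c assume "\<exists>A' z' v'. invertible A' \<and> z' \<in> affine_part A' S \<and> v' \<in> tangent_space (affine_part A' S) z' \<and>
      dchart A z v = dchart A' z' v' \<and>
      c = frechet_derivative (\<lambda>x. f (chart A' x)) (at z' within affine_part A' S) v'"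
  then obtain A' z' v' where *: "invertible A'" "z' \<in> affine_part A' S" "v' \<in> tangent_space (affine_part A' S) z'"
      "dchart A z v = dchart A' z' v'"
      "c = frechet_derivative (\<lambda>x. f (chart A' x)) (at z' within affine_part A' S) v'" by blast
  let ?B = "transition A' A" and ?M = "affine_part A S" and ?M' = "affine_part A' S"
  let ?U = "{x. pden ?B x \<noteq> 0}"
  have B: "chart A' z' = chart A z" "v = dpmap ?B z' v'" "pden ?B z' \<noteq> 0" "z = pmap ?B z'"
    using dchart_eq_iff[OF *(1) A, of z' v' z v] *(4) chart_eq_iff[OF *(1) A, of z' z] by auto
  have "((\<lambda>x. f (chart A (pmap ?B x))) has_derivative (\<lambda>w. D (dpmap ?B z' w))) (at z' within ?M' \<inter> ?U)"
  proof (rule has_derivative_in_compose[of "pmap ?B" _ z' _ "\<lambda>x. f (chart A x)"])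
    show "(pmap ?B has_derivative dpmap ?B z') (at z' within ?M' \<inter> ?U)"
      by (rule has_derivative_at_withinI[OF has_derivative_pmap[OF B(3)]])
    show "((\<lambda>x. f (chart A x)) has_derivative D) (at (pmap ?B z') within pmap ?B ` (?M' \<inter> ?U))"
      unfolding B(4)[symmetric]
      by (rule has_derivative_subset[OF D]) (auto simp: chart_pmap[OF *(1) A])
  qed
  then have "((\<lambda>x. f (chart A' x)) has_derivative (\<lambda>w. D (dpmap ?B z' w))) (at z' within ?M' \<inter> ?U)"
    by (rule has_derivative_transform[rotated 2]) (use *(2) B(3) chart_pmap[OF *(1) A] in auto)
  then have "((\<lambda>x. f (chart A' x)) has_derivative (\<lambda>w. D (dpmap ?B z' w))) (at z' within ?M')"
    using at_within_Int_open[OF open_pden, of z' ?B ?M'] B(3) by simp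
  from frechet_derivative_within_eq[OF affine_part_hypersurface[OF S *(1)] *(2,3) this]
  show "c = D v" using *(5) B(2) by simp
qed

lemma smooth_function_has_derivative:
  assumes "smooth_function S f" "invertible A" "chart A z \<in> S"
  shows "((\<lambda>x. f (chart A x)) has_derivative frechet_derivative (\<lambda>x. f (chart A x)) (at z within affine_part A S))
    (at z within affine_part A S)"
  using smooth_on_subset_has_derivative[of "\<lambda>x. f (chart A x)" "affine_part A S" z] assms
  by (simp add: smooth_function_def)

lemma differential_eq:
  assumes "smooth_cp_hypersurface S" "smooth_function S f" "invertible A" "chart A z \<in> S"
    "v \<in> tangent_space (affine_part A S) z"
  shows "differential S f (dchart A z v) = frechet_derivative (\<lambda>x. f (chart A x)) (at z within affine_part A S) v"
  by (rule differential_dchart[OF assms(1,3,4,5) smooth_function_has_derivative[OF assms(2-4)]])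

lemma differential_add:
  assumes S: "smooth_cp_hypersurface S" and f: "smooth_function S f" "smooth_function S g"
    and A: "invertible A" and z: "chart A z \<in> S" and v: "v \<in> tangent_space (affine_part A S) z"
    and h: "\<And>p. p \<in> S \<Longrightarrow> h p = f p + g p"
  shows "differential S h (dchart A z v) = differential S f (dchart A z v) + differential S g (dchart A z v)"
proof -
  have "((\<lambda>x. h (chart A x)) has_derivative (\<lambda>v. frechet_derivative (\<lambda>x. f (chart A x)) (at z within affine_part A S) v
     + frechet_derivative (\<lambda>x. g (chart A x)) (at z within affine_part A S) v)) (at z within affine_part A S)"
    by (rule has_derivative_transform[OF _ _ has_derivative_add[OF smooth_function_has_derivative[OF f(1) A z]
        smooth_function_has_derivative[OF f(2) A z]]]) (use z h in auto)
  from differential_dchart[OF S A z v this] show ?thesis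
    by (simp add: differential_eq[OF S _ A z v] f)
qed

text \<open>It suffices to extend a function smoothly in one chart around each point: a smooth transition
  map carries the extension to every other chart.\<close>

lemma smooth_functionI:
  assumes "\<And>p. p \<in> S \<Longrightarrow> \<exists>A z W F. invertible A \<and> chart A z = p \<and> open W \<and> z \<in> W \<and> smooth_on F W \<and>
      (\<forall>x\<in>W \<inter> affine_part A S. F x = f (chart A x))"
  shows "smooth_function S f"
  unfolding smooth_function_def smooth_on_subset_def
proof (intro allI impI ballI)
  fix A' :: "complex^('a option)^('a option)" and z' assume A': "invertible A'" and z': "z' \<in> affine_part A' S"
  then obtain A z W F where *: "invertible A" "chart A z = chart A' z'" "open W" "z \<in> W" "smooth_on F W"
      "\<forall>x\<in>W \<inter> affine_part A S. F x = f (chart A x)"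
    using assms[of "chart A' z'"] by auto
  let ?B = "transition A' A"
  have B: "pden ?B z' \<noteq> 0" "z = pmap ?B z'" using chart_eq_iff[OF A' *(1), of z' z] *(2) by auto
  let ?V = "{x. pden ?B x \<noteq> 0} \<inter> pmap ?B -` W"
  have op: "open ?V"
    by (rule continuous_open_preimage[OF smooth_on_continuous[OF smooth_on_pmap[OF open_pden]] open_pden *(3)]) auto
  have "smooth_on (\<lambda>x. F (pmap ?B x)) ?V"
    by (rule smooth_on_compose[OF op *(3,5) smooth_on_pmap[OF op]]) auto
  moreover have "F (pmap ?B x) = f (chart A' x)" if "x \<in> ?V \<inter> affine_part A' S" for x
    using that *(6) chart_pmap[OF A' *(1), of x] by auto
  ultimately show "\<exists>V F. open V \<and> z' \<in> V \<and> smooth_on F V \<and> (\<forall>x\<in>V \<inter> affine_part A' S. F x = f (chart A' x))"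
    using op B *(4) by (intro exI[of _ ?V] exI[of _ "\<lambda>x. F (pmap ?B x)"]) auto
qed

lemma smooth_functionE:
  assumes "smooth_function S f" "invertible A" "chart A z \<in> S"
  obtains W F where "open W" "z \<in> W" "smooth_on F W" "\<And>x. x \<in> W \<inter> affine_part A S \<Longrightarrow> F x = f (chart A x)"
proof -
  obtain W F where "open W" "z \<in> W" "smooth_on F W" "\<forall>x\<in>W \<inter> affine_part A S. F x = f (chart A x)"
    using assms unfolding smooth_function_def smooth_on_subset_def by (metis mem_affine_part)
  then show ?thesis using that by blast
qed

lemma smooth_function_diff:
  assumes "\<And>p. p \<in> S \<Longrightarrow> \<exists>A z. invertible A \<and> chart A z = p"
    and f: "smooth_function S f" "smooth_function S g"
  shows "smooth_function S (\<lambda>p. f p - g p)"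
proof (rule smooth_functionI)
  fix p assume p: "p \<in> S"
  then obtain A z where A: "invertible A" "chart A z = p" using assms(1) by blast
  obtain W F where F: "open W" "z \<in> W" "smooth_on F W" "\<And>x. x \<in> W \<inter> affine_part A S \<Longrightarrow> F x = f (chart A x)"
    using smooth_functionE[OF f(1) A(1)] A(2) p by metis
  obtain W' F' where F': "open W'" "z \<in> W'" "smooth_on F' W'" "\<And>x. x \<in> W' \<inter> affine_part A S \<Longrightarrow> F' x = g (chart A x)"
    using smooth_functionE[OF f(2) A(1)] A(2) p by metis
  have op: "open (W \<inter> W')" using F F' by auto
  have "smooth_on (\<lambda>x. F x - F' x) (W \<inter> W')"
    by (intro smooth_on_diff op smooth_on_mono[OF F(3)] smooth_on_mono[OF F'(3)]) auto
  then show "\<exists>A z W F. invertible A \<and> chart A z = p \<and> open W \<and> z \<in> W \<and> smooth_on F W \<and>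
      (\<forall>x\<in>W \<inter> affine_part A S. F x = f (chart A x) - g (chart A x))"
    using A op F F' by (intro exI[of _ A] exI[of _ z] exI[of _ "W \<inter> W'"] exI[of _ "\<lambda>x. F x - F' x"]) auto
qed


section \<open>Complex covectors and complex hyperplanes\<close>

definition cdot :: "complex^'m \<Rightarrow> complex^'m \<Rightarrow> complex" where
  "cdot a v = (\<Sum>j\<in>UNIV. a $ j * v $ j)"

lemma cdot_add: "cdot (a + b) v = cdot a v + cdot b v" "cdot a (v + w) = cdot a v + cdot a w"
  by (simp_all add: cdot_def algebra_simps sum.distrib)

lemma cdot_cmul: "cdot (c *s a) v = c * cdot a v" "cdot a (c *s v) = c * cdot a v"
  by (simp_all add: cdot_def sum_distrib_left mult_ac)

lemma cdot_minus: "cdot (- a) v = - cdot a v" "cdot a (- v) = - cdot a v"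
  by (simp_all add: cdot_def sum_negf)

lemma cdot_commute: "cdot a v = cdot v a"
  by (simp add: cdot_def mult.commute)

lemma cdot_zero [simp]: "cdot 0 v = 0" "cdot a 0 = 0"
  by (simp_all add: cdot_def)

lemma cdot_axis: "cdot a (axis j c) = a $ j * c"
  by (simp add: cdot_def axis_def if_distrib cong: if_cong)

lemma cdot_homog: "cdot (homog a v) (homog b w) = a * b + cdot v w"
proof -
  have "cdot (homog a v) (homog b w) = (\<Sum>j\<in>insert None (range Some). homog a v $ j * homog b w $ j)"
    unfolding cdot_def UNIV_option_conv ..
  also have "\<dots> = a * b + cdot v w"
    by (subst sum.insert) (auto simp: sum.reindex cdot_def)
  finally show ?thesis .
qed

lemma cdot_transpose: "cdot (transpose B *v X) Z = cdot X (B *v Z)" for B :: "complex^'m^'n"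
proof -
  have "cdot (transpose B *v X) Z = (\<Sum>j\<in>UNIV. \<Sum>i\<in>UNIV. B $ i $ j * X $ i * Z $ j)"
    by (simp add: cdot_def matrix_vector_mult_def transpose_def sum_distrib_right)
  also have "\<dots> = (\<Sum>i\<in>UNIV. \<Sum>j\<in>UNIV. B $ i $ j * X $ i * Z $ j)"
    by (rule sum.swap)
  also have "\<dots> = cdot X (B *v Z)"
    by (simp add: cdot_def matrix_vector_mult_def sum_distrib_left mult_ac)
  finally show ?thesis .
qed

lemma cdot_eq_0_imp_zero: "(\<And>v. cdot a v = 0) \<Longrightarrow> a = 0"
  by (simp add: vec_eq_iff) (metis cdot_axis mult.right_neutral)

lemma linear_cdot: "linear (cdot a)"
  by (auto simp: linear_iff cdot_add scaleR_eq_cmul cdot_cmul scaleR_conv_of_real)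

lemma bounded_bilinear_cdot: "bounded_bilinear (cdot :: complex^'m::finite \<Rightarrow> complex^'m \<Rightarrow> complex)"
proof -
  have "bilinear (cdot :: complex^'m::finite \<Rightarrow> complex^'m \<Rightarrow> complex)"
    unfolding bilinear_def using linear_cdot cdot_commute[abs_def] by (metis (no_types, lifting) ext)
  then show ?thesis by (simp add: bilinear_conv_bounded_bilinear)
qed

text \<open>Test on vectors supported on two coordinates.\<close>

lemma kernel_subset_imp_proportional:
  assumes a: "a \<noteq> 0" and sub: "\<And>v. cdot a v = 0 \<Longrightarrow> cdot b v = 0"
  obtains c where "b = c *s a"
proof -
  obtain i where i: "a $ i \<noteq> 0" using a by (auto simp: vec_eq_iff)
  have "b $ j = b $ i / a $ i * a $ j" for j
  proof -
    have "cdot a (axis j (a $ i) + axis i (- a $ j)) = 0"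
      by (simp add: cdot_add cdot_axis)
    from sub[OF this] have "b $ j * a $ i = b $ i * a $ j"
      by (simp add: cdot_add cdot_axis)
    then show ?thesis using i by (simp add: field_simps)
  qed
  then have "b = (b $ i / a $ i) *s a"
    unfolding vec_eq_iff vector_smult_component by blast
  then show ?thesis by (rule that)
qed

lemma subspace_complex_hyperplane: "subspace {v. cdot a v = 0}"
  by (rule linear_subspace_kernel[OF linear_cdot])

text \<open>The hyperplane is the real orthogonal complement of the complex line through the conjugate
  of its covector.\<close>

lemma dim_complex_hyperplane:
  assumes "a \<noteq> (0 :: complex^'m)"
  shows "dim {v. cdot a v = 0} + 2 = DIM(complex^'m)"
proof -
  define b where "b = (\<chi> j. cnj (a $ j))"
  define C where "C = range (\<lambda>c. c *s b)"
  have lin: "linear (\<lambda>c. c *s b)"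
    by (auto simp: linear_iff vec_eq_iff algebra_simps)
  have inj: "inj (\<lambda>c. c *s b)"
    using assms by (auto simp: inj_def b_def vec_eq_iff)
  have C: "subspace C" unfolding C_def using linear_subspace_image[OF lin subspace_UNIV] .
  have "dim C = dim (UNIV :: complex set)"
    unfolding C_def by (rule dim_image_eq[OF lin]) (use inj in \<open>simp add: inj_on_def\<close>)
  then have dC: "dim C = 2" by simp
  have ip: "(c *s b) \<bullet> v = Re (cnj c * cdot a v)" for c v
    by (simp add: inner_vec_def cdot_def b_def inner_complex_def sum_distrib_left algebra_simps sum.distrib sum_subtractf)
  have "{v. cdot a v = 0} = {v \<in> UNIV. \<forall>x\<in>C. orthogonal x v}"
  proof (intro equalityI subsetI)
    fix v assume "v \<in> {v \<in> UNIV. \<forall>x\<in>C. orthogonal x v}"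
    then have "(cdot a v *s b) \<bullet> v = 0" by (auto simp: C_def orthogonal_def)
    then have "Re (cnj (cdot a v) * cdot a v) = 0" unfolding ip .
    then have "cmod (cdot a v) ^ 2 = 0" unfolding cmod_power2 by (simp add: power2_eq_square)
    then show "v \<in> {v. cdot a v = 0}" by (metis mem_Collect_eq norm_eq_zero power_eq_0_iff)
  qed (auto simp: C_def orthogonal_def ip)
  then show ?thesis
    using dim_subspace_orthogonal_to_vectors[OF C subspace_UNIV] dC by simp
qed

text \<open>All complex hyperplanes have the same dimension.\<close>

lemma complex_hyperplane_image_eq:
  assumes a: "a \<noteq> (0 :: complex^'m)" and b: "b \<noteq> (0 :: complex^'m)" and L: "linear L"
    and inj: "\<And>v. cdot a v = 0 \<Longrightarrow> L v = 0 \<Longrightarrow> v = 0" and maps: "\<And>v. cdot a v = 0 \<Longrightarrow> cdot b (L v) = 0"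
  shows "L ` {v. cdot a v = 0} = {v. cdot b v = 0}"
proof (rule subspace_dim_equal)
  let ?H = "{v. cdot a v = 0}"
  show "subspace (L ` ?H)" by (rule linear_subspace_image[OF L subspace_complex_hyperplane])
  show "subspace {v. cdot b v = 0}" by (rule subspace_complex_hyperplane)
  show "L ` ?H \<subseteq> {v. cdot b v = 0}" using maps by auto
  have "inj_on L (span ?H)"
    unfolding span_eq_iff[THEN iffD2, OF subspace_complex_hyperplane]
    using linear_inj_on_iff_eq_0[OF L subspace_complex_hyperplane] inj by auto
  then have "dim (L ` ?H) = dim ?H" by (rule dim_image_eq[OF L])
  then show "dim {v. cdot b v = 0} \<le> dim (L ` ?H)"
    using dim_complex_hyperplane[OF a] dim_complex_hyperplane[OF b] by simp
qed


section \<open>The complex gradient of a defining function\<close>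

text \<open>As a complex covector this is the holomorphic part of the derivative, and twice its real part is
  the derivative (\<open>FD_eq_cgrad\<close>); so its complex kernel is the complex tangent space.\<close>

definition cgrad :: "(complex^'n::finite \<Rightarrow> real) \<Rightarrow> complex^'n \<Rightarrow> complex^'n" where
  "cgrad \<rho> z = (\<chi> j. wirtinger \<rho> z j)"

lemma vec_eq_sum_axis_Re_Im:
  "v = (\<Sum>j\<in>UNIV. Re (v $ j) *\<^sub>R axis j 1 + Im (v $ j) *\<^sub>R axis j \<i>)" for v :: "complex^'n"
proof -
  have "(\<Sum>j\<in>UNIV. Re (v $ j) *\<^sub>R axis j 1 + Im (v $ j) *\<^sub>R axis j \<i>) $ k = v $ k" for k
  proof -
    have "(\<Sum>j\<in>UNIV. Re (v $ j) *\<^sub>R axis j 1 + Im (v $ j) *\<^sub>R axis j \<i>) $ k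
        = (\<Sum>j\<in>UNIV. if j = k then v $ k else 0)"
      unfolding sum_component by (rule sum.cong) (auto simp: axis_def complex_eq_iff)
    also have "\<dots> = v $ k" by simp
    finally show ?thesis .
  qed
  then show ?thesis by (simp add: vec_eq_iff)
qed

lemma FD_eq_cgrad:
  assumes "linear (FD \<rho> x)" shows "FD \<rho> x v = 2 * Re (cdot (cgrad \<rho> x) v)"
proof -
  have "FD \<rho> x v = (\<Sum>j\<in>UNIV. Re (v $ j) * FD \<rho> x (axis j 1) + Im (v $ j) * FD \<rho> x (axis j \<i>))"
    by (subst vec_eq_sum_axis_Re_Im) (simp add: linear_sum[OF assms] linear_add[OF assms] linear_scale[OF assms])
  also have "\<dots> = 2 * Re (cdot (cgrad \<rho> x) v)"
    unfolding cdot_def cgrad_def wirtinger_def Re_sum sum_distrib_left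
    by (rule sum.cong) (simp_all add: field_simps)
  finally show ?thesis .
qed

lemma smooth_on_wirtinger: "smooth_on \<rho> V \<Longrightarrow> open V \<Longrightarrow> smooth_on (\<lambda>x. wirtinger \<rho> x j) V"
  unfolding wirtinger_def
  by (intro smooth_on_divide smooth_on_diff smooth_on_mult smooth_on_of_real smooth_on_FD smooth_on_const) auto

lemma smooth_on_cgrad: "smooth_on \<rho> V \<Longrightarrow> open V \<Longrightarrow> smooth_on (cgrad \<rho>) V"
  unfolding cgrad_def[abs_def] by (intro smooth_on_vec smooth_on_wirtinger)

lemma smooth_on_cdot:
  "open V \<Longrightarrow> smooth_on f V \<Longrightarrow> smooth_on g V \<Longrightarrow> smooth_on (\<lambda>x. cdot (f x) (g x) :: complex) V"
  by (rule smooth_on_bilinear[OF _ bounded_bilinear_cdot])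

context
  fixes M :: "(complex^'n::finite) set" and V \<rho>
  assumes df: "defining_function M V \<rho>"
begin

lemma FD_defining: "x \<in> V \<Longrightarrow> FD \<rho> x v = 2 * Re (cdot (cgrad \<rho> x) v)"
  by (rule FD_eq_cgrad[OF smooth_on_FD_linear[OF defining_functionD(2,1)[OF df]]])

lemma tangent_space_cgrad:
  "x \<in> V \<Longrightarrow> x \<in> M \<Longrightarrow> tangent_space M x = {v. Re (cdot (cgrad \<rho> x) v) = 0}"
  unfolding tangent_space_eq[OF df] by (simp add: FD_defining)

lemma complex_tangent_space_cgrad:
  assumes "x \<in> V" "x \<in> M"
  shows "complex_tangent_space M x = {v. cdot (cgrad \<rho> x) v = 0}"
proof -
  have "v \<in> complex_tangent_space M x \<longleftrightarrow> v \<in> tangent_space M x \<and> \<i> *s v \<in> tangent_space M x" for v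
  proof
    assume "v \<in> complex_tangent_space M x"
    then obtain w where w: "v \<in> tangent_space M x" "w \<in> tangent_space M x" "v = \<i> *s w"
      unfolding complex_tangent_space_def by auto
    have "\<i> *s v = - w" unfolding w(3) by simp
    then show "v \<in> tangent_space M x \<and> \<i> *s v \<in> tangent_space M x"
      using w by (simp add: tangent_space_cgrad[OF assms] cdot_minus)
  next
    assume v: "v \<in> tangent_space M x \<and> \<i> *s v \<in> tangent_space M x"
    have "v = \<i> *s (- (\<i> *s v))" by (simp add: vec_eq_iff)
    moreover have "- (\<i> *s v) \<in> tangent_space M x"
      using v by (simp add: tangent_space_cgrad[OF assms] cdot_minus)
    ultimately show "v \<in> complex_tangent_space M x"
      using v unfolding complex_tangent_space_def by blast
  qed
  then show ?thesis
    unfolding tangent_space_cgrad[OF assms] by (auto simp: cdot_cmul complex_eq_iff)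
qed

lemma cgrad_nonzero: "x \<in> V \<Longrightarrow> x \<in> M \<Longrightarrow> cgrad \<rho> x \<noteq> 0"
  using defining_functionD(4)[OF df] FD_defining by fastforce

lemma gradient_inner:
  assumes "x \<in> V" shows "FD \<rho> x v = gradient \<rho> x \<bullet> v"
proof -
  have "FD \<rho> x v = (\<Sum>b\<in>Basis. (v \<bullet> b) *\<^sub>R FD \<rho> x b)"
    by (rule linear_sum_Basis[OF smooth_on_FD_linear[OF defining_functionD(2,1)[OF df] assms]])
  also have "\<dots> = gradient \<rho> x \<bullet> v"
    by (simp add: gradient_def inner_sum_left inner_commute[of v] mult.commute)
  finally show ?thesis .
qed

text \<open>Differentiating the factor that normalises the gradient contributes only a multiple of the
  gradient, which is orthogonal to tangent vectors.\<close>

lemma second_fundamental_form_eq_Hessian: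
  assumes z: "z \<in> V" "z \<in> M" and v: "v \<in> tangent_space M z"
  shows "second_fundamental_form \<rho> z v v = FD (\<lambda>x. FD \<rho> x v) z v / norm (gradient \<rho> z)"
proof -
  note D = defining_functionD[OF df]
  have sG: "smooth_on (gradient \<rho>) V"
    unfolding gradient_def[abs_def] by (intro smooth_on_sum smooth_on_scaleR smooth_on_FD smooth_on_const D)
  have DG: "(gradient \<rho> has_derivative FD (gradient \<rho>) z) (at z)"
    by (rule smooth_on_has_derivative[OF sG D(1) z(1)])
  have Gv: "gradient \<rho> z \<bullet> v = 0"
    using v gradient_inner[OF z(1)] tangent_space_eq[OF df z] by simp
  have G0: "gradient \<rho> z \<noteq> 0"
    using D(4)[OF z] gradient_inner[OF z(1)] by auto
  have nrm: "((\<lambda>x. norm (gradient \<rho> x)) has_derivative (\<lambda>w. FD (gradient \<rho>) z w \<bullet> sgn (gradient \<rho> z))) (at z)"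
    using has_derivative_compose[OF DG has_derivative_norm[OF G0]] .
  have n0: "norm (gradient \<rho> z) \<noteq> 0" using G0 by simp
  let ?n = "inverse (norm (gradient \<rho> z))"
  define s where "s = - (?n * (FD (gradient \<rho>) z v \<bullet> sgn (gradient \<rho> z)) * ?n)"
  have N: "FD (\<lambda>x. gradient \<rho> x /\<^sub>R norm (gradient \<rho> x)) z v = ?n *\<^sub>R FD (gradient \<rho>) z v + s *\<^sub>R gradient \<rho> z"
    unfolding s_def by (subst FD_eqI[OF has_derivative_scaleR[OF Deriv.has_derivative_inverse[OF n0 nrm] DG]]) (rule refl)
  have "((\<lambda>x. FD \<rho> x v) has_derivative (\<lambda>w. FD (gradient \<rho>) z w \<bullet> v)) (at z)"
    by (rule has_derivative_transform_within_open[OF has_derivative_inner_left[OF DG] D(1) z(1)])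
      (simp add: gradient_inner)
  then have "FD (\<lambda>x. FD \<rho> x v) z v = FD (gradient \<rho>) z v \<bullet> v" by (simp add: FD_eqI)
  then show ?thesis
    unfolding second_fundamental_form_def N by (simp add: inner_add_left Gv divide_inverse mult.commute)
qed

text \<open>With \<open>w = v\<close> this is the link between the Gauss map and the second fundamental form.\<close>

lemma Hessian_eq_cgrad:
  assumes z: "z \<in> V"
  shows "FD (\<lambda>x. FD \<rho> x w) z v = 2 * Re (cdot (FD (cgrad \<rho>) z v) w)"
proof -
  note D = defining_functionD[OF df]
  have "bounded_linear (\<lambda>a. 2 * Re (cdot a w))"
  proof -
    have "linear (\<lambda>a. 2 * Re (cdot a w))"
      by (auto simp: linear_iff cdot_add scaleR_eq_cmul cdot_cmul)
    then show ?thesis by (simp add: linear_conv_bounded_linear)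
  qed
  from bounded_linear.has_derivative[OF this smooth_on_has_derivative[OF smooth_on_cgrad[OF D(2,1)] D(1) z]]
  have "((\<lambda>x. FD \<rho> x w) has_derivative (\<lambda>v. 2 * Re (cdot (FD (cgrad \<rho>) z v) w))) (at z)"
    by (rule has_derivative_transform_within_open[OF _ D(1) z]) (simp add: FD_defining)
  then show ?thesis by (simp add: FD_eqI)
qed

end

text \<open>The factor \<open>s\<close> carries the sign of the form.\<close>

lemma definite_cgrad:
  assumes "definite_second_fundamental_form M z"
  obtains V \<rho> s where "z \<in> V" "z \<in> M" "defining_function M V \<rho>" "s \<noteq> 0"
    "\<And>v. v \<in> tangent_space M z \<Longrightarrow> v \<noteq> 0 \<Longrightarrow> s * Re (cdot (FD (cgrad \<rho>) z v) v) > 0"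
proof -
  obtain V \<rho> where V: "z \<in> V" "z \<in> M" "defining_function M V \<rho>"
    "(\<forall>v\<in>tangent_space M z. v \<noteq> 0 \<longrightarrow> second_fundamental_form \<rho> z v v > 0) \<or>
     (\<forall>v\<in>tangent_space M z. v \<noteq> 0 \<longrightarrow> second_fundamental_form \<rho> z v v < 0)"
    using assms unfolding definite_second_fundamental_form_def by blast
  have eq: "second_fundamental_form \<rho> z v v = 2 * Re (cdot (FD (cgrad \<rho>) z v) v) / norm (gradient \<rho> z)"
    if "v \<in> tangent_space M z" for v
    using second_fundamental_form_eq_Hessian[OF V(3,1,2) that] Hessian_eq_cgrad[OF V(3,1)] by simp
  from V(4) show thesis
  proof
    assume pos: "\<forall>v\<in>tangent_space M z. v \<noteq> 0 \<longrightarrow> second_fundamental_form \<rho> z v v > 0"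
    show thesis
      by (rule that[OF V(1-3), of 1]) (use pos eq in \<open>auto simp: zero_less_divide_iff\<close>)
  next
    assume neg: "\<forall>v\<in>tangent_space M z. v \<noteq> 0 \<longrightarrow> second_fundamental_form \<rho> z v v < 0"
    show thesis
      by (rule that[OF V(1-3), of "-1"]) (use neg eq in \<open>auto simp: divide_less_0_iff\<close>)
  qed
qed

section \<open>Conormal lifts and the dual complex structure\<close>

text \<open>A covector field in homogeneous coordinates along \<open>M\<close> that represents the complex tangent
  hyperplanes, that is, a lift of the Gauss map of \<open>M\<close> into the dual projective space.\<close>

definition conormal_lift :: "(complex^'n::finite) set \<Rightarrow> (complex^'n) set \<Rightarrow> (complex^'n \<Rightarrow> complex^('n option)) \<Rightarrow> bool" where
  "conormal_lift M U \<omega> \<longleftrightarrow> (\<forall>x\<in>M \<inter> U. \<omega> x \<noteq> 0 \<and> cdot (\<omega> x) (homog 1 x) = 0 \<and>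
     (\<forall>v\<in>complex_tangent_space M x. cdot (\<omega> x) (homog 0 v) = 0))"

lemma conormal_liftD:
  assumes "conormal_lift M U \<omega>" "x \<in> M" "x \<in> U"
  shows "\<omega> x \<noteq> 0" "cdot (\<omega> x) (homog 1 x) = 0" "v \<in> complex_tangent_space M x \<Longrightarrow> cdot (\<omega> x) (homog 0 v) = 0"
  using assms unfolding conormal_lift_def by auto

lemma homog_eq_0_iff: "homog a v = 0 \<longleftrightarrow> a = 0 \<and> v = 0"
  by (auto simp: vec_option_eq_iff vec_eq_iff)

text \<open>The hyperplane through \<open>x\<close> with covector \<open>a\<close> has the homogeneous equation \<open>a \<cdot> Z - (a \<cdot> x) Z\<^sub>0 = 0\<close>.\<close>

lemma conormal_lift_cgrad:
  assumes df: "defining_function M V \<rho>"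
  shows "conormal_lift M V (\<lambda>x. homog (- cdot (cgrad \<rho> x) x) (cgrad \<rho> x))"
  unfolding conormal_lift_def
  using cgrad_nonzero[OF df] complex_tangent_space_cgrad[OF df]
  by (auto simp: homog_eq_0_iff cdot_homog)

text \<open>A lift annihilates the point and the complex tangent space, which together span a hyperplane, the
  kernel of the lift given by a complex gradient.\<close>

lemma conormal_lift_proportional:
  assumes M: "smooth_hypersurface M" and x: "x \<in> M" "x \<in> U" "x \<in> U'"
    and \<omega>: "conormal_lift M U \<omega>" "conormal_lift M U' \<omega>'"
  obtains c where "c \<noteq> 0" "\<omega>' x = c *s \<omega> x"
proof -
  obtain V \<rho> where V: "x \<in> V" "defining_function M V \<rho>"
    using smooth_hypersurfaceE[OF M x(1) open_UNIV UNIV_I] by metis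
  let ?a = "homog (- cdot (cgrad \<rho> x) x) (cgrad \<rho> x)"
  have a: "?a \<noteq> 0" using cgrad_nonzero[OF V(2,1) x(1)] by (simp add: homog_eq_0_iff)
  have kernel: "cdot (\<eta> x) Z = 0" if \<eta>: "conormal_lift M W \<eta>" "x \<in> W" and Z: "cdot ?a Z = 0" for \<eta> W Z
  proof -
    define v where "v = (\<chi> j. Z $ Some j - Z $ None * x $ j)"
    have Zeq: "Z = Z $ None *s homog 1 x + homog 0 v"
      by (simp add: vec_option_eq_iff v_def)
    have "cdot ?a Z = cdot ?a (Z $ None *s homog 1 x + homog 0 v)" using Zeq by simp
    then have "cdot (cgrad \<rho> x) v = 0" using Z by (simp add: cdot_add cdot_cmul cdot_homog)
    then have "v \<in> complex_tangent_space M x" using complex_tangent_space_cgrad[OF V(2,1) x(1)] by simp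
    then have "cdot (\<eta> x) (Z $ None *s homog 1 x + homog 0 v) = 0"
      using conormal_liftD[OF \<eta>(1) x(1) \<eta>(2)] by (simp add: cdot_add cdot_cmul)
    then show ?thesis using Zeq by simp
  qed
  obtain c1 where c1: "\<omega> x = c1 *s ?a"
    using kernel_subset_imp_proportional[OF a kernel[OF \<omega>(1) x(2)]] by metis
  obtain c2 where c2: "\<omega>' x = c2 *s ?a"
    using kernel_subset_imp_proportional[OF a kernel[OF \<omega>(2) x(3)]] by metis
  have "c1 \<noteq> 0" "c2 \<noteq> 0"
    using c1 c2 conormal_liftD(1)[OF \<omega>(1) x(1,2)] conormal_liftD(1)[OF \<omega>(2) x(1,3)] by auto
  then show ?thesis using that[of "c2 / c1"] by (simp add: c1 c2 vector_smult_assoc)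
qed

text \<open>Two lifts are pointwise proportional. Differentiating the cross-multiplied relation between
  their components shows that their derivatives agree up to that factor modulo the lift itself.\<close>

lemma conormal_lift_derivative:
  assumes M: "smooth_hypersurface M" and z: "z \<in> M" "z \<in> U" "z \<in> U'" and U: "open U" "open U'"
    and \<omega>: "conormal_lift M U \<omega>" "conormal_lift M U' \<omega>'"
    and D: "(\<omega> has_derivative D) (at z within M)" "(\<omega>' has_derivative D') (at z within M)"
  obtains c \<kappa> where "c \<noteq> 0" "\<omega>' z = c *s \<omega> z" "\<And>u. u \<in> tangent_space M z \<Longrightarrow> D' u = c *s D u + \<kappa> u *s \<omega> z"
proof -
  obtain c where c: "c \<noteq> 0" "\<omega>' z = c *s \<omega> z"
    using conormal_lift_proportional[OF M z \<omega>] by metis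
  obtain i where i: "\<omega> z $ i \<noteq> 0" using conormal_liftD(1)[OF \<omega>(1) z(1,2)] by (auto simp: vec_eq_iff)
  define \<kappa> where "\<kappa> u = (D' u $ i - c * D u $ i) / \<omega> z $ i" for u
  have nth: "((\<lambda>x. \<omega> x $ j) has_derivative (\<lambda>u. D u $ j)) (at z within M)"
    "((\<lambda>x. \<omega>' x $ j) has_derivative (\<lambda>u. D' u $ j)) (at z within M)" for j
    using bounded_linear.has_derivative[OF bounded_linear_vec_nth] D by blast+
  have "D' u $ j = c * D u $ j + \<kappa> u * \<omega> z $ j" if u: "u \<in> tangent_space M z" for u j
  proof -
    have eq: "\<omega>' x $ j * \<omega> x $ i = \<omega>' x $ i * \<omega> x $ j" if "x \<in> M \<inter> (U \<inter> U')" for x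
    proof -
      obtain c' where "\<omega>' x = c' *s \<omega> x"
        using conormal_lift_proportional[OF M _ _ _ \<omega>, of x] \<open>x \<in> M \<inter> (U \<inter> U')\<close> by auto
      then show ?thesis by simp
    qed
    have "\<omega>' z $ j * D u $ i + D' u $ j * \<omega> z $ i = \<omega>' z $ i * D u $ j + D' u $ i * \<omega> z $ j"
      by (rule derivative_within_unique[where W = "U \<inter> U'", OF M z(1) u has_derivative_mult[OF nth(2) nth(1)]
            has_derivative_mult[OF nth(2) nth(1)] _ _ eq]) (use U z in auto)
    then show ?thesis using i unfolding \<kappa>_def c(2) by (simp add: field_simps)
  qed
  then have "D' u = c *s D u + \<kappa> u *s \<omega> z" if "u \<in> tangent_space M z" for u
    using that by (simp add: vec_eq_iff)
  then show ?thesis using that c by blast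
qed

lemma dpmap_complex_tangent:
  assumes S: "smooth_cp_hypersurface S" and A: "invertible A" "invertible A'"
    and x: "chart A x \<in> S" "pden (transition A A') x \<noteq> 0"
    and v: "v \<in> complex_tangent_space (affine_part A S) x"
  shows "dpmap (transition A A') x v \<in> complex_tangent_space (affine_part A' S) (pmap (transition A A') x)"
proof -
  have xM: "x \<in> affine_part A S" using x by simp
  have y: "pmap (transition A A') x \<in> affine_part A' S" using chart_pmap[OF A x(2)] x by simp
  show ?thesis
    using v dpmap_tangent[OF S A x]
    unfolding mem_complex_tangent_space[OF affine_part_hypersurface[OF S A(1)] xM]
      mem_complex_tangent_space[OF affine_part_hypersurface[OF S A(2)] y] by (metis dpmap_cmul)
qed

text \<open>The relation between derivatives of a lift that defines the dual complex structure does not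
  depend on the chart or on the lift.\<close>

lemma conormal_lift_transfer:
  assumes S: "smooth_cp_hypersurface S" and A: "invertible A" "invertible A'"
    and z: "chart A z \<in> S" "z \<in> U" "open U" and eq: "chart A' z' = chart A z" and z': "z' \<in> U'" "open U'"
    and \<omega>: "conormal_lift (affine_part A S) U \<omega>" "(\<omega> has_derivative D) (at z within affine_part A S)"
    and \<omega>': "conormal_lift (affine_part A' S) U' \<omega>'" "(\<omega>' has_derivative D') (at z' within affine_part A' S)"
    and v: "v \<in> tangent_space (affine_part A S) z" "w \<in> tangent_space (affine_part A S) z"
    and rel: "a *s D v + b *s D w = k *s \<omega> z"
  obtains k' where "a *s D' (dpmap (transition A A') z v) + b *s D' (dpmap (transition A A') z w) = k' *s \<omega>' z'"
proof -
  let ?B = "transition A A'" and ?M = "affine_part A S" and ?M' = "affine_part A' S"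
  have N: "pden ?B z \<noteq> 0" "z' = pmap ?B z" using chart_eq_iff[OF A] eq by metis+
  \<comment> \<open>Covectors pull back by the transpose, so this is a second lift in the first chart.\<close>
  define \<omega>2 where "\<omega>2 x = transpose ?B *v \<omega>' (pmap ?B x)" for x
  define U2 where "U2 = {x. pden ?B x \<noteq> 0} \<inter> pmap ?B -` U'"
  have U2: "open U2" unfolding U2_def
    by (rule continuous_open_preimage[OF smooth_on_continuous[OF smooth_on_pmap[OF open_pden]] open_pden z'(2)]) auto
  have zU2: "z \<in> U2" using N z' by (simp add: U2_def)
  have surj: "?B *v (transition A' A *v Z) = Z" for Z
    using A by (metis invertible_mult_eq_iff transition_mult)
  have inj: "X = 0" if "transpose ?B *v X = 0" for X
  proof (rule cdot_eq_0_imp_zero)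
    show "cdot X Z = 0" for Z
      using cdot_transpose[of ?B X "transition A' A *v Z"] that by (simp add: surj)
  qed
  have lift2: "conormal_lift ?M U2 \<omega>2"
    unfolding conormal_lift_def
  proof (intro ballI conjI)
    fix x assume x: "x \<in> ?M \<inter> U2"
    have n: "pden ?B x \<noteq> 0" and xS: "chart A x \<in> S" using x by (auto simp: U2_def)
    have y: "pmap ?B x \<in> ?M'" "pmap ?B x \<in> U'" using x chart_pmap[OF A, of x] by (auto simp: U2_def)
    note L = conormal_liftD[OF \<omega>'(1) y]
    show "\<omega>2 x \<noteq> 0" using L(1) inj by (auto simp: \<omega>2_def)
    show "cdot (\<omega>2 x) (homog 1 x) = 0"
      unfolding \<omega>2_def cdot_transpose homog_pmap[OF n] by (simp add: cdot_cmul L(2))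
    fix v assume v: "v \<in> complex_tangent_space ?M x"
    show "cdot (\<omega>2 x) (homog 0 v) = 0"
      unfolding \<omega>2_def cdot_transpose
      by (subst homog_dpmap[OF n]) (simp add: cdot_add cdot_cmul L(2) L(3)[OF dpmap_complex_tangent[OF S A xS n v]])
  qed
  have D2: "(\<omega>2 has_derivative (\<lambda>u. transpose ?B *v D' (dpmap ?B z u))) (at z within ?M)"
  proof -
    have "((\<lambda>x. \<omega>' (pmap ?B x)) has_derivative (\<lambda>u. D' (dpmap ?B z u))) (at z within ?M \<inter> U2)"
    proof (rule has_derivative_in_compose[of "pmap ?B" _ z _ \<omega>'])
      show "(pmap ?B has_derivative dpmap ?B z) (at z within ?M \<inter> U2)"
        by (rule has_derivative_at_withinI[OF has_derivative_pmap[OF N(1)]])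
      show "(\<omega>' has_derivative D') (at (pmap ?B z) within pmap ?B ` (?M \<inter> U2))"
        unfolding N(2)[symmetric] by (rule has_derivative_subset[OF \<omega>'(2)]) (auto simp: chart_pmap[OF A] U2_def)
    qed
    then have "((\<lambda>x. \<omega>' (pmap ?B x)) has_derivative (\<lambda>u. D' (dpmap ?B z u))) (at z within ?M)"
      using at_within_Int_open[OF U2 zU2] by metis
    from bounded_linear.has_derivative[OF linear_matrix_vector[unfolded linear_conv_bounded_linear] this]
    show ?thesis unfolding \<omega>2_def .
  qed
  have zM: "z \<in> ?M" using z by simp
  obtain c \<kappa> where c: "c \<noteq> 0" "\<omega>2 z = c *s \<omega> z"
    "\<And>u. u \<in> tangent_space ?M z \<Longrightarrow> transpose ?B *v D' (dpmap ?B z u) = c *s D u + \<kappa> u *s \<omega> z"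
    by (rule conormal_lift_derivative[OF affine_part_hypersurface[OF S A(1)] zM z(2) zU2 z(3) U2 \<omega>(1) lift2 \<omega>(2) D2]) (rule that)
  define k' where "k' = (c * k + a * \<kappa> v + b * \<kappa> w) / c"
  let ?X = "a *s D' (dpmap ?B z v) + b *s D' (dpmap ?B z w)"
  have "transpose ?B *v ?X = a *s (c *s D v + \<kappa> v *s \<omega> z) + b *s (c *s D w + \<kappa> w *s \<omega> z)"
    unfolding matrix_vector_right_distrib matrix_vector_mult_cmul c(3)[OF v(1)] c(3)[OF v(2)] ..
  also have "\<dots> = c *s (a *s D v + b *s D w) + (a * \<kappa> v + b * \<kappa> w) *s \<omega> z"
    by (simp add: vec_eq_iff algebra_simps)
  also have "\<dots> = k' *s (c *s \<omega> z)"
    unfolding rel using c(1) by (simp add: vec_eq_iff k'_def field_simps)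
  also have "\<dots> = transpose ?B *v (k' *s \<omega>' z')"
    using c(2) by (simp add: \<omega>2_def matrix_vector_mult_cmul N(2))
  finally have "transpose ?B *v (?X - k' *s \<omega>' z') = 0"
    by (simp add: matrix_vector_mult_diff_distrib)
  then have "?X = k' *s \<omega>' z'" using inj by fastforce
  then show ?thesis by (rule that)
qed

text \<open>The two ways in which strong convexity enters: the derivative of the Gauss map has no kernel on the
  complex tangent spaces, and it is complex linear along no nonzero vector. Both are proved in the
  convex chart, where pairing the derivative of the complex gradient with the vector computes the
  second fundamental form, and carried to all other charts and lifts. A kernel vector would be a
  zero of that form, and complex linearity along \<open>v\<close> would give it opposite signs at \<open>v\<close> and \<open>\<i> v\<close>.\<close>

lemma strongly_C_convex_conormal_lift:
  assumes S: "smooth_cp_hypersurface S" and conv: "strongly_C_convex S" and A: "invertible A" and z: "chart A z \<in> S"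
    and U: "z \<in> U" "open U" and \<omega>: "conormal_lift (affine_part A S) U \<omega>"
    and D: "(\<omega> has_derivative D) (at z within affine_part A S)"
    and v: "v \<in> complex_tangent_space (affine_part A S) z"
  shows "D v = k *s \<omega> z \<Longrightarrow> v = 0" and "D (\<i> *s v) - \<i> *s D v = k *s \<omega> z \<Longrightarrow> v = 0"
proof -
  obtain A0 z0 V1 where A0: "invertible A0" "chart A0 z0 = chart A z" "z0 \<in> V1"
    "\<And>x. x \<in> V1 \<inter> affine_part A0 S \<Longrightarrow> definite_second_fundamental_form (affine_part A0 S) x"
    using conv z unfolding strongly_C_convex_def by blast
  let ?M = "affine_part A S" and ?N = "affine_part A0 S" and ?B = "transition A A0"
  have def: "definite_second_fundamental_form ?N z0" using A0(2-4) z by simp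
  obtain V \<rho> s where V: "z0 \<in> V" "z0 \<in> ?N" "defining_function ?N V \<rho>" "s \<noteq> 0"
    and pos: "\<And>v. v \<in> tangent_space ?N z0 \<Longrightarrow> v \<noteq> 0 \<Longrightarrow> s * Re (cdot (FD (cgrad \<rho>) z0 v) v) > 0"
    using definite_cgrad[OF def] by metis
  note DD = defining_functionD[OF V(3)]
  define \<omega>0 where "\<omega>0 x = homog (- cdot (cgrad \<rho> x) x) (cgrad \<rho> x)" for x
  have lift0: "conormal_lift ?N V \<omega>0" unfolding \<omega>0_def by (rule conormal_lift_cgrad[OF V(3)])
  have comp: "smooth_on (\<lambda>x. case i of None \<Rightarrow> - cdot (cgrad \<rho> x) x | Some j \<Rightarrow> cgrad \<rho> x $ j) V" for i
    by (cases i) (auto intro!: smooth_on_uminus smooth_on_cdot smooth_on_cgrad smooth_on_vec_nth smooth_on_id DD)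
  have smooth0: "smooth_on \<omega>0 V"
    unfolding \<omega>0_def homog_def by (rule smooth_on_vec[OF DD(1) comp])
  have D0: "(\<omega>0 has_derivative FD \<omega>0 z0) (at z0)" by (rule smooth_on_has_derivative[OF smooth0 DD(1) V(1)])
  have Dcg: "(cgrad \<rho> has_derivative FD (cgrad \<rho>) z0) (at z0)"
    by (rule smooth_on_has_derivative[OF smooth_on_cgrad[OF DD(2,1)] DD(1) V(1)])
  have D0nth: "FD \<omega>0 z0 u $ Some j = FD (cgrad \<rho>) z0 u $ j" for u j
  proof -
    have "((\<lambda>x. \<omega>0 x $ Some j) has_derivative (\<lambda>u. FD \<omega>0 z0 u $ Some j)) (at z0)"
      by (rule bounded_linear.has_derivative[OF bounded_linear_vec_nth D0])
    moreover have "((\<lambda>x. \<omega>0 x $ Some j) has_derivative (\<lambda>u. FD (cgrad \<rho>) z0 u $ j)) (at z0)"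
      unfolding \<omega>0_def homog_nth by (rule bounded_linear.has_derivative[OF bounded_linear_vec_nth Dcg])
    ultimately show ?thesis using has_derivative_unique by metis
  qed
  have pair0: "cdot (FD \<omega>0 z0 u) (homog 0 w) = cdot (FD (cgrad \<rho>) z0 u) w" for u w
  proof -
    have "FD \<omega>0 z0 u = homog (FD \<omega>0 z0 u $ None) (FD (cgrad \<rho>) z0 u)"
      by (simp add: vec_option_eq_iff D0nth)
    then show ?thesis by (metis cdot_homog mult_zero_right add_0)
  qed
  have N: "pden ?B z \<noteq> 0" "z0 = pmap ?B z" using chart_eq_iff[OF A A0(1)] A0(2) by metis+
  define v0 where "v0 = dpmap ?B z v"
  have zM: "z \<in> ?M" using z by simp
  have v0H: "v0 \<in> complex_tangent_space ?N z0"
    unfolding v0_def N(2) by (rule dpmap_complex_tangent[OF S A A0(1) z N(1) v])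
  then have v0T: "v0 \<in> tangent_space ?N z0" "\<i> *s v0 \<in> tangent_space ?N z0"
    using mem_complex_tangent_space[OF affine_part_hypersurface[OF S A0(1)] V(2)] by auto
  have vT: "v \<in> tangent_space ?M z" "\<i> *s v \<in> tangent_space ?M z"
    using v mem_complex_tangent_space[OF affine_part_hypersurface[OF S A] zM] by auto
  have v0_0: "v = 0" if "v0 = 0"
  proof -
    have "dchart A z v = dchart A0 z0 v0" using dchart_dpmap[OF A A0(1) N(1), of v] N(2) v0_def by simp
    moreover have "dchart A z 0 = dchart A0 z0 0"
      using dchart_dpmap[OF A A0(1) N(1), of 0] unfolding linear_0[OF linear_dpmap] N(2)[symmetric] by simp
    ultimately have "dchart A z v = dchart A z 0" using that by simp
    then show ?thesis by (simp add: dchart_inj[OF A])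
  qed
  have lift_v0: "cdot (\<omega>0 z0) (homog 0 v0) = 0"
    by (rule conormal_liftD(3)[OF lift0 V(2,1) v0H])
  note transfer = conormal_lift_transfer[OF S A A0(1) z U A0(2) V(1) DD(1) \<omega> D lift0 has_derivative_at_withinI[OF D0]]
  show "v = 0" if "D v = k *s \<omega> z"
  proof -
    have "1 *s D v + 0 *s D v = k *s \<omega> z" using that by simp
    from transfer[OF vT(1) vT(1) this] obtain k' where "1 *s FD \<omega>0 z0 v0 + 0 *s FD \<omega>0 z0 v0 = k' *s \<omega>0 z0"
      unfolding v0_def by blast
    then have "FD \<omega>0 z0 v0 = k' *s \<omega>0 z0" by simp
    then have "cdot (FD (cgrad \<rho>) z0 v0) v0 = 0"
      using pair0[of v0 v0] lift_v0 by (simp add: cdot_cmul)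
    then show ?thesis using pos[OF v0T(1)] v0_0 by fastforce
  qed
  show "v = 0" if "D (\<i> *s v) - \<i> *s D v = k *s \<omega> z"
  proof -
    have "1 *s D (\<i> *s v) + (- \<i>) *s D v = k *s \<omega> z" using that by (simp add: vec_eq_iff)
    from transfer[OF vT(2) vT(1) this] obtain k' where
      "1 *s FD \<omega>0 z0 (\<i> *s v0) + (- \<i>) *s FD \<omega>0 z0 v0 = k' *s \<omega>0 z0"
      unfolding v0_def dpmap_cmul by blast
    then have "cdot (1 *s FD \<omega>0 z0 (\<i> *s v0) + (- \<i>) *s FD \<omega>0 z0 v0) (homog 0 v0) = 0"
      using lift_v0 by (simp add: cdot_cmul)
    then have "cdot (FD (cgrad \<rho>) z0 (\<i> *s v0)) v0 = \<i> * cdot (FD (cgrad \<rho>) z0 v0) v0"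
      unfolding cdot_add cdot_cmul pair0 by (simp add: algebra_simps)
    then have "cdot (FD (cgrad \<rho>) z0 (\<i> *s v0)) (\<i> *s v0) = - cdot (FD (cgrad \<rho>) z0 v0) v0"
      by (simp add: cdot_cmul)
    then have neg: "s * Re (cdot (FD (cgrad \<rho>) z0 (\<i> *s v0)) (\<i> *s v0)) = - (s * Re (cdot (FD (cgrad \<rho>) z0 v0) v0))"
      by simp
    show ?thesis
    proof (rule ccontr)
      assume "v \<noteq> 0"
      then have "v0 \<noteq> 0" using v0_0 by blast
      moreover from this have "\<i> *s v0 \<noteq> 0" by (auto simp: vec_eq_iff)
      ultimately show False using pos[OF v0T(1)] pos[OF v0T(2)] neg by linarith
    qed
  qed
qed

text \<open>The complex gradients of two defining functions have the same kernel, so they are proportional,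
  and the factor cancels in the quotient.\<close>

lemma dual_map_eq:
  assumes df: "defining_function M V \<rho>" and z: "z \<in> V" "z \<in> M"
  shows "dual_map M z = (\<chi> j. wirtinger \<rho> z j / (\<Sum>m\<in>UNIV. z $ m * wirtinger \<rho> z m))"
  unfolding dual_map_def
proof (rule the_equality)
  fix w assume "\<exists>V \<rho>. z \<in> V \<inter> M \<and> defining_function M V \<rho> \<and>
        w = (\<chi> j. wirtinger \<rho> z j / (\<Sum>m\<in>UNIV. z $ m * wirtinger \<rho> z m))"
  then obtain V' \<rho>' where *: "z \<in> V'" "defining_function M V' \<rho>'"
    "w = (\<chi> j. wirtinger \<rho>' z j / (\<Sum>m\<in>UNIV. z $ m * wirtinger \<rho>' z m))" by blast
  have "cdot (cgrad \<rho>' z) v = 0" if "cdot (cgrad \<rho> z) v = 0" for v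
    using complex_tangent_space_cgrad[OF df z] complex_tangent_space_cgrad[OF *(2,1) z(2)] that by blast
  then obtain c where c: "cgrad \<rho>' z = c *s cgrad \<rho> z"
    using kernel_subset_imp_proportional[OF cgrad_nonzero[OF df z]] by metis
  then have "c \<noteq> 0" using cgrad_nonzero[OF *(2,1) z(2)] by auto
  have "wirtinger \<rho>' z j = c * wirtinger \<rho> z j" for j
    using arg_cong[OF c, of "\<lambda>v. v $ j"] by (simp add: cgrad_def)
  then have "(\<Sum>m\<in>UNIV. z $ m * wirtinger \<rho>' z m) = c * (\<Sum>m\<in>UNIV. z $ m * wirtinger \<rho> z m)"
    "wirtinger \<rho>' z j = c * wirtinger \<rho> z j" for j
    by (simp_all add: sum_distrib_left mult_ac)
  then show "w = (\<chi> j. wirtinger \<rho> z j / (\<Sum>m\<in>UNIV. z $ m * wirtinger \<rho> z m))"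
    unfolding *(3) using \<open>c \<noteq> 0\<close> by (simp add: vec_eq_iff)
qed (use assms in blast)

lemma dual_map_cgrad:
  assumes "defining_function M V \<rho>" "z \<in> V" "z \<in> M"
  shows "dual_map M z = inverse (cdot (cgrad \<rho> z) z) *s cgrad \<rho> z"
  unfolding dual_map_eq[OF assms] by (simp add: vec_eq_iff cgrad_def cdot_def divide_inverse mult.commute)

lemma tangents_avoid_origin_cgrad:
  assumes "defining_function M V \<rho>" "z \<in> V" "z \<in> M" "z \<in> W" "tangents_avoid_origin M W"
  shows "cdot (cgrad \<rho> z) z \<noteq> 0"
proof
  assume "cdot (cgrad \<rho> z) z = 0"
  then have "- z \<in> complex_tangent_space M z"
    unfolding complex_tangent_space_cgrad[OF assms(1-3)] by (simp add: cdot_minus)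
  then have "0 \<in> (\<lambda>v. z + v) ` complex_tangent_space M z" by (force simp: image_iff)
  then show False using assms(3-5) unfolding tangents_avoid_origin_def by blast
qed

context
  fixes M :: "(complex^'n::finite) set" and W z
  assumes M: "smooth_hypersurface M" and z: "z \<in> M" "z \<in> W" and W: "open W" "tangents_avoid_origin M W"
begin

lemma dual_map_has_derivative:
  "(dual_map M has_derivative frechet_derivative (dual_map M) (at z within M)) (at z within M)"
proof -
  obtain V \<rho> where V: "z \<in> V" "V \<subseteq> W" "defining_function M V \<rho>"
    using smooth_hypersurfaceE[OF M z(1) W(1) z(2)] by metis
  note D = defining_functionD[OF V(3)]
  have s: "smooth_on (\<lambda>x. cdot (cgrad \<rho> x) x) V"
    by (intro smooth_on_cdot smooth_on_cgrad smooth_on_id D)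
  let ?V = "{x \<in> V. cdot (cgrad \<rho> x) x \<noteq> 0}"
  have op: "open ?V"
    using continuous_open_preimage[OF smooth_on_continuous[OF s] D(1), of "- {0}"] by (auto simp: vimage_def Int_def)
  have sc: "smooth_on (cgrad \<rho>) ?V" by (rule smooth_on_mono[OF smooth_on_cgrad[OF D(2,1)]]) auto
  have "smooth_on (\<lambda>x. \<chi> j. inverse (cdot (cgrad \<rho> x) x) * cgrad \<rho> x $ j) ?V"
    by (intro smooth_on_vec smooth_on_mult smooth_on_inverse smooth_on_vec_nth smooth_on_mono[OF s] sc op) auto
  then have "smooth_on (\<lambda>x. inverse (cdot (cgrad \<rho> x) x) *s cgrad \<rho> x) ?V"
    by (simp add: vector_scalar_mult_def)
  note sm = this
  have "z \<in> ?V" using tangents_avoid_origin_cgrad[OF V(3,1) z W(2)] V(1) by simp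
  from extension_has_derivative[OF sm op this z(1), of "dual_map M"]
  have "dual_map M differentiable (at z within M)"
    using dual_map_cgrad[OF V(3)] by (auto simp: differentiable_def)
  then show ?thesis using frechet_derivative_works by blast
qed

lemma dual_map_point:
  assumes "x \<in> M" "x \<in> W"
  shows "dual_map M x \<noteq> 0" "cdot (dual_map M x) x = 1" "complex_tangent_space M x = {v. cdot (dual_map M x) v = 0}"
proof -
  obtain V \<rho> where V: "x \<in> V" "defining_function M V \<rho>"
    using smooth_hypersurfaceE[OF M assms(1) open_UNIV UNIV_I] by metis
  have n: "cdot (cgrad \<rho> x) x \<noteq> 0" by (rule tangents_avoid_origin_cgrad[OF V(2,1) assms W(2)])
  note eq = dual_map_cgrad[OF V(2,1) assms(1)]
  show one: "cdot (dual_map M x) x = 1" using n by (simp add: eq cdot_cmul)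
  then show "dual_map M x \<noteq> 0" by auto
  show "complex_tangent_space M x = {v. cdot (dual_map M x) v = 0}"
    unfolding complex_tangent_space_cgrad[OF V(2,1) assms(1)] eq using n by (simp add: cdot_cmul)
qed

lemma conormal_lift_dual_map: "conormal_lift M W (\<lambda>x. homog (- 1) (dual_map M x))"
  unfolding conormal_lift_def using dual_map_point by (auto simp: homog_eq_0_iff cdot_homog)

lemma conormal_lift_dual_map_derivative:
  "((\<lambda>x. homog (- 1) (dual_map M x)) has_derivative
    (\<lambda>v. homog 0 (frechet_derivative (dual_map M) (at z within M) v))) (at z within M)"
proof -
  have eq: "(\<lambda>x. homog (- 1) (dual_map M x)) = (\<lambda>x. homog (- 1) 0 + homog 0 (dual_map M x))"
    by (rule ext) (simp add: vec_option_eq_iff)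
  have "((\<lambda>x. homog (- 1) 0 + homog 0 (dual_map M x)) has_derivative
      (\<lambda>v. 0 + homog 0 (frechet_derivative (dual_map M) (at z within M) v))) (at z within M)"
    by (intro has_derivative_add has_derivative_const
        bounded_linear.has_derivative[OF linear_homog_0[unfolded linear_conv_bounded_linear] dual_map_has_derivative])
  then show ?thesis unfolding eq by simp
qed

text \<open>Differentiate the relation \<open>w \<cdot> z = 1\<close> along a vector of the hyperplane \<open>w \<cdot> v = 0\<close>.\<close>

lemma dual_map_derivative_maps:
  assumes v: "v \<in> complex_tangent_space M z"
  shows "cdot z (frechet_derivative (dual_map M) (at z within M) v) = 0"
proof -
  have vT: "v \<in> tangent_space M z" using v complex_tangent_space_subset by blast
  have "cdot (dual_map M z) v + cdot (frechet_derivative (dual_map M) (at z within M) v) z = 0"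
    by (rule derivative_within_unique[OF M z(1) vT
          bounded_bilinear.FDERIV[OF bounded_bilinear_cdot dual_map_has_derivative has_derivative_ident]
          has_derivative_const W(1) z(2)]) (use dual_map_point(2) in auto)
  moreover have "cdot (dual_map M z) v = 0" using v dual_map_point(3)[OF z] by blast
  ultimately show ?thesis by (simp add: cdot_commute[of z])
qed

end

context
  fixes S :: "'n::finite cp set" and A :: "complex^('n option)^('n option)" and W z
  assumes S: "smooth_cp_hypersurface S" and conv: "strongly_C_convex S" and A: "invertible A"
    and z: "chart A z \<in> S" "z \<in> W" and W: "open W" "tangents_avoid_origin (affine_part A S) W"
begin

abbreviation (input) "MA \<equiv> affine_part A S"
abbreviation (input) "Hz \<equiv> complex_tangent_space (affine_part A S) z"
abbreviation (input) "Dw \<equiv> frechet_derivative (dual_map (affine_part A S)) (at z within affine_part A S)"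

lemma base_in_affine_part: "z \<in> MA" using z by simp

lemmas avoiding_chart = affine_part_hypersurface[OF S A] base_in_affine_part z(2) W
lemmas dual_map_lift = conormal_lift_dual_map[OF avoiding_chart] conormal_lift_dual_map_derivative[OF avoiding_chart]
lemmas dual_map_lift_nondegenerate = strongly_C_convex_conormal_lift[OF S conv A z W(1) dual_map_lift]

lemma linear_dual_map_derivative: "linear Dw"
  using dual_map_has_derivative[OF avoiding_chart] has_derivative_linear by blast

lemma subspace_complex_tangent_space: "subspace Hz"
  unfolding dual_map_point(3)[OF avoiding_chart base_in_affine_part z(2)] by (rule subspace_complex_hyperplane)

lemma complex_tangent_space_cmul: "v \<in> Hz \<Longrightarrow> c *s v \<in> Hz"
  unfolding dual_map_point(3)[OF avoiding_chart base_in_affine_part z(2)] by (simp add: cdot_cmul)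

lemma dual_map_derivative_eq_0: "v \<in> Hz \<Longrightarrow> Dw v = 0 \<Longrightarrow> v = 0"
  using dual_map_lift_nondegenerate(1)[of v 0] by (simp add: homog_eq_0_iff)

lemma dual_map_derivative_inj:
  assumes "v \<in> Hz" "w \<in> Hz" "Dw v = Dw w" shows "v = w"
  using dual_map_derivative_eq_0[OF subspace_diff[OF subspace_complex_tangent_space assms(1,2)]] assms(3) by (simp add: linear_diff[OF linear_dual_map_derivative])

lemma base_nonzero: "z \<noteq> 0"
  using dual_map_point(2)[OF avoiding_chart base_in_affine_part z(2)] by auto

text \<open>The image is a complex subspace by a dimension count. This is what makes multiplication by \<open>\<i>\<close>
  available in the definition of \<open>J*\<close>.\<close>

lemma dual_map_derivative_image: "Dw ` Hz = {\<eta>. cdot z \<eta> = 0}"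
  unfolding dual_map_point(3)[OF avoiding_chart base_in_affine_part z(2)]
  by (rule complex_hyperplane_image_eq[OF dual_map_point(1)[OF avoiding_chart base_in_affine_part z(2)] base_nonzero linear_dual_map_derivative])
    (use dual_map_derivative_eq_0 dual_map_derivative_maps[OF avoiding_chart] in \<open>auto simp: dual_map_point(3)[OF avoiding_chart base_in_affine_part z(2)]\<close>)

lemma affine_dual_J:
  assumes v: "v \<in> Hz"
  shows "affine_dual_J MA z v \<in> Hz" "Dw (affine_dual_J MA z v) = \<i> *s Dw v"
proof -
  have "Dw v \<in> Dw ` Hz" using v by blast
  then have "\<i> *s Dw v \<in> Dw ` Hz" unfolding dual_map_derivative_image by (simp add: cdot_cmul)
  then show "affine_dual_J MA z v \<in> Hz" "Dw (affine_dual_J MA z v) = \<i> *s Dw v"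
    unfolding affine_dual_J_def Let_def by (rule inv_into_into, rule f_inv_into_f)
qed

text \<open>With \<open>D\<close> the derivative of the dual map, \<open>\<i> \<sigma> - J* \<sigma> = v\<close> amounts to \<open>D (\<i> \<sigma>) - \<i> D \<sigma> = D v\<close>. The
  left-hand side is injective in \<open>\<sigma>\<close>, so it attains every value of \<open>D\<close> by counting dimensions.\<close>

lemma affine_dual_J_minus_J_surj:
  assumes v: "v \<in> Hz"
  obtains \<sigma> where "\<sigma> \<in> Hz" "\<i> *s \<sigma> - affine_dual_J MA z \<sigma> = v"
proof -
  define L where "L u = Dw (\<i> *s u) - \<i> *s Dw u" for u
  have lin: "linear L"
    unfolding L_def
    by (intro linear_compose_sub linear_compose[OF linear_cmul linear_dual_map_derivative, unfolded o_def]
        linear_compose[OF linear_dual_map_derivative linear_cmul, unfolded o_def])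
  have inj: "u = 0" if "u \<in> Hz" "L u = 0" for u
  proof (rule dual_map_lift_nondegenerate(2)[OF that(1), of 0])
    have "Dw (\<i> *s u) = \<i> *s Dw u" using that(2) by (simp add: L_def)
    then show "homog 0 (Dw (\<i> *s u)) - \<i> *s homog 0 (Dw u) = 0 *s homog (- 1) (dual_map MA z)"
      by (simp add: homog_0_cmul)
  qed
  have maps: "cdot z (L u) = 0" if "u \<in> Hz" for u
    using dual_map_derivative_maps[OF avoiding_chart] that complex_tangent_space_cmul[OF that]
    by (simp add: L_def diff_conv_add_uminus cdot_add cdot_minus cdot_cmul del: add_uminus_conv_diff)
  have "L ` Hz = {\<eta>. cdot z \<eta> = 0}"
    unfolding dual_map_point(3)[OF avoiding_chart base_in_affine_part z(2)]
    by (rule complex_hyperplane_image_eq[OF dual_map_point(1)[OF avoiding_chart base_in_affine_part z(2)] base_nonzero lin])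
      (use inj maps in \<open>auto simp: dual_map_point(3)[OF avoiding_chart base_in_affine_part z(2)]\<close>)
  moreover have "cdot z (Dw v) = 0" by (rule dual_map_derivative_maps[OF avoiding_chart v])
  ultimately obtain \<sigma> where \<sigma>: "\<sigma> \<in> Hz" "L \<sigma> = Dw v" by (metis (mono_tags, lifting) imageE mem_Collect_eq)
  have "\<i> *s \<sigma> - v = affine_dual_J MA z \<sigma>"
  proof (rule dual_map_derivative_inj)
    show "\<i> *s \<sigma> - v \<in> Hz" by (rule subspace_diff[OF subspace_complex_tangent_space complex_tangent_space_cmul[OF \<sigma>(1)] v])
    show "Dw (\<i> *s \<sigma> - v) = Dw (affine_dual_J MA z \<sigma>)"
      unfolding affine_dual_J(2)[OF \<sigma>(1)] linear_diff[OF linear_dual_map_derivative] \<sigma>(2)[symmetric] L_def by simp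
  qed (rule affine_dual_J(1)[OF \<sigma>(1)])
  then have "\<i> *s \<sigma> - affine_dual_J MA z \<sigma> = v" by (metis diff_diff_eq2 add_diff_cancel_left')
  with \<sigma>(1) show ?thesis by (rule that)
qed

end

text \<open>In terms of lifts, \<open>\<sigma> = J* v\<close> says that the derivative along \<open>\<sigma>\<close> is \<open>\<i>\<close> times that along \<open>v\<close>
  modulo the lift, a condition that does not depend on the chart.\<close>

lemma affine_dual_J_transfer:
  assumes S: "smooth_cp_hypersurface S" "strongly_C_convex S" and A: "invertible A" "invertible A'"
    and z: "chart A z \<in> S" "z \<in> W" "open W" "tangents_avoid_origin (affine_part A S) W"
    and z': "z' \<in> W'" "open W'" "tangents_avoid_origin (affine_part A' S) W'"
    and v: "v \<in> complex_tangent_space (affine_part A S) z" and eq: "dchart A z v = dchart A' z' v'"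
  shows "dchart A z (affine_dual_J (affine_part A S) z v) = dchart A' z' (affine_dual_J (affine_part A' S) z' v')"
proof -
  let ?B = "transition A A'" and ?M = "affine_part A S" and ?M' = "affine_part A' S"
  have e: "chart A' z' = chart A z" "v' = dpmap ?B z v" using dchart_eq_iff[OF A, of z v z' v'] eq by auto
  have N: "pden ?B z \<noteq> 0" "z' = pmap ?B z" using chart_eq_iff[OF A, of z z'] e(1) by auto
  have zS': "chart A' z' \<in> S" using e(1) z by simp
  let ?\<sigma> = "affine_dual_J ?M z v"
  note c = S A(1) z(1,2,3,4) and c' = S A(2) zS' z'(1,2,3)
  note J = affine_dual_J[OF c v]
  have v': "v' \<in> complex_tangent_space ?M' z'"
    unfolding e(2) N(2) by (rule dpmap_complex_tangent[OF S(1) A z(1) N(1) v])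
  have \<sigma>': "dpmap ?B z ?\<sigma> \<in> complex_tangent_space ?M' z'"
    unfolding N(2) by (rule dpmap_complex_tangent[OF S(1) A z(1) N(1) J(1)])
  let ?D = "frechet_derivative (dual_map ?M) (at z within ?M)"
  let ?D' = "frechet_derivative (dual_map ?M') (at z' within ?M')"
  have "1 *s homog 0 (?D ?\<sigma>) + (- \<i>) *s homog 0 (?D v) = 0 *s homog (- 1) (dual_map ?M z)"
    unfolding J(2) by (simp add: vec_eq_iff homog_0_cmul)
  from conormal_lift_transfer[OF S(1) A z(1,2,3) e(1) z'(1,2) dual_map_lift[OF c] dual_map_lift[OF c']
      subsetD[OF complex_tangent_space_subset J(1)] subsetD[OF complex_tangent_space_subset v] this]
  obtain k where k: "1 *s homog 0 (?D' (dpmap ?B z ?\<sigma>)) + (- \<i>) *s homog 0 (?D' (dpmap ?B z v))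
      = k *s homog (- 1) (dual_map ?M' z')" by blast
  \<comment> \<open>The lifts are normalised to have constant coordinate \<open>-1\<close> at \<open>None\<close>, so their derivatives have
    coordinate \<open>0\<close> there, and no multiple of the lift can occur.\<close>
  have "k = 0" using arg_cong[OF k, of "\<lambda>Z. Z $ None"] by simp
  then have "?D' (dpmap ?B z ?\<sigma>) $ j = (\<i> *s ?D' v') $ j" for j
    using arg_cong[OF k, of "\<lambda>Z. Z $ Some j"] by (simp add: e(2))
  then have "?D' (dpmap ?B z ?\<sigma>) = ?D' (affine_dual_J ?M' z' v')"
    unfolding affine_dual_J(2)[OF c' v'] vec_eq_iff by blast
  then have "dpmap ?B z ?\<sigma> = affine_dual_J ?M' z' v'"
    by (rule dual_map_derivative_inj[OF c' \<sigma>' affine_dual_J(1)[OF c' v']])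
  then show ?thesis using dchart_dpmap[OF A N(1), of ?\<sigma>] N(2) by simp
qed

lemma dual_J_dchart:
  assumes S: "smooth_cp_hypersurface S" "strongly_C_convex S" and A: "invertible A"
    and z: "chart A z \<in> S" "z \<in> W" "open W" "tangents_avoid_origin (affine_part A S) W"
    and v: "v \<in> complex_tangent_space (affine_part A S) z"
  shows "dual_J S (dchart A z v) = dchart A z (affine_dual_J (affine_part A S) z v)"
  unfolding dual_J_def
proof (rule the_equality)
  fix \<sigma> assume "\<exists>A' z' v' V'. invertible A' \<and> z' \<in> affine_part A' S \<and> open V' \<and> z' \<in> V' \<and>
      tangents_avoid_origin (affine_part A' S) V' \<and> v' \<in> complex_tangent_space (affine_part A' S) z' \<and>
      dchart A z v = dchart A' z' v' \<and> \<sigma> = dchart A' z' (affine_dual_J (affine_part A' S) z' v')"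
  then obtain A' z' v' V' where *: "invertible A'" "open V'" "z' \<in> V'" "tangents_avoid_origin (affine_part A' S) V'"
      "dchart A z v = dchart A' z' v'" "\<sigma> = dchart A' z' (affine_dual_J (affine_part A' S) z' v')" by blast
  show "\<sigma> = dchart A z (affine_dual_J (affine_part A S) z v)"
    unfolding *(6) by (rule affine_dual_J_transfer[OF S A *(1) z *(3,2,4) v *(5), symmetric])
qed (use assms in auto)

text \<open>The matrix of the translation by \<open>b\<close> of the affine chart.\<close>

definition shift :: "complex^'n::finite \<Rightarrow> complex^('n option)^('n option)" where
  "shift b = (\<chi> i k. (if i = k then 1 else 0) + (case i of None \<Rightarrow> 0 | Some j \<Rightarrow> if k = None then b $ j else 0))"

lemma shift_mult: "shift b *v homog c x = homog c (x + c *s b)"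
proof -
  have "(shift b *v Z) $ i = Z $ i + (case i of None \<Rightarrow> 0 | Some j \<Rightarrow> b $ j * Z $ None)" for Z i
    by (cases i) (simp_all add: shift_def matrix_vector_mult_def distrib_right sum.distrib if_distrib[of "\<lambda>x. x * _"] cong: if_cong)
  then show ?thesis by (simp add: vec_option_eq_iff mult.commute)
qed

lemma invertible_shift: "invertible (shift b)"
proof -
  have "shift b ** shift (- b) = mat 1" for b :: "complex^'a"
  proof (subst matrix_eq, rule allI)
    fix Z :: "complex^('a option)"
    have "Z = homog (Z $ None) (\<chi> j. Z $ Some j)" by (simp add: vec_option_eq_iff)
    then obtain c x where Z: "Z = homog c x" by blast
    show "(shift b ** shift (- b)) *v Z = mat 1 *v Z"
      unfolding Z matrix_vector_mul_assoc[symmetric] shift_mult by (simp add: vec_option_eq_iff)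
  qed
  from this[of b] this[of "- b"] show ?thesis unfolding invertible_def by auto
qed

lemma chart_shift: "chart (A ** shift b) x = chart A (x + b)"
  and dchart_shift: "dchart (A ** shift b) x v = dchart A (x + b) v"
  using shift_mult[of b 1 x] shift_mult[of b 0 v]
  by (simp_all add: chart_def dchart_def matrix_vector_mul_assoc[symmetric])

lemma ex_chart_avoiding_origin:
  assumes S: "smooth_cp_hypersurface S" and A: "invertible A" and z: "chart A z \<in> S"
  obtains A' z' W where "invertible A'" "chart A' z' = chart A z" "z' \<in> W" "open W"
    "tangents_avoid_origin (affine_part A' S) W"
proof -
  have zM: "z \<in> affine_part A S" using z by simp
  obtain V \<rho> where V: "z \<in> V" "defining_function (affine_part A S) V \<rho>"
    using smooth_hypersurfaceE[OF affine_part_hypersurface[OF S A] zM open_UNIV UNIV_I] by metis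
  obtain u where u: "cdot (cgrad \<rho> z) u \<noteq> 0"
    using cgrad_nonzero[OF V(2,1) zM] cdot_eq_0_imp_zero by blast
  \<comment> \<open>The translation moves the origin to a point off the complex tangent hyperplane.\<close>
  define A' where "A' = A ** shift (z + u)"
  have A': "invertible A'" unfolding A'_def by (rule invertible_mult[OF A invertible_shift])
  have e: "chart A' (- u) = chart A z" "dchart A' (- u) v = dchart A z v" for v
    by (simp_all add: A'_def chart_shift dchart_shift)
  have uM: "- u \<in> affine_part A' S" using e z by simp
  have "u \<notin> complex_tangent_space (affine_part A S) z"
    using u complex_tangent_space_cgrad[OF V(2,1) zM] by simp
  then have "dchart A z u \<notin> H S (chart A z)" using dchart_in_H_iff[OF S A z] by simp
  then have uH: "u \<notin> complex_tangent_space (affine_part A' S) (- u)"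
    using dchart_in_H_iff[OF S A', of "- u" u] e z by simp
  obtain V' \<rho>' where V': "- u \<in> V'" "defining_function (affine_part A' S) V' \<rho>'"
    using smooth_hypersurfaceE[OF affine_part_hypersurface[OF S A'] uM open_UNIV UNIV_I] by metis
  note D = defining_functionD[OF V'(2)]
  have s: "smooth_on (\<lambda>x. cdot (cgrad \<rho>' x) x) V'"
    by (intro smooth_on_cdot smooth_on_cgrad smooth_on_id D)
  let ?W = "{x \<in> V'. cdot (cgrad \<rho>' x) x \<noteq> 0}"
  have op: "open ?W"
    using continuous_open_preimage[OF smooth_on_continuous[OF s] D(1), of "- {0}"] by (auto simp: vimage_def Int_def)
  have uW: "- u \<in> ?W"
    using uH V'(1) complex_tangent_space_cgrad[OF V'(2,1) uM] by (simp add: cdot_minus)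
  have av: "tangents_avoid_origin (affine_part A' S) ?W"
    unfolding tangents_avoid_origin_def
  proof
    fix x assume x: "x \<in> ?W \<inter> affine_part A' S"
    then have "- x \<notin> complex_tangent_space (affine_part A' S) x"
      using complex_tangent_space_cgrad[OF V'(2), of x] by (simp add: cdot_minus)
    then show "0 \<notin> (\<lambda>v. x + v) ` complex_tangent_space (affine_part A' S) x"
      by (auto simp: add_eq_0_iff)
  qed
  show ?thesis by (rule that[OF A' e(1) uW op av])
qed

text \<open>All that is used about \<open>J*\<close>: it preserves the complex tangent spaces, and its difference from \<open>J\<close>
  maps onto them.\<close>

lemma ex_chart_dual_J:
  assumes S: "smooth_cp_hypersurface S" "strongly_C_convex S" and p: "p \<in> S"
  obtains A z J' where "invertible A" "chart A z = p"
    "\<And>v. v \<in> complex_tangent_space (affine_part A S) z \<Longrightarrow> J' v \<in> complex_tangent_space (affine_part A S) z"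
    "\<And>v. v \<in> complex_tangent_space (affine_part A S) z \<Longrightarrow> dual_J S (dchart A z v) = dchart A z (J' v)"
    "\<And>v. v \<in> complex_tangent_space (affine_part A S) z \<Longrightarrow>
      \<exists>\<sigma>\<in>complex_tangent_space (affine_part A S) z. \<i> *s \<sigma> - J' \<sigma> = v"
proof -
  obtain A0 z0 where A0: "invertible A0" "chart A0 z0 = p" using S(2) p unfolding strongly_C_convex_def by blast
  have z0: "chart A0 z0 \<in> S" using A0 p by simp
  obtain A z W where A: "invertible A" "chart A z = chart A0 z0" and W: "z \<in> W" "open W"
    "tangents_avoid_origin (affine_part A S) W"
    using ex_chart_avoiding_origin[OF S(1) A0(1) z0] by metis
  have zS: "chart A z \<in> S" using A(2) z0 by simp
  note c = S A(1) zS W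
  show ?thesis
  proof (rule that[OF A(1), of z "affine_dual_J (affine_part A S) z"])
    show "chart A z = p" using A(2) A0(2) by simp
    fix v assume v: "v \<in> complex_tangent_space (affine_part A S) z"
    show "affine_dual_J (affine_part A S) z v \<in> complex_tangent_space (affine_part A S) z"
      by (rule affine_dual_J(1)[OF c v])
    show "dual_J S (dchart A z v) = dchart A z (affine_dual_J (affine_part A S) z v)"
      by (rule dual_J_dchart[OF c v])
    show "\<exists>\<sigma>\<in>complex_tangent_space (affine_part A S) z. \<i> *s \<sigma> - affine_dual_J (affine_part A S) z \<sigma> = v"
      using affine_dual_J_minus_J_surj[OF c v] by metis
  qed
qed


section \<open>Continuation of local solutions on a simply connected set\<close>

text \<open>An abstract problem whose local solutions exist and are unique up to a constant near each point.
  The relation \<open>L p f\<close> is read as: \<open>f\<close> is a solution near \<open>p\<close>.\<close>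

locale local_solutions =
  fixes S :: "'a::topological_space set" and L :: "'a \<Rightarrow> ('a \<Rightarrow> complex) \<Rightarrow> bool"
  assumes ex_local: "p \<in> S \<Longrightarrow> \<exists>f U. open U \<and> p \<in> U \<and> (\<forall>q\<in>U \<inter> S. L q f)"
    and unique_local: "p \<in> S \<Longrightarrow> L p f \<Longrightarrow> L p g \<Longrightarrow>
      \<exists>U c. open U \<and> p \<in> U \<and> (\<forall>q\<in>U \<inter> S. f q = g q + c)"
begin

lemma unique_localE:
  assumes "p \<in> S" "L p f" "L p g"
  obtains U c where "open U" "p \<in> U" "\<And>q. q \<in> U \<inter> S \<Longrightarrow> f q = g q + c"
proof -
  obtain U c where "open U" "p \<in> U" "\<forall>q\<in>U \<inter> S. f q = g q + c"
    using unique_local[OF assms] by blast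
  then show thesis using that[of U c] by simp
qed

lemma ex_localE:
  assumes "p \<in> S"
  obtains U f where "open U" "p \<in> U" "\<And>q. q \<in> U \<inter> S \<Longrightarrow> L q f"
proof -
  obtain U f where "open U" "p \<in> U" "\<forall>q\<in>U \<inter> S. L q f"
    using ex_local[OF assms] by blast
  then show thesis using that[of U f] by simp
qed

text \<open>A continuation of local solutions along a map \<open>k\<close> from a parameter space, which will be an
  interval or a square, into \<open>S\<close>.\<close>

definition continuation :: "('x::topological_space \<Rightarrow> 'a) \<Rightarrow> 'x set \<Rightarrow> ('x \<Rightarrow> complex) \<Rightarrow> bool" where
  "continuation k A h \<longleftrightarrow> (\<forall>x\<in>A. \<exists>N f c. open N \<and> x \<in> N \<and> L (k x) f \<and> (\<forall>y\<in>A \<inter> N. h y = f (k y) + c))"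

lemma continuationI:
  assumes "\<And>x. x \<in> A \<Longrightarrow> \<exists>N f c. open N \<and> x \<in> N \<and> L (k x) f \<and> (\<forall>y\<in>A \<inter> N. h y = f (k y) + c)"
  shows "continuation k A h"
  using assms unfolding continuation_def by blast

lemma continuationE:
  assumes "continuation k A h" "x \<in> A"
  obtains N f c where "open N" "x \<in> N" "L (k x) f" "\<And>y. y \<in> A \<Longrightarrow> y \<in> N \<Longrightarrow> h y = f (k y) + c"
proof -
  obtain N f c where "open N" "x \<in> N" "L (k x) f" "\<forall>y\<in>A \<inter> N. h y = f (k y) + c"
    using assms unfolding continuation_def by blast
  then show thesis using that[of N f c] by simp
qed

lemma continuation_add:
  assumes "continuation k A h"
  shows "continuation k A (\<lambda>y. h y + c)"
proof (rule continuationI)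
  fix x assume "x \<in> A"
  then obtain N f d where "open N" "x \<in> N" "L (k x) f" "\<And>y. y \<in> A \<Longrightarrow> y \<in> N \<Longrightarrow> h y = f (k y) + d"
    using continuationE[OF assms] by metis
  then show "\<exists>N f d. open N \<and> x \<in> N \<and> L (k x) f \<and> (\<forall>y\<in>A \<inter> N. h y + c = f (k y) + d)"
    by (intro exI[of _ N] exI[of _ f] exI[of _ "d + c"]) auto
qed

lemma continuation_cong:
  assumes "\<And>x. x \<in> A \<Longrightarrow> k x = k' x" "\<And>x. x \<in> A \<Longrightarrow> h x = h' x"
  shows "continuation k A h \<longleftrightarrow> continuation k' A h'"
  unfolding continuation_def using assms by auto

lemma continuation_compose:
  assumes h: "continuation k A h" and m: "continuous_on B m" "m ` B \<subseteq> A"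
  shows "continuation (\<lambda>x. k (m x)) B (\<lambda>x. h (m x))"
proof (rule continuationI)
  fix x assume x: "x \<in> B"
  then obtain N f c where N: "open N" "m x \<in> N" "L (k (m x)) f"
    "\<And>y. y \<in> A \<Longrightarrow> y \<in> N \<Longrightarrow> h y = f (k y) + c"
    using continuationE[OF h, of "m x"] m by (metis image_subset_iff)
  obtain W where W: "open W" "W \<inter> B = m -` N \<inter> B"
    using m(1) N(1) unfolding continuous_on_open_invariant by blast
  then show "\<exists>N f c. open N \<and> x \<in> N \<and> L (k (m x)) f \<and> (\<forall>y\<in>B \<inter> N. h (m y) = f (k (m y)) + c)"
    using N x m(2) by (intro exI[of _ W] exI[of _ f] exI[of _ c]) (auto intro!: N(4))
qed

lemma continuation_subset:
  "continuation k A h \<Longrightarrow> B \<subseteq> A \<Longrightarrow> continuation k B h"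
  using continuation_compose[of k A h B "\<lambda>x. x"] by auto

lemma continuation_unique:
  assumes k: "continuous_on A k" "k ` A \<subseteq> S" and "connected A"
    and h: "continuation k A h" "continuation k A h'"
  obtains c where "\<And>x. x \<in> A \<Longrightarrow> h x = h' x + c"
proof -
  have "\<forall>x\<in>A. eventually (\<lambda>y. h x - h' x = h y - h' y) (at x within A)"
  proof
    fix x assume x: "x \<in> A"
    obtain N f c where N: "open N" "x \<in> N" "L (k x) f" "\<And>y. y \<in> A \<Longrightarrow> y \<in> N \<Longrightarrow> h y = f (k y) + c"
      by (rule continuationE[OF h(1) x]) (rule that)
    obtain N' f' c' where N': "open N'" "x \<in> N'" "L (k x) f'"
      "\<And>y. y \<in> A \<Longrightarrow> y \<in> N' \<Longrightarrow> h' y = f' (k y) + c'"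
      by (rule continuationE[OF h(2) x]) (rule that)
    obtain U d where U: "open U" "k x \<in> U" "\<And>q. q \<in> U \<inter> S \<Longrightarrow> f q = f' q + d"
      by (rule unique_localE[OF _ N(3) N'(3)]) (use k x in auto)
    obtain W where W: "open W" "W \<inter> A = k -` U \<inter> A"
      using k(1) U(1) unfolding continuous_on_open_invariant by blast
    have xW: "x \<in> W" using W U x by auto
    have "h y - h' y = d + c - c'" if "y \<in> A" "y \<in> N \<inter> N' \<inter> W" for y
    proof -
      have "k y \<in> U \<inter> S" using W that k by auto
      then show ?thesis using N(4)[of y] N'(4)[of y] U(3)[of "k y"] that by simp
    qed
    moreover have "eventually (\<lambda>y. y \<in> N \<inter> N' \<inter> W \<and> y \<in> A) (at x within A)"
      unfolding eventually_at_topological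
      using N N' W xW by (intro exI[of _ "N \<inter> N' \<inter> W"]) auto
    ultimately show "eventually (\<lambda>y. h x - h' x = h y - h' y) (at x within A)"
      using N(2) N'(2) xW x by (elim eventually_mono) auto
  qed
  then have "h x - h' x = h y - h' y" if "x \<in> A" "y \<in> A" for x y
    using connected_local_const[OF \<open>connected A\<close> that, of "\<lambda>x. h x - h' x"] by blast
  then show ?thesis
    using that by (metis add.commute diff_add_cancel)
qed

text \<open>Two continuations that agree on the overlap of two closed sets combine: at a point of the
  overlap their local solutions differ by a constant, which the common value there forces to fit.\<close>

lemma continuation_glue:
  assumes k: "continuous_on (A \<union> B) k" "k ` (A \<union> B) \<subseteq> S" and "closed A" "closed B"
    and h: "continuation k A h" "continuation k B h'"
    and eq: "\<And>x. x \<in> A \<Longrightarrow> x \<in> B \<Longrightarrow> h x = h' x"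
  shows "continuation k (A \<union> B) (\<lambda>x. if x \<in> A then h x else h' x)"
proof (rule continuationI)
  fix x assume x: "x \<in> A \<union> B"
  let ?h = "\<lambda>x. if x \<in> A then h x else h' x"
  consider "x \<in> A" "x \<notin> B" | "x \<in> B" "x \<notin> A" | "x \<in> A" "x \<in> B" using x by blast
  then show "\<exists>N f c. open N \<and> x \<in> N \<and> L (k x) f \<and> (\<forall>y\<in>(A \<union> B) \<inter> N. ?h y = f (k y) + c)"
  proof cases
    case 1
    obtain N f c where "open N" "x \<in> N" "L (k x) f" "\<And>y. y \<in> A \<Longrightarrow> y \<in> N \<Longrightarrow> h y = f (k y) + c"
      by (rule continuationE[OF h(1) 1(1)]) (rule that)
    then show ?thesis using 1 \<open>closed B\<close>
      by (intro exI[of _ "N - B"] exI[of _ f] exI[of _ c]) auto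
  next
    case 2
    obtain N f c where "open N" "x \<in> N" "L (k x) f" "\<And>y. y \<in> B \<Longrightarrow> y \<in> N \<Longrightarrow> h' y = f (k y) + c"
      by (rule continuationE[OF h(2) 2(1)]) (rule that)
    then show ?thesis using 2 \<open>closed A\<close>
      by (intro exI[of _ "N - A"] exI[of _ f] exI[of _ c]) auto
  next
    case 3
    obtain N f c where N: "open N" "x \<in> N" "L (k x) f" "\<And>y. y \<in> A \<Longrightarrow> y \<in> N \<Longrightarrow> h y = f (k y) + c"
      by (rule continuationE[OF h(1) 3(1)]) (rule that)
    obtain N' f' c' where N': "open N'" "x \<in> N'" "L (k x) f'"
      "\<And>y. y \<in> B \<Longrightarrow> y \<in> N' \<Longrightarrow> h' y = f' (k y) + c'"
      by (rule continuationE[OF h(2) 3(2)]) (rule that)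
    obtain U d where U: "open U" "k x \<in> U" "\<And>q. q \<in> U \<inter> S \<Longrightarrow> f q = f' q + d"
      by (rule unique_localE[OF _ N(3) N'(3)]) (use k x in auto)
    obtain W where W: "open W" "W \<inter> (A \<union> B) = k -` U \<inter> (A \<union> B)"
      using k(1) U(1) unfolding continuous_on_open_invariant by blast
    have xW: "x \<in> W" using W U x by auto
    have c: "d + c = c'"
      using N(4)[OF 3(1) N(2)] N'(4)[OF 3(2) N'(2)] eq[OF 3] U(3)[of "k x"] k x U(2) by auto
    have "?h y = f (k y) + c" if "y \<in> (A \<union> B) \<inter> (N \<inter> N' \<inter> W)" for y
    proof -
      have "k y \<in> U \<inter> S" using W that k by auto
      then show ?thesis using N(4)[of y] N'(4)[of y] U(3)[of "k y"] that c by auto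
    qed
    then show ?thesis using N N' W xW
      by (intro exI[of _ "N \<inter> N' \<inter> W"] exI[of _ f] exI[of _ c]) auto
  qed
qed

lemma continuation_join:
  assumes k: "continuous_on (A \<union> B) k" "k ` (A \<union> B) \<subseteq> S" and "closed A" "closed B"
    and "connected (A \<inter> B)"
    and h: "continuation k A h" "continuation k B h'"
  obtains h'' where "continuation k (A \<union> B) h''"
proof -
  obtain c where c: "\<And>x. x \<in> A \<inter> B \<Longrightarrow> h x = h' x + c"
  proof (rule continuation_unique[of "A \<inter> B" k h h'])
    show "continuous_on (A \<inter> B) k" "k ` (A \<inter> B) \<subseteq> S"
      using k by (auto intro: continuous_on_subset)
  qed (use assms in \<open>auto intro: continuation_subset\<close>)
  show thesis
    by (rule that, rule continuation_glue[OF k \<open>closed A\<close> \<open>closed B\<close> h(1) continuation_add[OF h(2), of c]])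
      (use c in auto)
qed

lemma continuation_local:
  assumes k: "continuous_on A k" "k ` A \<subseteq> S" and x: "x \<in> A"
  obtains N h where "open N" "x \<in> N" "continuation k (A \<inter> N) h"
proof -
  obtain U f where U: "open U" "k x \<in> U" "\<And>q. q \<in> U \<inter> S \<Longrightarrow> L q f"
    by (rule ex_localE[of "k x"]) (use k x in auto)
  obtain W where W: "open W" "W \<inter> A = k -` U \<inter> A"
    using k(1) U(1) unfolding continuous_on_open_invariant by blast
  have "continuation k (A \<inter> W) (\<lambda>x. f (k x))"
  proof (rule continuationI)
    fix y assume "y \<in> A \<inter> W"
    then have "L (k y) f" using W U k by auto
    then show "\<exists>N g c. open N \<and> y \<in> N \<and> L (k y) g \<and> (\<forall>z\<in>A \<inter> W \<inter> N. f (k z) = g (k z) + c)"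
      by (intro exI[of _ UNIV] exI[of _ f] exI[of _ 0]) auto
  qed
  with W U x show ?thesis using that by blast
qed

text \<open>Here \<open>R a b\<close> is a family of sets that behaves like the intervals \<open>{a..b}\<close> under joining, for
  instance rectangles over them.\<close>

lemma continuation_join_intervals:
  fixes R :: "real \<Rightarrow> real \<Rightarrow> 'x::topological_space set"
  assumes k: "continuous_on (R 0 1) k" "k ` R 0 1 \<subseteq> S"
    and R: "\<And>a b. closed (R a b)" "\<And>a b. 0 \<le> a \<Longrightarrow> b \<le> 1 \<Longrightarrow> R a b \<subseteq> R 0 1"
      "\<And>a b c. a \<le> b \<Longrightarrow> b \<le> c \<Longrightarrow> R a b \<union> R b c = R a c \<and> connected (R a b \<inter> R b c)"
    and short: "d > 0" "\<And>a b. 0 \<le> a \<Longrightarrow> b \<le> 1 \<Longrightarrow> b - a < d \<Longrightarrow> \<exists>h. continuation k (R a b) h"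
  shows "\<exists>h. continuation k (R 0 1) h"
proof -
  define P where "P a b \<longleftrightarrow> (0 \<le> a \<longrightarrow> b \<le> 1 \<longrightarrow> (\<exists>h. continuation k (R a b) h))" for a b
  have "P 0 1"
  proof (rule Bolzano)
    fix a b c assume P: "P a b" "P b c" and ab: "a \<le> b" "b \<le> c"
    show "P a c" unfolding P_def
    proof (intro impI)
      assume ac: "0 \<le> a" "c \<le> 1"
      have b: "0 \<le> b" "b \<le> 1" using ab ac by linarith+
      obtain h1 h2 where h: "continuation k (R a b) h1" "continuation k (R b c) h2"
        using P[unfolded P_def] b ac by metis
      note un = R(3)[OF ab, THEN conjunct1]
      obtain h where "continuation k (R a b \<union> R b c) h"
      proof (rule continuation_join[OF _ _ R(1) R(1) R(3)[OF ab, THEN conjunct2] h])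
        show "continuous_on (R a b \<union> R b c) k" "k ` (R a b \<union> R b c) \<subseteq> S"
          unfolding un using continuous_on_subset[OF k(1) R(2)[OF ac]] k(2) R(2)[OF ac] by auto
      qed (rule that)
      then show "\<exists>h. continuation k (R a c) h" unfolding un by blast
    qed
  next
    fix x :: real
    show "\<exists>d>0. \<forall>a b. a \<le> x \<and> x \<le> b \<and> b - a < d \<longrightarrow> P a b"
      using short unfolding P_def by (intro exI[of _ d]) simp
  qed simp
  then show ?thesis by (simp add: P_def)
qed

text \<open>Sufficiently small rectangles carry a continuation by compactness. They are joined to strips of
  full width, and the strips to the square.\<close>

lemma continuation_on_square:
  fixes k :: "real \<times> real \<Rightarrow> 'a"
  assumes k: "continuous_on ({0..1} \<times> {0..1}) k" "k ` ({0..1} \<times> {0..1}) \<subseteq> S"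
  obtains h where "continuation k ({0..1} \<times> {0..1}) h"
proof -
  let ?Q = "{0..1} \<times> {0..1} :: (real \<times> real) set"
  let ?\<N> = "{N. open N \<and> (\<exists>h. continuation k (?Q \<inter> N) h)}"
  have "\<exists>N\<in>?\<N>. z \<in> N" if z: "z \<in> ?Q" for z
    by (rule continuation_local[OF k z]) blast
  then have cover: "?Q \<subseteq> \<Union>?\<N>" by blast
  have "compact ?Q" by (intro compact_Times) auto
  from Heine_Borel_lemma[OF this cover] obtain d where d: "d > 0" "\<And>z. z \<in> ?Q \<Longrightarrow> \<exists>N\<in>?\<N>. ball z d \<subseteq> N"
    by blast
  have small: "\<exists>h. continuation k ({a..b} \<times> {c..e}) h"
    if "0 \<le> a" "b \<le> 1" "b - a < d / 2" "0 \<le> c" "e \<le> 1" "e - c < d / 2" for a b c e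
  proof (cases "a \<le> b \<and> c \<le> e")
    case True
    then obtain N h where N: "ball (a, c) d \<subseteq> N" "continuation k (?Q \<inter> N) h"
      using d(2)[of "(a, c)"] \<open>0 \<le> a\<close> \<open>b \<le> 1\<close> \<open>0 \<le> c\<close> \<open>e \<le> 1\<close> by auto
    have "(x, y) \<in> ball (a, c) d" if "x \<in> {a..b}" "y \<in> {c..e}" for x y
    proof -
      have "dist (a, c) (x, y) \<le> \<bar>a - x\<bar> + \<bar>c - y\<bar>"
        unfolding dist_Pair_Pair dist_real_def by (rule sqrt_sum_squares_le_sum_abs[THEN order_trans]) simp
      also have "\<dots> < d" using that \<open>b - a < d / 2\<close> \<open>e - c < d / 2\<close> by auto
      finally show ?thesis by simp
    qed
    then have "{a..b} \<times> {c..e} \<subseteq> ?Q \<inter> N"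
      using N(1) \<open>0 \<le> a\<close> \<open>b \<le> 1\<close> \<open>0 \<le> c\<close> \<open>e \<le> 1\<close> by fastforce
    then show ?thesis using continuation_subset[OF N(2)] by blast
  qed (auto simp: continuation_def)
  have strip: "\<exists>h. continuation k ({0..1} \<times> {c..e}) h" if "0 \<le> c" "e \<le> 1" "e - c < d / 2" for c e
  proof (rule continuation_join_intervals[of "\<lambda>a b. {a..b} \<times> {c..e}"])
    have sub: "{0..1} \<times> {c..e} \<subseteq> ?Q" using that by auto
    show "continuous_on ({0..1} \<times> {c..e}) k" "k ` ({0..1} \<times> {c..e}) \<subseteq> S"
      using continuous_on_subset[OF k(1) sub] k(2) sub by auto
    show "{a..b} \<times> {c..e} \<union> {b..b'} \<times> {c..e} = {a..b'} \<times> {c..e} \<and> connected ({a..b} \<times> {c..e} \<inter> {b..b'} \<times> {c..e})"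
      if "a \<le> b" "b \<le> b'" for a b b' :: real
    proof -
      have eq: "{a..b} \<times> {c..e} \<inter> {b..b'} \<times> {c..e} = {b} \<times> {c..e}" using that by auto
      show ?thesis unfolding eq using that by (auto intro!: connected_Times)
    qed
    show "\<exists>h. continuation k ({a..b} \<times> {c..e}) h" if "0 \<le> a" "b \<le> 1" "b - a < d / 2" for a b
      by (rule small[OF that \<open>0 \<le> c\<close> \<open>e \<le> 1\<close> \<open>e - c < d / 2\<close>])
  qed (use d(1) in \<open>auto intro: closed_Times\<close>)
  have "\<exists>h. continuation k ({0..1} \<times> {0..1}) h"
  proof (rule continuation_join_intervals[of "\<lambda>c e. {0..1} \<times> {c..e}" _ "d / 2", OF k _ _ _ _ strip])
    show "{0..1::real} \<times> {c..e} \<union> {0..1} \<times> {e..e'} = {0..1} \<times> {c..e'} \<and> connected ({0..1::real} \<times> {c..e} \<inter> {0..1} \<times> {e..e'})"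
      if "c \<le> e" "e \<le> e'" for c e e' :: real
    proof -
      have eq: "{0..1::real} \<times> {c..e} \<inter> {0..1} \<times> {e..e'} = {0..1} \<times> {e}" using that by auto
      show ?thesis unfolding eq using that by (auto intro!: connected_Times)
    qed
  qed (use d(1) in \<open>auto intro: closed_Times\<close>)
  then show thesis using that by blast
qed

text \<open>The change of a local solution when it is continued along a path.\<close>

definition transport :: "'a \<Rightarrow> complex \<Rightarrow> 'a \<Rightarrow> bool" where
  "transport p c q \<longleftrightarrow> (\<exists>\<gamma> h. path \<gamma> \<and> path_image \<gamma> \<subseteq> S \<and> pathstart \<gamma> = p \<and> pathfinish \<gamma> = q \<and>
     continuation \<gamma> {0..1} h \<and> h 1 - h 0 = c)"

lemma transport_ex:
  assumes \<gamma>: "path \<gamma>" "path_image \<gamma> \<subseteq> S"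
  obtains c where "transport (pathstart \<gamma>) c (pathfinish \<gamma>)"
proof -
  have k: "continuous_on ({0..1} \<times> {0..1::real}) (\<lambda>z. \<gamma> (fst z))" "(\<lambda>z. \<gamma> (fst z)) ` ({0..1} \<times> {0..1::real}) \<subseteq> S"
    using \<gamma> unfolding path_def path_image_def
    by (auto intro!: continuous_on_compose2[of "{0..1}" \<gamma>] continuous_intros)
  obtain h where h: "continuation (\<lambda>z. \<gamma> (fst z)) ({0..1} \<times> {0..1::real}) h"
    using continuation_on_square[OF k] by blast
  have "continuation (\<lambda>s. \<gamma> (fst (s, 0::real))) {0..1} (\<lambda>s. h (s, 0))"
    by (rule continuation_compose[OF h]) (auto intro!: continuous_intros)
  then show ?thesis using that \<gamma> unfolding transport_def by auto
qed

lemma transport_sym: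
  assumes "transport p c q"
  shows "transport q (- c) p"
proof -
  obtain \<gamma> h where g: "path \<gamma>" "path_image \<gamma> \<subseteq> S" "pathstart \<gamma> = p" "pathfinish \<gamma> = q"
     "continuation \<gamma> {0..1} h" "h 1 - h 0 = c"
    using assms unfolding transport_def by blast
  have "continuation (\<lambda>s. \<gamma> (1 - s)) {0..1} (\<lambda>s. h (1 - s))"
    by (rule continuation_compose[OF g(5)]) (auto intro!: continuous_intros)
  then have "continuation (reversepath \<gamma>) {0..1} (\<lambda>s. h (1 - s))"
    unfolding reversepath_def .
  moreover have "path (reversepath \<gamma>)" "path_image (reversepath \<gamma>) \<subseteq> S"
    "pathstart (reversepath \<gamma>) = q" "pathfinish (reversepath \<gamma>) = p"
    using g by simp_all
  moreover have "h (1 - 1) - h (1 - 0) = - c" using g(6) by (simp add: algebra_simps)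
  ultimately show ?thesis unfolding transport_def by blast
qed

lemma transport_trans:
  assumes "transport p c q" "transport q d r"
  shows "transport p (c + d) r"
proof -
  obtain \<gamma> h where g: "path \<gamma>" "path_image \<gamma> \<subseteq> S" "pathstart \<gamma> = p" "pathfinish \<gamma> = q"
     "continuation \<gamma> {0..1} h" "h 1 - h 0 = c"
    using assms(1) unfolding transport_def by blast
  obtain \<gamma>' h' where g': "path \<gamma>'" "path_image \<gamma>' \<subseteq> S" "pathstart \<gamma>' = q" "pathfinish \<gamma>' = r"
     "continuation \<gamma>' {0..1} h'" "h' 1 - h' 0 = d"
    using assms(2) unfolding transport_def by blast
  let ?k = "\<gamma> +++ \<gamma>'"
  have pk: "path ?k" "path_image ?k \<subseteq> S" using g g' by (simp_all add: path_image_join)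
  define h1 where "h1 = (\<lambda>s::real. h (2 * s))"
  define h2 where "h2 = (\<lambda>s::real. h' (2 * s - 1) + (h 1 - h' 0))"
  have un: "{0..1/2} \<union> {1/2..1} = {0..1::real}" by auto
  have "continuation (\<lambda>s. \<gamma> (2 * s)) {0..1/2} h1" unfolding h1_def
    by (rule continuation_compose[OF g(5)]) (auto intro!: continuous_intros)
  then have 1: "continuation ?k {0..1/2} h1"
    by (subst continuation_cong[where k' = "\<lambda>s. \<gamma> (2 * s)" and h' = h1]) (auto simp: joinpaths_def)
  have "continuation (\<lambda>s. \<gamma>' (2 * s - 1)) {1/2..1} h2" unfolding h2_def
    by (rule continuation_add, rule continuation_compose[OF g'(5)]) (auto intro!: continuous_intros)
  then have 2: "continuation ?k {1/2..1} h2"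
  proof (subst continuation_cong[where k' = "\<lambda>s. \<gamma>' (2 * s - 1)" and h' = h2])
    fix s :: real assume s: "s \<in> {1/2..1}"
    show "?k s = \<gamma>' (2 * s - 1)"
    proof (cases "s = 1/2")
      case True
      show ?thesis unfolding True using g(4) g'(3) by (simp add: joinpaths_def pathstart_def pathfinish_def)
    qed (use s in \<open>auto simp: joinpaths_def\<close>)
  qed auto
  have "continuation ?k ({0..1/2} \<union> {1/2..1}) (\<lambda>x. if x \<in> {0..1/2} then h1 x else h2 x)"
  proof (rule continuation_glue[OF _ _ _ _ 1 2])
    show "continuous_on ({0..1/2} \<union> {1/2..1}) ?k" "?k ` ({0..1/2} \<union> {1/2..1}) \<subseteq> S"
      unfolding un using pk by (auto simp: path_def path_image_def)
    fix x :: real assume "x \<in> {0..1/2}" "x \<in> {1/2..1}"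
    then have x: "x = 1/2" by auto
    show "h1 x = h2 x" unfolding x by (simp add: h1_def h2_def)
  qed auto
  then show ?thesis unfolding transport_def un using pk g g'
    by (intro exI[of _ ?k] exI[of _ "\<lambda>x. if x \<in> {0..1/2} then h1 x else h2 x"])
      (auto simp: h1_def h2_def)
qed

text \<open>Along a contraction of a loop, the change of a continuation around the loop is locally
  constant in the contraction parameter, and it vanishes for the constant loop.\<close>

lemma transport_loop_eq_0:
  assumes sc: "simply_connected S" and "transport p c p"
  shows "c = 0"
proof -
  obtain \<gamma> h where g: "path \<gamma>" "path_image \<gamma> \<subseteq> S" "pathstart \<gamma> = p" "pathfinish \<gamma> = p"
     "continuation \<gamma> {0..1} h" "h 1 - h 0 = c"
    using assms(2) unfolding transport_def by blast
  have pS: "p \<in> S" using g by (metis pathstart_in_path_image subsetD)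
  have "homotopic_loops S \<gamma> (\<lambda>_. p)"
    using sc[unfolded simply_connected_def, rule_format, of \<gamma> "\<lambda>_. p"] g pS
    by (simp add: path_def path_image_def pathstart_def pathfinish_def)
  then obtain k where k: "continuous_on ({0..1::real} \<times> {0..1}) k" "k \<in> ({0..1} \<times> {0..1}) \<rightarrow> S"
    "\<And>t. t \<in> {0..1} \<Longrightarrow> k (0, t) = \<gamma> t" "\<And>t. t \<in> {0..1} \<Longrightarrow> k (1, t) = p"
    "\<And>s. s \<in> {0..1} \<Longrightarrow> pathfinish (k \<circ> Pair s) = pathstart (k \<circ> Pair s)"
    unfolding homotopic_loops by auto
  have kS: "k ` ({0..1} \<times> {0..1}) \<subseteq> S" using k(2) by auto
  obtain H where H: "continuation k ({0..1} \<times> {0..1}) H"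
    using continuation_on_square[OF k(1) kS] by blast
  have bottom: "continuation (\<lambda>s. k (s, 0)) {0..1} (\<lambda>s. H (s, 0))"
    by (rule continuation_compose[OF H]) (auto intro!: continuous_intros)
  have "continuation (\<lambda>s. k (s, 1)) {0..1} (\<lambda>s. H (s, 1))"
    by (rule continuation_compose[OF H]) (auto intro!: continuous_intros)
  then have top: "continuation (\<lambda>s. k (s, 0)) {0..1} (\<lambda>s. H (s, 1))"
    by (subst (asm) continuation_cong[where k' = "\<lambda>s. k (s, 0)" and h' = "\<lambda>s. H (s, 1)"])
      (use k(5) in \<open>auto simp: pathstart_def pathfinish_def\<close>)
  have cont: "continuous_on {0..1} (\<lambda>s. k (s, 0))"
    by (rule continuous_on_compose2[OF k(1)]) (auto intro!: continuous_intros)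
  obtain d where d: "\<And>s. s \<in> {0..1} \<Longrightarrow> H (s, 1) = H (s, 0) + d"
    by (rule continuation_unique[OF cont _ _ top bottom]) (use k(2) in auto)
  have right: "continuation (\<lambda>t. k (1, t)) {0..1} (\<lambda>t. H (1, t))"
    by (rule continuation_compose[OF H]) (auto intro!: continuous_intros)
  then have right: "continuation (\<lambda>t::real. p) {0..1} (\<lambda>t. H (1, t))"
    by (subst (asm) continuation_cong[where k' = "\<lambda>_. p" and h' = "\<lambda>t. H (1, t)"]) (use k(4) in auto)
  obtain U f where U: "open U" "p \<in> U" "\<And>q. q \<in> U \<inter> S \<Longrightarrow> L q f"
    by (rule ex_localE[OF pS]) (rule that)
  have "continuation (\<lambda>t::real. p) {0..1} (\<lambda>t. 0)"
    by (rule continuationI, intro exI[of _ UNIV] exI[of _ f] exI[of _ "- f p"]) (use U pS in auto)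
  from continuation_unique[OF _ _ _ right this] obtain e where e: "\<And>t. t \<in> {0..1} \<Longrightarrow> H (1, t) = 0 + e"
    using pS by (metis connected_Icc continuous_on_const image_subsetI)
  have left: "continuation (\<lambda>t. k (0, t)) {0..1} (\<lambda>t. H (0, t))"
    by (rule continuation_compose[OF H]) (auto intro!: continuous_intros)
  then have left: "continuation \<gamma> {0..1} (\<lambda>t. H (0, t))"
    by (subst (asm) continuation_cong[where k' = \<gamma> and h' = "\<lambda>t. H (0, t)"]) (use k(3) in auto)
  obtain a where a: "\<And>t. t \<in> {0..1} \<Longrightarrow> H (0, t) = h t + a"
    by (rule continuation_unique[OF _ _ _ left g(5)]) (use g in \<open>auto simp: path_def path_image_def\<close>)
  show ?thesis using a[of 0] a[of 1] d[of 0] d[of 1] e[of 0] e[of 1] g(6) by simp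
qed

text \<open>The solution at a point is the change by transport from a base point; the choice of the path is
  immaterial because transport around loops is trivial.\<close>

theorem global_solution:
  assumes sc: "simply_connected S"
    and lpc: "\<And>p U. p \<in> S \<Longrightarrow> open U \<Longrightarrow> p \<in> U \<Longrightarrow>
      \<exists>V. open V \<and> p \<in> V \<and> V \<subseteq> U \<and> path_connected (V \<inter> S)"
  obtains F where "\<And>p f. p \<in> S \<Longrightarrow> L p f \<Longrightarrow> \<exists>U c. open U \<and> p \<in> U \<and> (\<forall>q\<in>U \<inter> S. F q = f q + c)"
proof (cases "S = {}")
  case False
  then obtain a where a: "a \<in> S" by blast
  have pc: "path_connected S"
    unfolding path_connected_def
  proof (intro ballI)
    fix x y assume xy: "x \<in> S" "y \<in> S"
    have "homotopic_loops S (\<lambda>_. x) (\<lambda>_. y)"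
      using sc[unfolded simply_connected_def, rule_format, of "\<lambda>_. x" "\<lambda>_. y"] xy
      by (simp add: path_def path_image_def pathstart_def pathfinish_def)
    then obtain k where k: "continuous_on ({0..1::real} \<times> {0..1::real}) k" "k \<in> ({0..1} \<times> {0..1}) \<rightarrow> S"
      "\<And>t. t \<in> {0..1} \<Longrightarrow> k (0, t) = x" "\<And>t. t \<in> {0..1} \<Longrightarrow> k (1, t) = y"
      unfolding homotopic_loops by auto
    have "continuous_on {0..1} (\<lambda>s. k (s, 0))"
      by (rule continuous_on_compose2[OF k(1)]) (auto intro!: continuous_intros)
    then show "\<exists>g. path g \<and> path_image g \<subseteq> S \<and> pathstart g = x \<and> pathfinish g = y"
      using k by (intro exI[of _ "\<lambda>s. k (s, 0)"]) (auto simp: path_def path_image_def pathstart_def pathfinish_def)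
  qed
  have ex: "\<exists>c. transport a c q" if q: "q \<in> S" for q
    using pc a q transport_ex unfolding path_connected_def by metis
  define F where "F q = (SOME c. transport a c q)" for q
  have F: "transport a (F q) q" if "q \<in> S" for q
    unfolding F_def using ex[OF that] by (rule someI_ex)
  have Funique: "c = F q" if "transport a c q" "q \<in> S" for c q
    using transport_loop_eq_0[OF sc transport_trans[OF that(1) transport_sym[OF F[OF that(2)]]]] by simp
  show ?thesis
  proof (rule that)
    fix p f assume p: "p \<in> S" and Lf: "L p f"
    obtain U g where U: "open U" "p \<in> U" "\<And>q. q \<in> U \<inter> S \<Longrightarrow> L q g"
      by (rule ex_localE[OF p]) (rule that)
    have Lg: "L p g" using U p by blast
    obtain U' d where U': "open U'" "p \<in> U'" "\<And>q. q \<in> U' \<inter> S \<Longrightarrow> g q = f q + d"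
      by (rule unique_localE[OF p Lg Lf]) (rule that)
    obtain V where V: "open V" "p \<in> V" "V \<subseteq> U \<inter> U'" "path_connected (V \<inter> S)"
      using lpc[OF p, of "U \<inter> U'"] U U' by auto
    have "F q = g q + (F p - g p)" if q: "q \<in> V \<inter> S" for q
    proof -
      obtain \<gamma> where g: "path \<gamma>" "path_image \<gamma> \<subseteq> V \<inter> S" "pathstart \<gamma> = p" "pathfinish \<gamma> = q"
        using V q p unfolding path_connected_def by blast
      have "continuation \<gamma> {0..1} (\<lambda>t. g (\<gamma> t))"
      proof (rule continuationI, intro exI[of _ UNIV] exI[of _ g] exI[of _ 0] conjI)
        fix x :: real assume "x \<in> {0..1}"
        then have "\<gamma> x \<in> V \<inter> S" using g by (auto simp: path_image_def)
        then show "L (\<gamma> x) g" using U V by auto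
      qed auto
      then have "transport p (g q - g p) q"
        unfolding transport_def using g
        by (intro exI[of _ \<gamma>] exI[of _ "\<lambda>t. g (\<gamma> t)"]) (auto simp: pathstart_def pathfinish_def)
      then have "F p + (g q - g p) = F q"
        using Funique transport_trans[OF F[OF p]] q by blast
      then show ?thesis by (simp add: algebra_simps)
    qed
    then have "\<forall>q\<in>V \<inter> S. F q = f q + (d + F p - g p)"
      using U' V by force
    then show "\<exists>U c. open U \<and> p \<in> U \<and> (\<forall>q\<in>U \<inter> S. F q = f q + c)"
      using V by blast
  qed
qed (use that in auto)

end


section \<open>Potentials of closed 1-forms\<close>

lemma ex_chart:
  assumes "strongly_C_convex S" "p \<in> S"
  obtains A z where "invertible A" "chart A z = p"
  using assms unfolding strongly_C_convex_def by blast

text \<open>A local primitive of \<open>\<eta>\<close> near \<open>p\<close>. Transition maps make a single chart sufficient.\<close>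

definition potential :: "('n::finite) cp set \<Rightarrow> ('n cp_tangent \<Rightarrow> complex) \<Rightarrow> 'n cp \<Rightarrow> ('n cp \<Rightarrow> complex) \<Rightarrow> bool" where
  "potential S \<eta> p f \<longleftrightarrow> (\<exists>A z W F. invertible A \<and> chart A z = p \<and> open W \<and> z \<in> W \<and> smooth_on F W \<and>
     (\<forall>x\<in>W \<inter> affine_part A S. F x = f (chart A x) \<and>
        (\<forall>v\<in>tangent_space (affine_part A S) x. FD F x v = \<eta> (dchart A x v))))"

lemma potentialI:
  assumes "invertible A" "chart A z = p" "open W" "z \<in> W" "smooth_on F W"
    "\<And>x. x \<in> W \<inter> affine_part A S \<Longrightarrow> F x = f (chart A x)"
    "\<And>x v. x \<in> W \<inter> affine_part A S \<Longrightarrow> v \<in> tangent_space (affine_part A S) x \<Longrightarrow> FD F x v = \<eta> (dchart A x v)"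
  shows "potential S \<eta> p f"
  using assms unfolding potential_def by (intro exI[of _ A] exI[of _ z] exI[of _ W] exI[of _ F]) auto

lemma potentialE:
  assumes "potential S \<eta> p f"
  obtains A z W F where "invertible A" "chart A z = p" "open W" "z \<in> W" "smooth_on F W"
    "\<And>x. x \<in> W \<inter> affine_part A S \<Longrightarrow> F x = f (chart A x)"
    "\<And>x v. x \<in> W \<inter> affine_part A S \<Longrightarrow> v \<in> tangent_space (affine_part A S) x \<Longrightarrow> FD F x v = \<eta> (dchart A x v)"
proof -
  obtain A z W F where "invertible A" "chart A z = p" "open W" "z \<in> W" "smooth_on F W"
     "\<forall>x\<in>W \<inter> affine_part A S. F x = f (chart A x) \<and>
        (\<forall>v\<in>tangent_space (affine_part A S) x. FD F x v = \<eta> (dchart A x v))"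
    using assms unfolding potential_def by blast
  then show thesis using that[of A z W F] by simp
qed

lemma FD_diff:
  assumes "smooth_on f V" "smooth_on g V" "open V" "x \<in> V"
  shows "FD (\<lambda>x. f x - g x) x v = FD f x v - FD g x v"
  using FD_eqI[OF has_derivative_diff[OF smooth_on_has_derivative[OF assms(1,3,4)] smooth_on_has_derivative[OF assms(2,3,4)]]]
  by metis

lemma closed_form_ex_potential:
  assumes S: "smooth_cp_hypersurface S" and closed: "closed_form S \<eta>" and A: "invertible A" and z: "chart A z \<in> S"
  shows "\<exists>f U. open U \<and> chart A z \<in> U \<and> (\<forall>q\<in>U \<inter> S. potential S \<eta> q f)"
proof -
  let ?M = "affine_part A S"
  have zM: "z \<in> ?M" using z by simp
  obtain V \<alpha> where V: "z \<in> V" "form_extension S (T S) A \<eta> V \<alpha>"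
    "\<forall>x\<in>V \<inter> ?M. \<forall>v\<in>tangent_space ?M x. \<forall>w\<in>tangent_space ?M x.
       FD (\<lambda>y. \<alpha> y w) x v - FD (\<lambda>y. \<alpha> y v) x w = 0"
    using closed[unfolded closed_form_def, THEN spec, THEN spec, THEN mp, OF conjI, OF A zM]
    by (elim exE conjE) (rule that)
  have V': "open V" "\<And>x. x \<in> V \<Longrightarrow> linear (\<alpha> x)" "\<And>v. smooth_on (\<lambda>x. \<alpha> x v) V"
    "\<And>x v. x \<in> V \<inter> ?M \<Longrightarrow> dchart A x v \<in> T S (chart A x) \<Longrightarrow> \<eta> (dchart A x v) = \<alpha> x v"
    using V(2) unfolding form_extension_def by auto
  have cl: "FD (\<lambda>y. \<alpha> y w) x v = FD (\<lambda>y. \<alpha> y v) x w"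
    if "x \<in> V \<inter> ?M" "v \<in> tangent_space ?M x" "w \<in> tangent_space ?M x" for x v w
    using V(3)[rule_format, OF that] by simp
  obtain W F where W: "open W" "z \<in> W" "W \<subseteq> V" "smooth_on F W"
    "\<And>x v. x \<in> W \<inter> ?M \<Longrightarrow> v \<in> tangent_space ?M x \<Longrightarrow> FD F x v = \<alpha> x v"
    by (rule closed_on_hypersurface_has_potential[OF affine_part_hypersurface[OF S A] zM V'(1) V(1) V'(2,3) cl])
      (assumption, assumption, assumption, assumption, rule that)
  define f where "f p = F (THE x. chart A x = p)" for p
  have f: "f (chart A x) = F x" for x
    unfolding f_def by (simp add: chart_inj[OF A])
  show ?thesis
  proof (intro exI[of _ f] exI[of _ "chart A ` W"] conjI ballI)
    show "open (chart A ` W)" by (rule open_chart_image[OF A W(1)])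
    show "chart A z \<in> chart A ` W" using W(2) by blast
    fix q assume "q \<in> chart A ` W \<inter> S"
    then obtain x where x: "x \<in> W" "chart A x = q" by auto
    show "potential S \<eta> q f"
    proof (rule potentialI[OF A x(2) W(1) x(1) W(4)])
      fix y v assume y: "y \<in> W \<inter> ?M" and v: "v \<in> tangent_space ?M y"
      have "\<eta> (dchart A y v) = \<alpha> y v"
        by (rule V'(4)) (use y v W(3) dchart_in_T_iff[OF S A, of y v] in auto)
      then show "FD F y v = \<eta> (dchart A y v)" using W(5)[OF y v] by simp
    qed (simp add: f)
  qed
qed

text \<open>In a common chart the difference of the two potentials has zero derivative along the hypersurface.\<close>

lemma potential_unique:
  assumes S: "smooth_cp_hypersurface S" and p: "p \<in> S" and "potential S \<eta> p f" "potential S \<eta> p g"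
  shows "\<exists>U c. open U \<and> p \<in> U \<and> (\<forall>q\<in>U \<inter> S. f q = g q + c)"
proof -
  obtain A z W F where F: "invertible A" "chart A z = p" "open W" "z \<in> W" "smooth_on F W"
    "\<And>x. x \<in> W \<inter> affine_part A S \<Longrightarrow> F x = f (chart A x)"
    "\<And>x v. x \<in> W \<inter> affine_part A S \<Longrightarrow> v \<in> tangent_space (affine_part A S) x \<Longrightarrow> FD F x v = \<eta> (dchart A x v)"
    by (rule potentialE[OF assms(3)]) (rule that)
  obtain A' z' W' G where G: "invertible A'" "chart A' z' = p" "open W'" "z' \<in> W'" "smooth_on G W'"
    "\<And>x. x \<in> W' \<inter> affine_part A' S \<Longrightarrow> G x = g (chart A' x)"
    "\<And>x v. x \<in> W' \<inter> affine_part A' S \<Longrightarrow> v \<in> tangent_space (affine_part A' S) x \<Longrightarrow> FD G x v = \<eta> (dchart A' x v)"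
    by (rule potentialE[OF assms(4)]) (rule that)
  let ?M = "affine_part A S" and ?B = "transition A A'"
  have zM: "z \<in> ?M" using F(2) p by simp
  have N: "pden ?B z \<noteq> 0" "z' = pmap ?B z" using chart_eq_iff[OF F(1) G(1), of z z'] F(2) G(2) by auto
  define V where "V = W \<inter> ({x. pden ?B x \<noteq> 0} \<inter> pmap ?B -` W')"
  have V: "open V" unfolding V_def
    by (intro open_Int F(3) continuous_open_preimage[OF smooth_on_continuous[OF smooth_on_pmap[OF open_pden]] open_pden G(3)]) auto
  have zV: "z \<in> V" using N F(4) G(4) by (simp add: V_def)
  have sF: "smooth_on F V" by (rule smooth_on_mono[OF F(5)]) (auto simp: V_def)
  have sG: "smooth_on (\<lambda>x. G (pmap ?B x)) V"
    by (rule smooth_on_compose[OF V G(3,5) smooth_on_pmap[OF V]]) (auto simp: V_def)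
  have zero: "FD (\<lambda>x. F x - G (pmap ?B x)) x v = 0"
    if x: "x \<in> V \<inter> ?M" and v: "v \<in> tangent_space ?M x" for x v
  proof -
    have n: "pden ?B x \<noteq> 0" and xV: "x \<in> V" and xS: "chart A x \<in> S" using x by (auto simp: V_def)
    have y: "pmap ?B x \<in> W' \<inter> affine_part A' S" using x chart_pmap[OF F(1) G(1) n] by (auto simp: V_def)
    have "((\<lambda>x. G (pmap ?B x)) has_derivative (\<lambda>v. FD G (pmap ?B x) (dpmap ?B x v))) (at x)"
      by (rule has_derivative_compose[OF has_derivative_pmap[OF n] smooth_on_has_derivative[OF G(5,3)]]) (use y in auto)
    then have "FD (\<lambda>x. G (pmap ?B x)) x v = FD G (pmap ?B x) (dpmap ?B x v)" by (simp add: FD_eqI)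
    also have "\<dots> = \<eta> (dchart A' (pmap ?B x) (dpmap ?B x v))"
      by (rule G(7)[OF y dpmap_tangent[OF S F(1) G(1) xS n v]])
    also have "\<dots> = FD F x v"
      unfolding dchart_dpmap[OF F(1) G(1) n] by (rule F(7)[symmetric]) (use x v in \<open>auto simp: V_def\<close>)
    finally show ?thesis by (simp add: FD_diff[OF sF sG V xV])
  qed
  obtain U where U: "open U" "z \<in> U" "\<And>x. x \<in> U \<inter> ?M \<Longrightarrow> F x - G (pmap ?B x) = F z - G (pmap ?B z)"
    by (rule zero_tangential_derivative_imp_locally_constant[OF affine_part_hypersurface[OF S F(1)] zM V zV
        smooth_on_diff[OF V sF sG] zero]) (assumption, assumption, rule that)
  show ?thesis
  proof (intro exI[of _ "chart A ` (U \<inter> V)"] exI[of _ "F z - G (pmap ?B z)"] conjI ballI)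
    show "open (chart A ` (U \<inter> V))" by (intro open_chart_image F(1) open_Int U V)
    show "p \<in> chart A ` (U \<inter> V)" using F(2) U(2) zV by blast
    fix q assume "q \<in> chart A ` (U \<inter> V) \<inter> S"
    then obtain x where x: "x \<in> U" "x \<in> V" "q = chart A x" "x \<in> ?M" by auto
    have n: "pden ?B x \<noteq> 0" using x by (simp add: V_def)
    have "F x = f q" using F(6)[of x] x by (simp add: V_def)
    moreover have "G (pmap ?B x) = g q"
      using G(6)[of "pmap ?B x"] x chart_pmap[OF F(1) G(1) n] by (simp add: V_def)
    ultimately show "f q = g q + (F z - G (pmap ?B z))" using U(3)[of x] x by (simp add: algebra_simps)
  qed
qed

lemma cp_hypersurface_locally_path_connected:
  assumes S: "smooth_cp_hypersurface S" and A: "invertible A" and z: "chart A z \<in> S" and U: "open U" "chart A z \<in> U"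
  shows "\<exists>V. open V \<and> chart A z \<in> V \<and> V \<subseteq> U \<and> path_connected (V \<inter> S)"
proof -
  have zM: "z \<in> affine_part A S" "z \<in> chart A -` U" using z U by simp_all
  obtain W where W: "open W" "z \<in> W" "W \<subseteq> chart A -` U" "path_connected (W \<inter> affine_part A S)"
    by (rule hypersurface_locally_path_connected[OF affine_part_hypersurface[OF S A] zM(1) open_chart_vimage[OF A U(1)] zM(2)])
      (rule that)
  have eq: "chart A ` W \<inter> S = chart A ` (W \<inter> affine_part A S)" by auto
  have "path_connected (chart A ` W \<inter> S)"
    unfolding eq by (rule path_connected_continuous_image[OF continuous_on_subset[OF continuous_on_chart[OF A]] W(4)]) auto
  then show ?thesis using open_chart_image[OF A W(1)] W by (intro exI[of _ "chart A ` W"]) auto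
qed

lemma closed_form_has_potential:
  assumes S: "smooth_cp_hypersurface S" and conv: "strongly_C_convex S" and sc: "simply_connected S"
    and closed: "closed_form S \<eta>"
  obtains f where "\<And>p. p \<in> S \<Longrightarrow> potential S \<eta> p f"
proof -
  interpret local_solutions S "potential S \<eta>"
  proof
    fix p assume p: "p \<in> S"
    obtain A z where A: "invertible A" "chart A z = p" using ex_chart[OF conv p] by metis
    then show "\<exists>f U. open U \<and> p \<in> U \<and> (\<forall>q\<in>U \<inter> S. potential S \<eta> q f)"
      using closed_form_ex_potential[OF S closed A(1), of z] p by simp
  next
    fix p f g assume "p \<in> S" "potential S \<eta> p f" "potential S \<eta> p g"
    then show "\<exists>U c. open U \<and> p \<in> U \<and> (\<forall>q\<in>U \<inter> S. f q = g q + c)"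
      by (rule potential_unique[OF S])
  qed
  have lpc: "\<exists>V. open V \<and> p \<in> V \<and> V \<subseteq> U \<and> path_connected (V \<inter> S)" if p: "p \<in> S" and U: "open U" "p \<in> U" for p U
  proof -
    obtain A z where A: "invertible A" "chart A z = p" using ex_chart[OF conv p] by metis
    then show ?thesis using cp_hypersurface_locally_path_connected[OF S A(1), of z U] p U by simp
  qed
  obtain f where f: "\<And>p g. p \<in> S \<Longrightarrow> potential S \<eta> p g \<Longrightarrow> \<exists>U c. open U \<and> p \<in> U \<and> (\<forall>q\<in>U \<inter> S. f q = g q + c)"
    by (rule global_solution[OF sc lpc]) (assumption, assumption, assumption, rule that)
  show thesis
  proof (rule that)
    fix p assume p: "p \<in> S"
    obtain U1 g where "open U1" "p \<in> U1" "\<And>q. q \<in> U1 \<inter> S \<Longrightarrow> potential S \<eta> q g"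
      by (rule ex_localE[OF p]) (rule that)
    then have g: "potential S \<eta> p g" using p by blast
    obtain U c where U: "open U" "p \<in> U" "\<forall>q\<in>U \<inter> S. f q = g q + c" using f[OF p g] by blast
    obtain A z W F where F: "invertible A" "chart A z = p" "open W" "z \<in> W" "smooth_on F W"
      "\<And>x. x \<in> W \<inter> affine_part A S \<Longrightarrow> F x = g (chart A x)"
      "\<And>x v. x \<in> W \<inter> affine_part A S \<Longrightarrow> v \<in> tangent_space (affine_part A S) x \<Longrightarrow> FD F x v = \<eta> (dchart A x v)"
      by (rule potentialE[OF g]) (rule that)
    let ?W = "W \<inter> chart A -` U"
    have W: "open ?W" by (intro open_Int F(3) open_chart_vimage F(1) U(1))
    have sF: "smooth_on F ?W" by (rule smooth_on_mono[OF F(5)]) auto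
    show "potential S \<eta> p f"
    proof (rule potentialI[OF F(1,2) W])
      show "z \<in> ?W" using F(2,4) U(2) by simp
      show "smooth_on (\<lambda>x. F x + c) ?W" by (intro smooth_on_add smooth_on_const W sF)
      show "F x + c = f (chart A x)" if "x \<in> ?W \<inter> affine_part A S" for x
        using that F(6)[of x] U(3) by auto
      fix x v assume x: "x \<in> ?W \<inter> affine_part A S" and v: "v \<in> tangent_space (affine_part A S) x"
      have "((\<lambda>x. F x + c) has_derivative (\<lambda>v. FD F x v + 0)) (at x)"
        by (intro has_derivative_add has_derivative_const smooth_on_has_derivative[OF sF W]) (use x in auto)
      then show "FD (\<lambda>x. F x + c) x v = \<eta> (dchart A x v)"
        using F(7)[of x v] x v by (simp add: FD_eqI)
    qed
  qed
qed

lemma potential_smooth_function: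
  assumes "\<And>p. p \<in> S \<Longrightarrow> potential S \<eta> p f"
  shows "smooth_function S f"
proof (rule smooth_functionI)
  fix p assume "p \<in> S"
  from assms[OF this] show "\<exists>A z W F. invertible A \<and> chart A z = p \<and> open W \<and> z \<in> W \<and> smooth_on F W \<and>
      (\<forall>x\<in>W \<inter> affine_part A S. F x = f (chart A x))"
    unfolding potential_def by blast
qed

lemma potential_differential:
  assumes S: "smooth_cp_hypersurface S" and p: "p \<in> S" and f: "potential S \<eta> p f" and \<tau>: "\<tau> \<in> T S p"
  shows "differential S f \<tau> = \<eta> \<tau>"
proof -
  obtain A z W F where F: "invertible A" "chart A z = p" "open W" "z \<in> W" "smooth_on F W"
    "\<And>x. x \<in> W \<inter> affine_part A S \<Longrightarrow> F x = f (chart A x)"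
    "\<And>x v. x \<in> W \<inter> affine_part A S \<Longrightarrow> v \<in> tangent_space (affine_part A S) x \<Longrightarrow> FD F x v = \<eta> (dchart A x v)"
    by (rule potentialE[OF f]) (rule that)
  have z: "chart A z \<in> S" using F(2) p by simp
  obtain v where v: "v \<in> tangent_space (affine_part A S) z" "\<tau> = dchart A z v"
    using \<tau> T_chart[OF S F(1) z] F(2) by auto
  have "differential S f (dchart A z v) = FD F z v"
    by (rule differential_dchart[OF S F(1) z v(1) extension_has_derivative[OF F(5,3,4)]]) (use z F(6) in auto)
  then show ?thesis using F(7)[of z v] F(4) z v by simp
qed

text \<open>Second derivatives of a local extension commute.\<close>

lemma closed_form_differential:
  assumes S: "smooth_cp_hypersurface S" and f: "smooth_function S f"
    and \<eta>: "\<And>p \<tau>. p \<in> S \<Longrightarrow> \<tau> \<in> T S p \<Longrightarrow> \<eta> \<tau> = differential S f \<tau>"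
  shows "closed_form S \<eta>"
  unfolding closed_form_def
proof (intro allI impI)
  fix A z assume "invertible A \<and> z \<in> affine_part A S"
  then have A: "invertible A" and z: "chart A z \<in> S" by auto
  let ?M = "affine_part A S"
  obtain W F where F: "open W" "z \<in> W" "smooth_on F W" "\<And>x. x \<in> W \<inter> ?M \<Longrightarrow> F x = f (chart A x)"
    by (rule smooth_functionE[OF f A z]) (rule that)
  have "form_extension S (T S) A \<eta> W (FD F)"
    unfolding form_extension_def
  proof (intro conjI ballI allI impI)
    show "linear (FD F x)" if "x \<in> W" for x by (rule smooth_on_FD_linear[OF F(3,1) that])
    show "smooth_on (\<lambda>x. FD F x v) W" for v by (rule smooth_on_FD[OF F(3,1)])
    fix x v assume x: "x \<in> W \<inter> ?M" and v: "dchart A x v \<in> T S (chart A x)"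
    have xS: "chart A x \<in> S" and xW: "x \<in> W" and xM: "x \<in> ?M" using x by auto
    have vT: "v \<in> tangent_space ?M x" using v dchart_in_T_iff[OF S A xS] by simp
    have "differential S f (dchart A x v) = FD F x v"
      by (rule differential_dchart[OF S A xS vT extension_has_derivative[OF F(3,1) xW xM F(4)]])
    then show "\<eta> (dchart A x v) = FD F x v" using \<eta>[OF xS v] by simp
  qed (rule F(1))
  moreover have "FD (\<lambda>y. FD F y w) x v - FD (\<lambda>y. FD F y v) x w = 0" if "x \<in> W" for x v w
    using FD_commute[OF F(3,1) that, of w v] by simp
  ultimately show "\<exists>V \<alpha>. z \<in> V \<and> form_extension S (T S) A \<eta> V \<alpha> \<and>
      (\<forall>x\<in>V \<inter> ?M. \<forall>v\<in>tangent_space ?M x. \<forall>w\<in>tangent_space ?M x.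
        FD (\<lambda>y. \<alpha> y w) x v - FD (\<lambda>y. \<alpha> y v) x w = 0)"
    using F(2) by (intro exI[of _ W] exI[of _ "FD F"]) auto
qed


section \<open>The splitting of differentials on the complex tangent spaces\<close>

lemma tangent_J_in_H:
  assumes S: "smooth_cp_hypersurface S" "strongly_C_convex S" and p: "p \<in> S" and \<tau>: "\<tau> \<in> H S p"
  shows "tangent_J \<tau> \<in> H S p"
proof -
  obtain A z where A: "invertible A" "chart A z = p" using ex_chart[OF S(2) p] by metis
  have z: "chart A z \<in> S" "z \<in> affine_part A S" using A p by simp_all
  obtain v where v: "v \<in> complex_tangent_space (affine_part A S) z" "\<tau> = dchart A z v"
    using \<tau> H_chart[OF S(1) A(1) z(1)] A(2) by auto
  have "- v \<in> tangent_space (affine_part A S) z"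
    using v(1) complex_tangent_space_subset subspace_neg[OF subspace_tangent_space[OF affine_part_hypersurface[OF S(1) A(1)] z(2)]]
    by blast
  then have "\<i> *s v \<in> complex_tangent_space (affine_part A S) z"
    using v(1) unfolding mem_complex_tangent_space[OF affine_part_hypersurface[OF S(1) A(1)] z(2)] by simp
  then show ?thesis
    unfolding v(2) tangent_J_dchart[OF A(1)] using dchart_in_H_iff[OF S(1) A(1) z(1)] A(2) by simp
qed

lemma dual_J_in_H:
  assumes S: "smooth_cp_hypersurface S" "strongly_C_convex S" and p: "p \<in> S" and \<tau>: "\<tau> \<in> H S p"
  shows "dual_J S \<tau> \<in> H S p"
proof -
  obtain A z J' where A: "invertible A" "chart A z = p"
    and J': "\<And>v. v \<in> complex_tangent_space (affine_part A S) z \<Longrightarrow> J' v \<in> complex_tangent_space (affine_part A S) z"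
    "\<And>v. v \<in> complex_tangent_space (affine_part A S) z \<Longrightarrow> dual_J S (dchart A z v) = dchart A z (J' v)"
    using ex_chart_dual_J[OF S p] by metis
  have z: "chart A z \<in> S" using A p by simp
  show ?thesis
    using \<tau> J' unfolding H_chart[OF S(1) A(1) z, unfolded A(2)] by auto
qed

lemma H_subset_T: "H S p \<subseteq> T S p"
  by (simp add: H_def)

text \<open>A functional that is complex linear for both structures vanishes on the image of \<open>J - J*\<close>. This
  is the uniqueness of the splitting into \<open>d'\<close> and \<open>d''\<close>.\<close>

lemma real_linear_J_dual_J_linear_eq_0:
  assumes S: "smooth_cp_hypersurface S" "strongly_C_convex S" and p: "p \<in> S" and \<tau>: "\<tau> \<in> H S p"
    and lin: "\<And>A z. invertible A \<Longrightarrow> chart A z = p \<Longrightarrow>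
      \<exists>\<alpha>. linear \<alpha> \<and> (\<forall>v\<in>complex_tangent_space (affine_part A S) z. a (dchart A z v) = \<alpha> v)"
    and J: "\<And>\<tau>. \<tau> \<in> H S p \<Longrightarrow> a (tangent_J \<tau>) = \<i> * a \<tau>"
    and dual: "\<And>\<tau>. \<tau> \<in> H S p \<Longrightarrow> a (dual_J S \<tau>) = \<i> * a \<tau>"
  shows "a \<tau> = (0 :: complex)"
proof -
  obtain A z J' where A: "invertible A" "chart A z = p"
    and J': "\<And>v. v \<in> complex_tangent_space (affine_part A S) z \<Longrightarrow> J' v \<in> complex_tangent_space (affine_part A S) z"
    "\<And>v. v \<in> complex_tangent_space (affine_part A S) z \<Longrightarrow> dual_J S (dchart A z v) = dchart A z (J' v)"
    "\<And>v. v \<in> complex_tangent_space (affine_part A S) z \<Longrightarrow>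
      \<exists>\<sigma>\<in>complex_tangent_space (affine_part A S) z. \<i> *s \<sigma> - J' \<sigma> = v"
    by (rule ex_chart_dual_J[OF S p]) (rule that)
  have z: "chart A z \<in> S" using A p by simp
  note Hc = dchart_in_H_iff[OF S(1) A(1) z, unfolded A(2)]
  obtain \<alpha> where \<alpha>: "linear \<alpha>" "\<And>v. v \<in> complex_tangent_space (affine_part A S) z \<Longrightarrow> a (dchart A z v) = \<alpha> v"
    using lin[OF A] by blast
  obtain v where v: "v \<in> complex_tangent_space (affine_part A S) z" "\<tau> = dchart A z v"
    using \<tau> H_chart[OF S(1) A(1) z] A(2) by auto
  obtain \<sigma> where \<sigma>: "\<sigma> \<in> complex_tangent_space (affine_part A S) z" "\<i> *s \<sigma> - J' \<sigma> = v"
    using J'(3)[OF v(1)] by blast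
  have \<sigma>H: "dchart A z \<sigma> \<in> H S p" using Hc \<sigma>(1) by simp
  have i\<sigma>: "\<i> *s \<sigma> \<in> complex_tangent_space (affine_part A S) z"
    using tangent_J_in_H[OF S p \<sigma>H] unfolding tangent_J_dchart[OF A(1)] Hc .
  have "a \<tau> = \<alpha> (\<i> *s \<sigma>) - \<alpha> (J' \<sigma>)"
    using \<alpha>(2)[OF v(1)] linear_diff[OF \<alpha>(1), of "\<i> *s \<sigma>" "J' \<sigma>"] unfolding v(2) \<sigma>(2) by simp
  also have "\<dots> = a (tangent_J (dchart A z \<sigma>)) - a (dual_J S (dchart A z \<sigma>))"
    unfolding tangent_J_dchart[OF A(1)] J'(2)[OF \<sigma>(1)] \<alpha>(2)[OF i\<sigma>] \<alpha>(2)[OF J'(1)[OF \<sigma>(1)]] ..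
  also have "\<dots> = 0" unfolding J[OF \<sigma>H] dual[OF \<sigma>H] by simp
  finally show ?thesis .
qed

section \<open>Sums of CR and dual-CR functions\<close>

lemma smooth_formE:
  assumes "smooth_form S (T S) \<omega>" "smooth_cp_hypersurface S" "invertible A" "chart A z \<in> S"
  obtains V \<alpha> where "open V" "z \<in> V" "\<And>x. x \<in> V \<Longrightarrow> linear (\<alpha> x)" "\<And>v. smooth_on (\<lambda>x. \<alpha> x v) V"
    "\<And>x v. x \<in> V \<inter> affine_part A S \<Longrightarrow> v \<in> tangent_space (affine_part A S) x \<Longrightarrow> \<omega> (dchart A x v) = \<alpha> x v"
proof -
  obtain V \<alpha> where V: "z \<in> V" "form_extension S (T S) A \<omega> V \<alpha>"
    using assms unfolding smooth_form_def by (metis mem_affine_part)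
  show thesis
    by (rule that[of V \<alpha>]) (use V dchart_in_T_iff[OF assms(2,3)] in \<open>auto simp: form_extension_def\<close>)
qed

text \<open>The difference of the two sides is \<open>df - d'u = d''u - dg\<close>; the first expression is complex linear
  for \<open>J\<close>, the second for \<open>J*\<close>.\<close>

lemma CR_plus_dual_CR_differential:
  assumes S: "smooth_cp_hypersurface S" "strongly_C_convex S"
    and f: "CR S f" and g: "dual_CR S g" and u: "\<And>p. p \<in> S \<Longrightarrow> u p = f p + g p"
    and a: "smooth_form S (T S) a" "restricts_to_d' S u a" and p: "p \<in> S" and \<tau>: "\<tau> \<in> H S p"
  shows "differential S f \<tau> = a \<tau>"
proof -
  have sf: "smooth_function S f" and sg: "smooth_function S g"
    using f g unfolding CR_def dual_CR_def by auto
  obtain b where b: "is_d_split S u a b" using a(2) unfolding restricts_to_d'_def by blast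
  have split: "differential S u \<sigma> = a \<sigma> + b \<sigma>" "a (tangent_J \<sigma>) = \<i> * a \<sigma>" "b (dual_J S \<sigma>) = \<i> * b \<sigma>"
    if "\<sigma> \<in> H S p" for \<sigma>
    using b p that unfolding is_d_split_def by auto
  have du: "differential S u \<sigma> = differential S f \<sigma> + differential S g \<sigma>" if \<sigma>: "\<sigma> \<in> H S p" for \<sigma>
  proof -
    obtain A z where A: "invertible A" "chart A z = p" using ex_chart[OF S(2) p] by metis
    have z: "chart A z \<in> S" using A p by simp
    obtain v where v: "v \<in> tangent_space (affine_part A S) z" "\<sigma> = dchart A z v"
      using \<sigma> H_subset_T T_chart[OF S(1) A(1) z] A(2) by blast
    show ?thesis unfolding v(2) by (rule differential_add[OF S(1) sf sg A(1) z v(1) u])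
  qed
  define e where "e \<sigma> = differential S f \<sigma> - a \<sigma>" for \<sigma>
  have e: "e \<sigma> = b \<sigma> - differential S g \<sigma>" if "\<sigma> \<in> H S p" for \<sigma>
    using split(1)[OF that] du[OF that] by (simp add: e_def algebra_simps)
  have "e \<tau> = 0"
  proof (rule real_linear_J_dual_J_linear_eq_0[OF S p \<tau>])
    fix A z assume A: "invertible A" "chart A z = p"
    have z: "chart A z \<in> S" using A p by simp
    obtain V \<alpha> where V: "open V" "z \<in> V" "\<And>x. x \<in> V \<Longrightarrow> linear (\<alpha> x)" "\<And>v. smooth_on (\<lambda>x. \<alpha> x v) V"
      "\<And>x v. x \<in> V \<inter> affine_part A S \<Longrightarrow> v \<in> tangent_space (affine_part A S) x \<Longrightarrow> a (dchart A x v) = \<alpha> x v"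
      by (rule smooth_formE[OF a(1) S(1) A(1) z]) (rule that)
    let ?D = "frechet_derivative (\<lambda>x. f (chart A x)) (at z within affine_part A S)"
    have D: "linear ?D" using smooth_function_has_derivative[OF sf A(1) z] has_derivative_linear by blast
    have "e (dchart A z v) = ?D v - \<alpha> z v" if "v \<in> complex_tangent_space (affine_part A S) z" for v
    proof -
      have "v \<in> tangent_space (affine_part A S) z" using that complex_tangent_space_subset by blast
      then show ?thesis using differential_eq[OF S(1) sf A(1) z] V(5)[of z v] z V(2) by (simp add: e_def)
    qed
    then show "\<exists>\<alpha>. linear \<alpha> \<and> (\<forall>v\<in>complex_tangent_space (affine_part A S) z. e (dchart A z v) = \<alpha> v)"
      using linear_compose_sub[OF D V(3)[OF V(2)]] by blast
  next
    fix \<sigma> assume \<sigma>: "\<sigma> \<in> H S p"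
    show "e (tangent_J \<sigma>) = \<i> * e \<sigma>"
      using f p \<sigma> split(2)[OF \<sigma>] unfolding CR_def e_def by (simp add: algebra_simps)
    show "e (dual_J S \<sigma>) = \<i> * e \<sigma>"
      using g p \<sigma> split(3)[OF \<sigma>] unfolding e[OF \<sigma>] e[OF dual_J_in_H[OF S p \<sigma>]] dual_CR_def
      by (simp add: algebra_simps)
  qed
  then show ?thesis by (simp add: e_def)
qed

text \<open>Since \<open>H\<close> has real codimension one in the tangent space, two functionals that vanish on
  \<open>H\<close> are proportional.\<close>

lemma linear_vanishing_on_H_proportional:
  fixes \<alpha> \<beta> :: "complex^'n::finite \<Rightarrow> complex"
  assumes M: "smooth_hypersurface M" "z \<in> M" and lin: "linear \<alpha>" "linear \<beta>"
    and zero: "\<And>v. v \<in> complex_tangent_space M z \<Longrightarrow> \<alpha> v = 0" "\<And>v. v \<in> complex_tangent_space M z \<Longrightarrow> \<beta> v = 0"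
    and v: "v \<in> tangent_space M z" and w: "w \<in> tangent_space M z" "\<beta> w \<noteq> 0"
  shows "\<alpha> v = \<alpha> w / \<beta> w * \<beta> v"
proof -
  obtain V \<rho> where V: "z \<in> V" "defining_function M V \<rho>"
    using smooth_hypersurfaceE[OF M open_UNIV UNIV_I] by metis
  note T = tangent_space_cgrad[OF V(2,1) M(2)] and H = complex_tangent_space_cgrad[OF V(2,1) M(2)]
  let ?c = "cdot (cgrad \<rho> z)"
  have "w \<notin> complex_tangent_space M z" using zero(2) w(2) by blast
  then have n: "Im (?c w) \<noteq> 0" using w(1) unfolding T H by (auto simp: complex_eq_iff)
  define r where "r = Im (?c v) / Im (?c w)"
  have "?c (v - r *\<^sub>R w) = 0"
    using v w(1) n unfolding T
    by (simp add: linear_diff[OF linear_cdot] linear_scale[OF linear_cdot] complex_eq_iff r_def)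
  then have "v - r *\<^sub>R w \<in> complex_tangent_space M z" unfolding H by simp
  from zero(1)[OF this] zero(2)[OF this] have "\<alpha> v = r *\<^sub>R \<alpha> w" "\<beta> v = r *\<^sub>R \<beta> w"
    by (simp_all add: linear_diff[OF lin(1)] linear_scale[OF lin(1)] linear_diff[OF lin(2)] linear_scale[OF lin(2)])
  then show ?thesis using w(2) by (simp add: scaleR_conv_of_real)
qed

text \<open>The factor is the quotient of the two forms on any tangent vector outside \<open>H\<close>. It is smooth because
  locally such a vector can be chosen as the value of a smooth tangent vector field.\<close>

lemma form_vanishing_on_H_eq_multiple:
  assumes S: "smooth_cp_hypersurface S" "strongly_C_convex S" and \<theta>: "contact_form S \<theta>"
    and \<omega>: "\<And>A z. invertible A \<Longrightarrow> chart A z \<in> S \<Longrightarrow> \<exists>V \<alpha>. z \<in> V \<and> form_extension S (T S) A \<omega> V \<alpha>"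
    and zero: "\<And>p \<tau>. p \<in> S \<Longrightarrow> \<tau> \<in> H S p \<Longrightarrow> \<omega> \<tau> = 0"
  obtains l where "smooth_function S l" "\<And>p \<tau>. p \<in> S \<Longrightarrow> \<tau> \<in> T S p \<Longrightarrow> \<omega> \<tau> = l p * \<theta> \<tau>"
proof -
  have \<omega>': "smooth_form S (T S) \<omega>" using \<omega> unfolding smooth_form_def by simp
  have \<theta>': "smooth_form S (T S) \<theta>" "\<And>p. p \<in> S \<Longrightarrow> \<exists>\<tau>\<in>T S p. \<theta> \<tau> \<noteq> 0" "\<And>p \<tau>. p \<in> S \<Longrightarrow> \<tau> \<in> H S p \<Longrightarrow> \<theta> \<tau> = 0"
    using \<theta> unfolding contact_form_def by auto
  define t where "t p = (SOME \<tau>. \<tau> \<in> T S p \<and> \<theta> \<tau> \<noteq> 0)" for p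
  have t: "t p \<in> T S p" "\<theta> (t p) \<noteq> 0" if "p \<in> S" for p
    using someI_ex[of "\<lambda>\<tau>. \<tau> \<in> T S p \<and> \<theta> \<tau> \<noteq> 0"] \<theta>'(2)[OF that] unfolding t_def by blast+
  define l where "l p = \<omega> (t p) / \<theta> (t p)" for p
  have l: "\<omega> \<tau> = l p * \<theta> \<tau>" if p: "p \<in> S" and \<tau>: "\<tau> \<in> T S p" for p \<tau>
  proof -
    obtain A z where A: "invertible A" "chart A z = p" using ex_chart[OF S(2) p] by metis
    let ?M = "affine_part A S"
    have z: "chart A z \<in> S" "z \<in> ?M" using A p by simp_all
    obtain V \<alpha> where \<alpha>: "open V" "z \<in> V" "\<And>x. x \<in> V \<Longrightarrow> linear (\<alpha> x)" "\<And>v. smooth_on (\<lambda>x. \<alpha> x v) V"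
      "\<And>x v. x \<in> V \<inter> ?M \<Longrightarrow> v \<in> tangent_space ?M x \<Longrightarrow> \<omega> (dchart A x v) = \<alpha> x v"
      by (rule smooth_formE[OF \<omega>' S(1) A(1) z(1)]) (rule that)
    obtain V' \<beta> where \<beta>: "open V'" "z \<in> V'" "\<And>x. x \<in> V' \<Longrightarrow> linear (\<beta> x)" "\<And>v. smooth_on (\<lambda>x. \<beta> x v) V'"
      "\<And>x v. x \<in> V' \<inter> ?M \<Longrightarrow> v \<in> tangent_space ?M x \<Longrightarrow> \<theta> (dchart A x v) = \<beta> x v"
      by (rule smooth_formE[OF \<theta>'(1) S(1) A(1) z(1)]) (rule that)
    have \<alpha>z: "\<omega> (dchart A z v) = \<alpha> z v" and \<beta>z: "\<theta> (dchart A z v) = \<beta> z v" if "v \<in> tangent_space ?M z" for v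
      using \<alpha>(5)[of z v] \<beta>(5)[of z v] \<alpha>(2) \<beta>(2) z that by auto
    obtain v where v: "v \<in> tangent_space ?M z" "\<tau> = dchart A z v"
      using \<tau> T_chart[OF S(1) A(1) z(1)] A(2) by auto
    obtain w where w: "w \<in> tangent_space ?M z" "t p = dchart A z w"
      using t(1)[OF p] T_chart[OF S(1) A(1) z(1)] A(2) by auto
    have H0: "\<alpha> z v = 0" "\<beta> z v = 0" if "v \<in> complex_tangent_space ?M z" for v
    proof -
      have "dchart A z v \<in> H S p" using dchart_in_H_iff[OF S(1) A(1) z(1)] that A(2) by simp
      then show "\<alpha> z v = 0" "\<beta> z v = 0"
        using zero[OF p] \<theta>'(3)[OF p] \<alpha>z[of v] \<beta>z[of v] that complex_tangent_space_subset by fastforce+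
    qed
    have "\<beta> z w \<noteq> 0" using t(2)[OF p] w \<beta>z by simp
    from linear_vanishing_on_H_proportional[OF affine_part_hypersurface[OF S(1) A(1)] z(2) \<alpha>(3)[OF \<alpha>(2)]
        \<beta>(3)[OF \<beta>(2)] H0 v(1) w(1) this]
    show ?thesis unfolding l_def v(2) w(2) using \<alpha>z \<beta>z v(1) w(1) by simp
  qed
  have "smooth_function S l"
  proof (rule smooth_functionI)
    fix p assume p: "p \<in> S"
    obtain A z where A: "invertible A" "chart A z = p" using ex_chart[OF S(2) p] by metis
    let ?M = "affine_part A S"
    have z: "chart A z \<in> S" "z \<in> ?M" using A p by simp_all
    obtain V1 \<alpha> where \<alpha>: "open V1" "z \<in> V1" "\<And>x. x \<in> V1 \<Longrightarrow> linear (\<alpha> x)" "\<And>v. smooth_on (\<lambda>x. \<alpha> x v) V1"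
      "\<And>x v. x \<in> V1 \<inter> ?M \<Longrightarrow> v \<in> tangent_space ?M x \<Longrightarrow> \<omega> (dchart A x v) = \<alpha> x v"
      by (rule smooth_formE[OF \<omega>' S(1) A(1) z(1)]) (rule that)
    obtain V2 \<beta> where \<beta>: "open V2" "z \<in> V2" "\<And>x. x \<in> V2 \<Longrightarrow> linear (\<beta> x)" "\<And>v. smooth_on (\<lambda>x. \<beta> x v) V2"
      "\<And>x v. x \<in> V2 \<inter> ?M \<Longrightarrow> v \<in> tangent_space ?M x \<Longrightarrow> \<theta> (dchart A x v) = \<beta> x v"
      by (rule smooth_formE[OF \<theta>'(1) S(1) A(1) z(1)]) (rule that)
    obtain V3 \<rho> where \<rho>: "z \<in> V3" "defining_function ?M V3 \<rho>"
      using smooth_hypersurfaceE[OF affine_part_hypersurface[OF S(1) A(1)] z(2) open_UNIV UNIV_I] by metis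
    note D = defining_functionD[OF \<rho>(2)]
    obtain \<nu> where \<nu>: "FD \<rho> z \<nu> \<noteq> 0" using D(4)[OF \<rho>(1) z(2)] by blast
    obtain w where w: "w \<in> tangent_space ?M z" "t p = dchart A z w"
      using t(1)[OF p] T_chart[OF S(1) A(1) z(1)] A(2) by auto
    \<comment> \<open>A smooth tangent vector field with value \<open>w\<close> at \<open>z\<close>, so that the contact form does not vanish
      on it near \<open>z\<close>.\<close>
    define e where "e x = w - (FD \<rho> x w / FD \<rho> x \<nu>) *\<^sub>R \<nu>" for x
    define V4 where "V4 = {x \<in> V3. FD \<rho> x \<nu> \<noteq> 0}"
    have V4: "open V4"
      unfolding V4_def using continuous_open_preimage[OF smooth_on_continuous[OF smooth_on_FD[OF D(2,1), of \<nu>]] D(1), of "- {0}"]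
      by (auto simp: vimage_def Int_def)
    have zV4: "z \<in> V4" using \<rho>(1) \<nu> by (simp add: V4_def)
    have eT: "e x \<in> tangent_space ?M x" if "x \<in> V4" "x \<in> ?M" for x
    proof -
      have x: "x \<in> V3" "FD \<rho> x \<nu> \<noteq> 0" using that by (auto simp: V4_def)
      note lin = smooth_on_FD_linear[OF D(2,1) x(1)]
      show ?thesis
        unfolding tangent_space_eq[OF \<rho>(2) x(1) that(2)] e_def
        using x(2) by (simp add: linear_diff[OF lin] linear_scale[OF lin])
    qed
    have ez: "e z = w" using w(1) tangent_space_eq[OF \<rho>(2,1) z(2)] by (simp add: e_def)
    define V5 where "V5 = V1 \<inter> V2 \<inter> V4"
    have V5: "open V5" unfolding V5_def by (intro open_Int \<alpha> \<beta> V4)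
    have se: "smooth_on e V5"
      unfolding e_def
      by (intro smooth_on_diff smooth_on_const smooth_on_scaleR smooth_on_divide V5 smooth_on_mono[OF smooth_on_FD[OF D(2,1)]])
        (auto simp: V5_def V4_def)
    have s\<alpha>: "smooth_on (\<lambda>x. \<alpha> x (e x)) V5"
      by (rule smooth_on_linear_family[OF V5 _ smooth_on_mono[OF \<alpha>(4)] se]) (auto simp: V5_def intro: \<alpha>(3))
    have s\<beta>: "smooth_on (\<lambda>x. \<beta> x (e x)) V5"
      by (rule smooth_on_linear_family[OF V5 _ smooth_on_mono[OF \<beta>(4)] se]) (auto simp: V5_def intro: \<beta>(3))
    define W where "W = {x \<in> V5. \<beta> x (e x) \<noteq> 0}"
    have W: "open W"
      unfolding W_def using continuous_open_preimage[OF smooth_on_continuous[OF s\<beta>] V5, of "- {0}"]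
      by (auto simp: vimage_def Int_def)
    have "\<beta> z (e z) \<noteq> 0" using t(2)[OF p] \<beta>(5)[of z w] \<beta>(2) z w ez by simp
    then have zW: "z \<in> W" using \<alpha>(2) \<beta>(2) zV4 by (simp add: W_def V5_def)
    have sm: "smooth_on (\<lambda>x. \<alpha> x (e x) / \<beta> x (e x)) W"
      by (intro smooth_on_divide W smooth_on_mono[OF s\<alpha>] smooth_on_mono[OF s\<beta>]) (auto simp: W_def)
    have "\<alpha> x (e x) / \<beta> x (e x) = l (chart A x)" if x: "x \<in> W \<inter> ?M" for x
    proof -
      have xV: "x \<in> V1" "x \<in> V2" "x \<in> V4" "x \<in> ?M" "\<beta> x (e x) \<noteq> 0" and xS: "chart A x \<in> S"
        using x by (auto simp: W_def V5_def)
      have "\<omega> (dchart A x (e x)) = l (chart A x) * \<theta> (dchart A x (e x))"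
        by (rule l[OF xS]) (simp add: dchart_in_T_iff[OF S(1) A(1) xS] eT[OF xV(3,4)])
      then show ?thesis using \<alpha>(5)[of x "e x"] \<beta>(5)[of x "e x"] eT[OF xV(3,4)] xV by (simp add: divide_eq_eq)
    qed
    then show "\<exists>A z W F. invertible A \<and> chart A z = p \<and> open W \<and> z \<in> W \<and> smooth_on F W \<and>
        (\<forall>x\<in>W \<inter> affine_part A S. F x = l (chart A x))"
      using A W zW sm by blast
  qed
  then show thesis using l by (rule that)
qed

lemma base_T:
  assumes "smooth_cp_hypersurface S" "strongly_C_convex S" "p \<in> S" "\<tau> \<in> T S p"
  shows "base \<tau> = p"
proof -
  obtain A z where A: "invertible A" "chart A z = p" using ex_chart[OF assms(2,3)] by metis
  then show ?thesis
    using assms(3,4) T_chart[OF assms(1) A(1), of z] base_dchart[OF A(1)] by auto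
qed

theorem theorem6:
  fixes S :: "'n::finite cp set"
    and \<theta> :: "'n cp_tangent \<Rightarrow> complex"
    and Dt :: "('n cp \<Rightarrow> complex) \<Rightarrow> 'n cp_tangent \<Rightarrow> complex"
    and u :: "'n cp \<Rightarrow> complex"
  assumes "CARD('n) \<ge> 2"
    and "smooth_cp_hypersurface S"
    and "strongly_C_convex S"
    and "simply_connected S"
    and "contact_form S \<theta>"
    and "linear_form_operator S Dt"
    and "\<And>v. smooth_function S v \<Longrightarrow> restricts_to_d' S v (Dt v)"
    and "smooth_function S u"
  shows "(\<exists>f g. CR S f \<and> dual_CR S g \<and> (\<forall>p\<in>S. u p = f p + g p)) \<longleftrightarrow>
         (\<exists>l. smooth_function S l \<and> closed_form S (\<lambda>\<tau>. Dt u \<tau> + l (base \<tau>) * \<theta> \<tau>))"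
proof
  note S = assms(2,3)
  have Du: "smooth_form S (T S) (Dt u)" using assms(6,8) unfolding linear_form_operator_def by blast
  have ch: "\<exists>A z. invertible A \<and> chart A z = p" if "p \<in> S" for p by (rule ex_chart[OF S(2) that]) blast
  {
    assume "\<exists>f g. CR S f \<and> dual_CR S g \<and> (\<forall>p\<in>S. u p = f p + g p)"
    then obtain f g where fg: "CR S f" "dual_CR S g" "\<And>p. p \<in> S \<Longrightarrow> u p = f p + g p" by blast
    have f: "smooth_function S f" using fg(1) by (simp add: CR_def)
    define \<omega> where "\<omega> \<tau> = differential S f \<tau> - Dt u \<tau>" for \<tau>
    have H0: "\<omega> \<tau> = 0" if "p \<in> S" "\<tau> \<in> H S p" for p \<tau>
      using CR_plus_dual_CR_differential[OF S fg Du assms(7)[OF assms(8)] that] by (simp add: \<omega>_def)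
    have ext: "\<exists>V \<alpha>. z \<in> V \<and> form_extension S (T S) A \<omega> V \<alpha>" if A: "invertible A" and z: "chart A z \<in> S" for A z
    proof -
      obtain W F where F: "open W" "z \<in> W" "smooth_on F W" "\<And>x. x \<in> W \<inter> affine_part A S \<Longrightarrow> F x = f (chart A x)"
        by (rule smooth_functionE[OF f A z]) (rule that)
      obtain V \<alpha> where V: "open V" "z \<in> V" "\<And>x. x \<in> V \<Longrightarrow> linear (\<alpha> x)" "\<And>v. smooth_on (\<lambda>x. \<alpha> x v) V"
        "\<And>x v. x \<in> V \<inter> affine_part A S \<Longrightarrow> v \<in> tangent_space (affine_part A S) x \<Longrightarrow> Dt u (dchart A x v) = \<alpha> x v"
        by (rule smooth_formE[OF Du S(1) A z]) (rule that)
      have op: "open (V \<inter> W)" using V(1) F(1) by blast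
      have "form_extension S (T S) A \<omega> (V \<inter> W) (\<lambda>x v. FD F x v - \<alpha> x v)"
        unfolding form_extension_def
      proof (intro conjI ballI allI impI)
        show "linear (\<lambda>v. FD F x v - \<alpha> x v)" if "x \<in> V \<inter> W" for x
          by (rule linear_compose_sub) (use that smooth_on_FD_linear[OF F(3,1)] V(3) in auto)
        show "smooth_on (\<lambda>x. FD F x v - \<alpha> x v) (V \<inter> W)" for v
          by (intro smooth_on_diff op smooth_on_mono[OF smooth_on_FD[OF F(3,1)]] smooth_on_mono[OF V(4)]) auto
        fix x v assume x: "x \<in> V \<inter> W \<inter> affine_part A S" and v: "dchart A x v \<in> T S (chart A x)"
        have xS: "chart A x \<in> S" "x \<in> W" "x \<in> affine_part A S" using x by auto
        have vT: "v \<in> tangent_space (affine_part A S) x" using v dchart_in_T_iff[OF S(1) A xS(1)] by simp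
        have "differential S f (dchart A x v) = FD F x v"
          by (rule differential_dchart[OF S(1) A xS(1) vT extension_has_derivative[OF F(3,1) xS(2,3) F(4)]])
        then show "\<omega> (dchart A x v) = FD F x v - \<alpha> x v" using V(5)[of x v] x vT by (simp add: \<omega>_def)
      qed (rule op)
      then show ?thesis using V(2) F(2) by blast
    qed
    obtain l where l: "smooth_function S l" "\<And>p \<tau>. p \<in> S \<Longrightarrow> \<tau> \<in> T S p \<Longrightarrow> \<omega> \<tau> = l p * \<theta> \<tau>"
      by (rule form_vanishing_on_H_eq_multiple[OF S assms(5) ext H0])
        (assumption, assumption, assumption, assumption, rule that)
    have "closed_form S (\<lambda>\<tau>. Dt u \<tau> + l (base \<tau>) * \<theta> \<tau>)"
    proof (rule closed_form_differential[OF S(1) f])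
      fix p \<tau> assume p: "p \<in> S" "\<tau> \<in> T S p"
      show "Dt u \<tau> + l (base \<tau>) * \<theta> \<tau> = differential S f \<tau>"
        using l(2)[OF p] base_T[OF S p] by (simp add: \<omega>_def algebra_simps)
    qed
    then show "\<exists>l. smooth_function S l \<and> closed_form S (\<lambda>\<tau>. Dt u \<tau> + l (base \<tau>) * \<theta> \<tau>)"
      using l(1) by blast
  next
    assume "\<exists>l. smooth_function S l \<and> closed_form S (\<lambda>\<tau>. Dt u \<tau> + l (base \<tau>) * \<theta> \<tau>)"
    then obtain l where l: "closed_form S (\<lambda>\<tau>. Dt u \<tau> + l (base \<tau>) * \<theta> \<tau>)" by blast
    obtain f where f: "\<And>p. p \<in> S \<Longrightarrow> potential S (\<lambda>\<tau>. Dt u \<tau> + l (base \<tau>) * \<theta> \<tau>) p f"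
      by (rule closed_form_has_potential[OF S assms(4) l]) (rule that)
    have sf: "smooth_function S f" by (rule potential_smooth_function[OF f])
    define g where "g p = u p - f p" for p
    have sg: "smooth_function S g"
      unfolding g_def by (rule smooth_function_diff[OF ch assms(8) sf])
    obtain b where b: "is_d_split S u (Dt u) b" using assms(7)[OF assms(8)] unfolding restricts_to_d'_def by blast
    have df: "differential S f \<tau> = Dt u \<tau>" if "p \<in> S" "\<tau> \<in> H S p" for p \<tau>
    proof -
      have "\<theta> \<tau> = 0" using assms(5) that unfolding contact_form_def by blast
      moreover have "\<tau> \<in> T S p" using that(2) H_subset_T by blast
      ultimately show ?thesis using potential_differential[OF S(1) that(1) f[OF that(1)]] by simp
    qed
    have dg: "differential S g \<tau> = b \<tau>" if p: "p \<in> S" and \<tau>: "\<tau> \<in> H S p" for p \<tau>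
    proof -
      obtain A z where A: "invertible A" "chart A z = p" using ex_chart[OF S(2) p] by metis
      have z: "chart A z \<in> S" using A p by simp
      obtain v where v: "v \<in> tangent_space (affine_part A S) z" "\<tau> = dchart A z v"
        using \<tau> H_subset_T T_chart[OF S(1) A(1) z] A(2) by blast
      have "differential S u \<tau> = differential S f \<tau> + differential S g \<tau>"
        unfolding v(2) by (rule differential_add[OF S(1) sf sg A(1) z v(1)]) (simp add: g_def)
      moreover have "differential S u \<tau> = Dt u \<tau> + b \<tau>" using b p \<tau> unfolding is_d_split_def by blast
      ultimately show ?thesis using df[OF p \<tau>] by simp
    qed
    have "CR S f"
      unfolding CR_def
    proof (intro conjI ballI sf)
      fix p \<tau> assume p: "p \<in> S" "\<tau> \<in> H S p"
      show "differential S f (tangent_J \<tau>) = \<i> * differential S f \<tau>"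
        unfolding df[OF p] df[OF p(1) tangent_J_in_H[OF S p]] using b p unfolding is_d_split_def by blast
    qed
    moreover have "dual_CR S g"
      unfolding dual_CR_def
    proof (intro conjI ballI sg)
      fix p \<tau> assume p: "p \<in> S" "\<tau> \<in> H S p"
      show "differential S g (dual_J S \<tau>) = \<i> * differential S g \<tau>"
        unfolding dg[OF p] dg[OF p(1) dual_J_in_H[OF S p]] using b p unfolding is_d_split_def by blast
    qed
    ultimately show "\<exists>f g. CR S f \<and> dual_CR S g \<and> (\<forall>p\<in>S. u p = f p + g p)"
      by (intro exI[of _ f] exI[of _ g]) (simp add: g_def)
  }
qed

end
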